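(* Let $\sigma>0$, let $H:\mathbb{T}^d\times\mathbb{R}^d\to\mathbb{R}$, $(x,p)\mapsto H(x,p)$, be continuously differentiable and let $f,U_0:\mathcal M_1(\mathbb{T}^d)\to\mathcal C(\mathbb{T}^d,\mathbb{R})$. Assume that $H$ is convex in its second argument and that $f$ and $U_0$ are monotone, i.e. for all $\mu,\nu\in\mathcal M_1(\mathbb{T}^d)$, $\langle f(\mu)-f(\nu),\mu-\nu\rangle\ge0$ and $\langle U_0(\mu)-U_0(\nu),\mu-\nu\rangle\ge0$. Then there exists at most one M-solution $U$ to the master equation $$\partial_tU-\langle\nabla_\mu U(t,\mu,x,\cdot),\mathrm{div}(D_pH(\cdot,\nabla_xU(t,\mu,\cdot))\mu)+\sigma\Delta\mu\rangle-\sigma\Delta_xU+H(x,\nabla_xU)=f(\mu)(x)$$ in $(0,\infty)\times\mathcal M_1(\mathbb{T}^d)\times\mathbb{T}^d$ with $U|_{t=0}=U_0$. Moreover, if such a $U$ exists, then for all $t\ge0$, $U(t,\cdot)$ is monotone, i.e. $\langle U(t,\mu)-U(t,\nu),\mu-\nu\rangle\ge0$ for all $\mu,\nu\in\mathcal M_1(\mathbb{T}^d)$.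
   Context: $\mathbb{T}^d=\mathbb{R}^d/\mathbb{Z}^d$. $\mathcal M_1(\mathbb{T}^d)$ is the set of non-negative Borel measures on $\mathbb{T}^d$ of mass at most one, endowed with the weak topology (it is compact); equivalently with the distance $\mathcal W_1(\mu,\nu)=\sup\{\int\phi\,d(\mu-\nu):\mathrm{Lip}(\phi)\le1,\|\phi\|_\infty\le1\}$. $\langle\cdot,\cdot\rangle$ is the duality pairing extending the $L^2(\mathbb{T}^d)$ scalar product; in particular, for $g\in\mathcal C^2$, $b$ continuous, $\langle g,-\mathrm{div}(b\mu)-\sigma\Delta\mu\rangle=\int\nabla g\cdot b\,d\mu-\sigma\int\Delta g\,d\mu$. We write $U(t,\mu)$ or $U(t,\mu,\cdot)$ for the function $x\mapsto U(t,\mu,x)$. $\nabla_\mu$ in the equation is only a formal derivative with respect to the measure; the meaning of solution is the following. A continuous function $U:\mathbb{R}_+\times\mathcal M_1(\mathbb{T}^d)\times\mathbb{T}^d\to\mathbb{R}$ is an M-solution if: (i) for every $t>0$ and $\mu\in\mathcal M_1(\mathbb{T}^d)$, $x\mapsto U(t,\mu,x)$ belongs to $\mathcal C^2(\mathbb{T}^d,\mathbb{R})$; (ii) $(t,\mu,x)\mapsto\nabla_xU(t,\mu,x)$ is bounded on $[0,T]\times\mathcal M_1(\mathbb{T}^d)\times\mathbb{T}^d$ for every $T>0$; (iii) for every $T>0$, $\phi\in\mathcal C^2(\mathbb{T}^d,\mathbb{R})$, $\nu\in\mathcal M_1(\mathbb{T}^d)$, $\vartheta\in\mathcal C^1(\mathbb{R})$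 and every $(t_*,\mu_* )\in(0,T]\times\mathcal M_1(\mathbb{T}^d)$ which is a point of strict minimum of $(t,\mu)\mapsto\langle U(t,\mu,\cdot)-\phi,\mu-\nu\rangle-\vartheta(t)$ on $[0,T]\times\mathcal M_1(\mathbb{T}^d)$, $$\vartheta'(t_* )\ge\langle f(\mu_* )-H(\cdot,\nabla_xU(t_*,\mu_* ))+\sigma\Delta_xU(t_*,\mu_*,\cdot),\mu_*-\nu\rangle+\langle U(t_*,\mu_*,\cdot)-\phi,-\mathrm{div}(D_pH(\cdot,\nabla_xU(t_*,\mu_*,\cdot))\mu_* )-\sigma\Delta\mu_*\rangle.$$ *)

theory Defs
  imports "HOL-Analysis.Analysis"
begin

section \<open>The torus\<close>

definition lattice_equiv :: "real^'n \<Rightarrow> real^'n \<Rightarrow> bool" where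
  "lattice_equiv x y \<longleftrightarrow> (\<forall>i. x $ i - y $ i \<in> \<int>)"

lemma equivp_lattice_equiv: "equivp lattice_equiv"
proof (rule equivpI)
  show "reflp lattice_equiv"
    by (simp add: reflp_def lattice_equiv_def)
  show "symp lattice_equiv"
    unfolding symp_def lattice_equiv_def by (metis Ints_minus minus_diff_eq)
  show "transp lattice_equiv"
  proof (rule transpI)
    fix x y z :: "real^'n"
    assume "lattice_equiv x y" "lattice_equiv y z"
    then have "(x $ i - y $ i) + (y $ i - z $ i) \<in> \<int>" for i
      unfolding lattice_equiv_def by (blast intro: Ints_add)
    then show "lattice_equiv x z"
      by (simp add: lattice_equiv_def)
  qed
qed

quotient_type 'n torus = "real^('n::finite)" / lattice_equiv
  morphisms rep_torus to_torus
  by (rule equivp_lattice_equiv)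

instantiation torus :: (finite) topological_space
begin

text \<open>The quotient topology.\<close>

definition open_torus :: "'a torus set \<Rightarrow> bool" where
  "open_torus S \<longleftrightarrow> open (to_torus -` S)"

instance
  by standard (auto simp: open_torus_def vimage_Union)

end

section \<open>Differential calculus on the torus\<close>

text \<open>A function on the torus is differentiated through its periodic lift to the covering space.\<close>

definition torus_grad :: "('n::finite torus \<Rightarrow> real) \<Rightarrow> 'n torus \<Rightarrow> real^'n" where
  "torus_grad g x = (THE D. \<forall>y. to_torus y = x \<longrightarrow> GDERIV (\<lambda>z. g (to_torus z)) y :> D)"

definition torus_hess :: "('n::finite torus \<Rightarrow> real) \<Rightarrow> 'n torus \<Rightarrow> real^'n^'n" where
  "torus_hess g x = (THE M. \<forall>y. to_torus y = x \<longrightarrow>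
     ((\<lambda>z. torus_grad g (to_torus z)) has_derivative (\<lambda>h. M *v h)) (at y))"

definition torus_lap :: "('n::finite torus \<Rightarrow> real) \<Rightarrow> 'n torus \<Rightarrow> real" where
  "torus_lap g x = trace (torus_hess g x)"

definition torus_differentiable :: "('n::finite torus \<Rightarrow> real) \<Rightarrow> bool" where
  "torus_differentiable g \<longleftrightarrow> (\<forall>y. (\<lambda>z. g (to_torus z)) differentiable (at y))"

definition torus_C2 :: "('n::finite torus \<Rightarrow> real) \<Rightarrow> bool" where
  "torus_C2 g \<longleftrightarrow>
     torus_differentiable g \<and> continuous_on UNIV (torus_grad g) \<and>
     (\<forall>y. (\<lambda>z. torus_grad g (to_torus z)) differentiable (at y)) \<and>
     continuous_on UNIV (torus_hess g)"

lemma to_torus_eq_iff: "to_torus x = to_torus y \<longleftrightarrow> (\<forall>i. x $ i - y $ i \<in> \<int>)"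
  by (simp add: torus.abs_eq_iff lattice_equiv_def)

lemma to_torus_translate:
  assumes "to_torus y = to_torus y'"
  shows "to_torus (z + (y - y')) = to_torus z"
  using assms by (simp add: to_torus_eq_iff)

lemma has_derivative_torus_translate:
  fixes g :: "'n::finite torus \<Rightarrow> 'b::real_normed_vector"
  assumes "to_torus y = to_torus y'"
    and "((\<lambda>z. g (to_torus z)) has_derivative F) (at y)"
  shows "((\<lambda>z. g (to_torus z)) has_derivative F) (at y')"
proof -
  have "((\<lambda>z. z + (y - y')) has_derivative (\<lambda>h. h)) (at y')"
    by (auto intro!: derivative_eq_intros)
  moreover have "((\<lambda>z. g (to_torus z)) has_derivative F) (at (y' + (y - y')))"
    using assms(2) by simp
  ultimately have "((\<lambda>z. g (to_torus (z + (y - y')))) has_derivative (\<lambda>h. F h)) (at y')"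
    by (rule has_derivative_compose)
  then show ?thesis
    by (simp add: to_torus_translate[OF assms(1)])
qed

text \<open>The definite descriptions above do not depend on the representative.\<close>

lemma torus_grad_eqI:
  assumes "GDERIV (\<lambda>z. g (to_torus z)) y :> D"
  shows "torus_grad g (to_torus y) = D"
  unfolding torus_grad_def
proof (rule the_equality)
  show "\<forall>y'. to_torus y' = to_torus y \<longrightarrow> GDERIV (\<lambda>z. g (to_torus z)) y' :> D"
    using assms has_derivative_torus_translate[of y _ g] unfolding gderiv_def by metis
next
  fix D'
  assume "\<forall>y'. to_torus y' = to_torus y \<longrightarrow> GDERIV (\<lambda>z. g (to_torus z)) y' :> D'"
  then have "(\<lambda>h. h \<bullet> D') = (\<lambda>h. h \<bullet> D)"
    using assms has_derivative_unique unfolding gderiv_def by blast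
  then show "D' = D"
    by (metis vector_eq_ldot)
qed

lemma torus_hess_eqI:
  assumes "((\<lambda>z. torus_grad g (to_torus z)) has_derivative (\<lambda>h. M *v h)) (at y)"
  shows "torus_hess g (to_torus y) = M"
  unfolding torus_hess_def
proof (rule the_equality)
  show "\<forall>y'. to_torus y' = to_torus y \<longrightarrow>
      ((\<lambda>z. torus_grad g (to_torus z)) has_derivative (\<lambda>h. M *v h)) (at y')"
    using assms has_derivative_torus_translate[of y _ "torus_grad g"] by metis
next
  fix M'
  assume "\<forall>y'. to_torus y' = to_torus y \<longrightarrow>
      ((\<lambda>z. torus_grad g (to_torus z)) has_derivative (\<lambda>h. M' *v h)) (at y')"
  then have "(\<lambda>h. M' *v h) = (\<lambda>h. M *v h)"
    using assms has_derivative_unique by blast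
  then show "M' = M"
    by (metis matrix_eq)
qed

definition C1_hamiltonian :: "('n::finite torus \<Rightarrow> real^'n \<Rightarrow> real) \<Rightarrow> bool" where
  "C1_hamiltonian H \<longleftrightarrow>
     (\<exists>D :: (real^'n) \<times> (real^'n) \<Rightarrow> (real^'n) \<times> (real^'n).
        (\<forall>w. GDERIV (\<lambda>(y, p). H (to_torus y) p) w :> D w) \<and> continuous_on UNIV D)"

definition DpH :: "('n::finite torus \<Rightarrow> real^'n \<Rightarrow> real) \<Rightarrow> 'n torus \<Rightarrow> real^'n \<Rightarrow> real^'n" where
  "DpH H x p = (THE D. GDERIV (H x) p :> D)"

section \<open>Measures of mass at most one\<close>

definition M1 :: "'n::finite torus measure set" where
  "M1 = {\<mu>. sets \<mu> = sets borel \<and> emeasure \<mu> UNIV \<le> 1}"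

text \<open>The coarsest topology on \<^term>\<open>M1\<close> for which integration against every
  continuous function is continuous.\<close>

definition M1_topology :: "'n::finite torus measure topology" where
  "M1_topology = topology_generated_by
     {{\<mu> \<in> M1. (\<integral>x. \<phi> x \<partial>\<mu>) \<in> V} | \<phi> V. continuous_on UNIV \<phi> \<and> open (V :: real set)}"

lemma topspace_M1_topology: "topspace M1_topology = M1"
proof -
  have "M1 \<in> {{\<mu> \<in> M1. (\<integral>x. \<phi> x \<partial>\<mu>) \<in> V} | (\<phi> :: 'a torus \<Rightarrow> real) V.
      continuous_on UNIV \<phi> \<and> open (V :: real set)}"
    by (auto intro!: exI[of _ "\<lambda>_. 0"] exI[of _ UNIV])
  then show ?thesis
    unfolding M1_topology_def topology_generated_by_topspace by blast
qed

text \<open>The pairing of \<open>g\<close> with \<open>\<mu> - \<nu>\<close>.\<close>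

definition pair_diff ::
  "('n::finite torus \<Rightarrow> real) \<Rightarrow> 'n torus measure \<Rightarrow> 'n torus measure \<Rightarrow> real" where
  "pair_diff g \<mu> \<nu> = (\<integral>x. g x \<partial>\<mu>) - (\<integral>x. g x \<partial>\<nu>)"

text \<open>The pairing of \<open>g\<close> with the distribution \<open>- div (b \<mu>) - \<sigma> \<Delta>\<mu>\<close>.\<close>

definition pair_FP ::
  "real \<Rightarrow> ('n::finite torus \<Rightarrow> real) \<Rightarrow> ('n torus \<Rightarrow> real^'n) \<Rightarrow> 'n torus measure \<Rightarrow> real" where
  "pair_FP \<sigma> g b \<mu> = (\<integral>x. torus_grad g x \<bullet> b x \<partial>\<mu>) - \<sigma> * (\<integral>x. torus_lap g x \<partial>\<mu>)"

definition monotone_M1 :: "('n::finite torus measure \<Rightarrow> 'n torus \<Rightarrow> real) \<Rightarrow> bool" where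
  "monotone_M1 F \<longleftrightarrow> (\<forall>\<mu>\<in>M1. \<forall>\<nu>\<in>M1. pair_diff (\<lambda>x. F \<mu> x - F \<nu> x) \<mu> \<nu> \<ge> 0)"

section \<open>M-solutions\<close>

definition strict_min_on :: "'a set \<Rightarrow> ('a \<Rightarrow> real) \<Rightarrow> 'a \<Rightarrow> bool" where
  "strict_min_on S F a \<longleftrightarrow> a \<in> S \<and> (\<forall>b\<in>S. b \<noteq> a \<longrightarrow> F a < F b)"

text \<open>Boundedness of the gradient on \<open>[0, T]\<close> includes that the gradient exists at time 0.\<close>

definition M_solution ::
  "real \<Rightarrow> ('n::finite torus \<Rightarrow> real^'n \<Rightarrow> real) \<Rightarrow> ('n torus measure \<Rightarrow> 'n torus \<Rightarrow> real) \<Rightarrow>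
   (real \<Rightarrow> 'n torus measure \<Rightarrow> 'n torus \<Rightarrow> real) \<Rightarrow> bool" where
  "M_solution \<sigma> H f U \<longleftrightarrow>
     continuous_map (prod_topology (top_of_set {0..}) (prod_topology M1_topology euclidean))
       euclidean (\<lambda>(t, \<mu>, x). U t \<mu> x) \<and>
     (\<forall>t>0. \<forall>\<mu>\<in>M1. torus_C2 (U t \<mu>)) \<and>
     (\<forall>T>0. \<exists>C. \<forall>t\<in>{0..T}. \<forall>\<mu>\<in>M1.
        torus_differentiable (U t \<mu>) \<and> (\<forall>x. norm (torus_grad (U t \<mu>) x) \<le> C)) \<and>
     (\<forall>T>0. \<forall>\<phi>. \<forall>\<nu>\<in>M1. \<forall>\<theta> :: real \<Rightarrow> real. \<forall>t\<in>{0<..T}. \<forall>\<mu>\<in>M1.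
        torus_C2 \<phi> \<longrightarrow> \<theta> C1_differentiable_on UNIV \<longrightarrow>
        strict_min_on ({0..T} \<times> M1)
          (\<lambda>(s, m). pair_diff (\<lambda>x. U s m x - \<phi> x) m \<nu> - \<theta> s) (t, \<mu>) \<longrightarrow>
        deriv \<theta> t \<ge>
          pair_diff (\<lambda>x. f \<mu> x - H x (torus_grad (U t \<mu>) x) + \<sigma> * torus_lap (U t \<mu>) x) \<mu> \<nu> +
          pair_FP \<sigma> (\<lambda>x. U t \<mu> x - \<phi> x) (\<lambda>x. DpH H x (torus_grad (U t \<mu>) x)) \<mu>)"

end

theory Submission
  imports Defs "HOL-Probability.Helly_Selection" "HOL-Probability.Probability_Mass_Function"
begin

text \<open>
For M-solutions \<open>U\<close> and \<open>V\<close> with the same initial datum consider the pairing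
\<open>W (t, s, \<mu>, \<nu>) = \<langle>U (t, \<mu>) - V (s, \<nu>), \<mu> - \<nu>\<rangle>\<close>.  Both assertions follow from
\<open>W (t, t, \<mu>, \<nu>) \<ge> 0\<close>.  Monotonicity is the case \<open>U = V\<close>.  Uniqueness is Minty's argument: with
\<open>\<nu> = (1 - p) \<mu> + p m\<close> the pairing is \<open>p \<langle>U (t, \<mu>) - V (t, \<nu>), \<mu> - m\<rangle>\<close>; divide by \<open>p\<close> and let
\<open>p\<close> tend to 0 to get \<open>\<langle>U (t, \<mu>) - V (t, \<mu>), \<mu> - m\<rangle> \<ge> 0\<close>, and then equality by exchanging \<open>U\<close> and
\<open>V\<close>.  Since total mass below one is allowed, \<open>m\<close> may be the zero measure or a Dirac mass, and these
two choices give \<open>U (t, \<mu>, x) = V (t, \<mu>, x)\<close>.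

To see that \<open>W (T, T, \<mu>0, \<nu>0) < 0\<close> is impossible (\<open>M_solutions_cross_monotone\<close>), minimise
\<open>W + k (t - s)\<^sup>2 + \<gamma> (t + s)\<close> over \<open>[0, T]\<^sup>2\<close> and pairs of measures, with \<open>\<gamma> > 0\<close> small and \<open>k\<close>
large.  A large \<open>k\<close> keeps \<open>t\<close> and \<open>s\<close> close, so neither of them is 0 because the initial datum is
monotone.  Minimality in \<open>(t, \<mu>)\<close> is a test of \<open>U\<close> with test function \<open>V (s, \<nu>)\<close>, minimality in
\<open>(s, \<nu>)\<close> is a test of \<open>V\<close> with test function \<open>U (t, \<mu>)\<close>.  In the sum of the two inequalities the
penalty terms cancel, the Laplacians acting on the functions cancel those acting on the measures,
the Hamiltonian terms have a sign by convexity and the couplings by monotonicity of \<open>f\<close>.  What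
remains is \<open>- 2 \<gamma> \<ge> 0\<close>.

The definition of an M-solution tests strict minima only, and the test functions are linear in the
measure.  A minimum is made strict by a small generic linear perturbation, in the spirit of
Stegall's variational principle (\<open>linear_perturbation_strict_min\<close>, a Baire category argument).  Here
the perturbations are the time variables and the integrals against series of trigonometric waves
with weights so small that the series are \<open>C\<^sup>2\<close>, with derivatives bounded by the size of the
coefficients; they spoil the inequality above by an arbitrarily small amount.  The principle
needs two facts about measures of mass at most one.  Waves separate them, by the
Stone--Weierstrass theorem (\<open>M1_eq_if_wave_integrals_eq\<close>).  And they are weakly sequentially compact
(\<open>M1_seq_compact\<close>): a Borel section of a space-filling curve carries them to the unit interval,
Helly's selection theorem yields a limit there, and the curve carries the limit back to the torus.
\<close>

section \<open>Generic linear perturbations have strict minima\<close>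

text \<open>The hypothesis combines compactness of \<open>X\<close> and continuity of \<open>G\<close> along sequences, so that no
topology on \<open>X\<close> has to be named.\<close>

lemma attains_min_if_seq_compact:
  fixes G :: "'a \<Rightarrow> real"
  assumes "X \<noteq> {}"
    and cpt: "\<And>u::nat \<Rightarrow> 'a. (\<And>n. u n \<in> X) \<Longrightarrow>
      \<exists>x\<in>X. \<exists>r. strict_mono r \<and> (\<lambda>n. G (u (r n))) \<longlonglongrightarrow> G x"
  shows "\<exists>x\<in>X. \<forall>z\<in>X. G x \<le> G z"
proof -
  have bdd: "bdd_below (G ` X)"
  proof (rule ccontr)
    assume "\<not> bdd_below (G ` X)"
    then have "\<exists>x\<in>X. G x < - real n" for n
      unfolding bdd_below_def by (force simp: not_le)
    then obtain u where u: "\<And>n. u n \<in> X" "\<And>n. G (u n) < - real n"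
      by metis
    from cpt[of u, OF u(1)] obtain x r where r: "strict_mono r" "(\<lambda>n. G (u (r n))) \<longlonglongrightarrow> G x"
      by blast
    have "real n \<le> - G (u (r n))" for n
    proof -
      have "n \<le> r n"
        using r(1) by (rule strict_mono_imp_increasing)
      then show ?thesis
        using u(2)[of "r n"] by linarith
    qed
    moreover have "(\<lambda>n. - G (u (r n))) \<longlonglongrightarrow> - G x"
      using r(2) by (rule tendsto_minus)
    ultimately have "filterlim (\<lambda>n. - G (u (r n))) at_top sequentially"
      using filterlim_real_sequentially by (rule_tac filterlim_at_top_mono) auto
    with \<open>(\<lambda>n. - G (u (r n))) \<longlonglongrightarrow> - G x\<close> show False
      using not_tendsto_and_filterlim_at_infinity[OF _ _ filterlim_at_top_imp_at_infinity]
        trivial_limit_sequentially by blast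
  qed
  define m where "m = Inf (G ` X)"
  have "\<exists>x\<in>X. G x < m + 1 / Suc n" for n
    using cInf_lessD[of "G ` X" "m + 1 / Suc n"] \<open>X \<noteq> {}\<close> unfolding m_def by fastforce
  then obtain u where u: "\<And>n. u n \<in> X" "\<And>n. G (u n) < m + 1 / Suc n"
    by metis
  from cpt[of u, OF u(1)] obtain x r where x: "x \<in> X" and r: "strict_mono r" "(\<lambda>n. G (u (r n))) \<longlonglongrightarrow> G x"
    by blast
  have "(\<lambda>n. m + 1 / Suc (r n)) \<longlonglongrightarrow> m + 0"
    using LIMSEQ_subseq_LIMSEQ[OF LIMSEQ_Suc[OF lim_1_over_n] r(1)]
    by (intro tendsto_intros) (simp add: o_def)
  then have "G x \<le> m + 0"
    using r(2) u(2) by (intro LIMSEQ_le[OF r(2)]) (auto intro: less_imp_le)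
  moreover have "m \<le> G z" if "z \<in> X" for z
    unfolding m_def using bdd that by (simp add: cInf_lower)
  ultimately show ?thesis
    using x by force
qed

text \<open>Let \<open>A y\<close> be the set of minimisers of \<open>F + L y\<close>.  For a direction \<open>d\<close> and a size \<open>n\<close>, the parameters
\<open>y\<close> for which \<open>L d\<close> oscillates by less than \<open>1 / (n + 1)\<close> on \<open>A y\<close> form an open set, since minimisers
for converging parameters accumulate at minimisers.  The set is dense: replacing \<open>y\<close> by
\<open>y + t d\<close> with small \<open>t > 0\<close> favours small values of \<open>L d\<close>, so that the new minimisers accumulate at
points of \<open>A y\<close> where \<open>L d\<close> is minimal, and these share one value of \<open>L d\<close>.  By Baire's
theorem some small \<open>y\<close> lies in all these sets, and then \<open>A y\<close> is a single point because the directions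
separate points.\<close>

theorem linear_perturbation_strict_min:
  fixes X :: "'a set" and F :: "'a \<Rightarrow> real" and L :: "'a \<Rightarrow> 'b::banach \<Rightarrow> real"
  assumes ne: "X \<noteq> {}"
    and lin: "\<And>x. x \<in> X \<Longrightarrow> linear (L x)"
    and bnd: "\<And>x y. x \<in> X \<Longrightarrow> \<bar>L x y\<bar> \<le> C * norm y"
    and cpt: "\<And>u::nat \<Rightarrow> 'a. (\<And>n. u n \<in> X) \<Longrightarrow>
      \<exists>x\<in>X. \<exists>r. strict_mono r \<and> (\<lambda>n. F (u (r n))) \<longlonglongrightarrow> F x \<and>
        (\<forall>y. (\<lambda>n. L (u (r n)) y) \<longlonglongrightarrow> L x y)"
    and D: "countable D"
    and sep: "\<And>x x'. x \<in> X \<Longrightarrow> x' \<in> X \<Longrightarrow> (\<And>d. d \<in> D \<Longrightarrow> L x d = L x' d) \<Longrightarrow> x = x'"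
    and "\<epsilon> > 0"
  shows "\<exists>y x. norm y < \<epsilon> \<and> strict_min_on X (\<lambda>x. F x + L x y) x"
proof -
  define A where "A y = {x\<in>X. \<forall>z\<in>X. F x + L x y \<le> F z + L z y}" for y
  have A_ne: "A y \<noteq> {}" for y
  proof -
    have "\<exists>x\<in>X. \<forall>z\<in>X. F x + L x y \<le> F z + L z y"
    proof (rule attains_min_if_seq_compact[OF ne])
      fix u :: "nat \<Rightarrow> 'a" assume "\<And>n. u n \<in> X"
      from cpt[of u, OF this] obtain x r where "x \<in> X" "strict_mono r"
        "(\<lambda>n. F (u (r n)) + L (u (r n)) y) \<longlonglongrightarrow> F x + L x y"
        using tendsto_add by fast
      then show "\<exists>x\<in>X. \<exists>r. strict_mono r \<and> (\<lambda>n. F (u (r n)) + L (u (r n)) y) \<longlonglongrightarrow> F x + L x y"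
        by blast
    qed
    then show ?thesis by (auto simp: A_def)
  qed
  have A_lim: "\<exists>x\<in>A y. \<exists>r. strict_mono r \<and> (\<forall>d. (\<lambda>n. L (u (r n)) d) \<longlonglongrightarrow> L x d)"
    if u: "\<And>n. u n \<in> A (v n)" and v: "v \<longlonglongrightarrow> y" for u v y
  proof -
    have uX: "u n \<in> X" for n using u by (auto simp: A_def)
    from cpt[of u, OF uX] obtain x r where x: "x \<in> X" and r: "strict_mono r"
      and F: "(\<lambda>n. F (u (r n))) \<longlonglongrightarrow> F x" and L: "\<And>y. (\<lambda>n. L (u (r n)) y) \<longlonglongrightarrow> L x y"
      by blast
    have vr: "(\<lambda>n. v (r n)) \<longlonglongrightarrow> y"
      using LIMSEQ_subseq_LIMSEQ[OF v r] by (simp add: o_def)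
    have to0: "(\<lambda>n. L (w n) (v (r n) - y)) \<longlonglongrightarrow> 0" if "\<And>n. w n \<in> X" for w
    proof (rule Lim_null_comparison)
      show "\<forall>\<^sub>F n in sequentially. norm (L (w n) (v (r n) - y)) \<le> C * norm (v (r n) - y)"
        using bnd[OF that] by auto
      show "(\<lambda>n. C * norm (v (r n) - y)) \<longlonglongrightarrow> 0"
        using vr by (intro tendsto_mult_right_zero tendsto_norm_zero) (simp add: LIM_zero_iff)
    qed
    have split: "L z (v (r n)) = L z y + L z (v (r n) - y)" if "z \<in> X" for z n
      using linear_add[OF lin[OF that], of y "v (r n) - y"] by simp
    have lhs: "(\<lambda>n. F (u (r n)) + L (u (r n)) (v (r n))) \<longlonglongrightarrow> F x + (L x y + 0)"
      unfolding split[OF uX] by (intro tendsto_add F L to0 uX)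
    have "F x + L x y \<le> F z + L z y" if z: "z \<in> X" for z
    proof -
      have rhs: "(\<lambda>n. F z + L z (v (r n))) \<longlonglongrightarrow> F z + (L z y + 0)"
        unfolding split[OF z] by (intro tendsto_add tendsto_const to0 z)
      have "F x + (L x y + 0) \<le> F z + (L z y + 0)"
        by (rule LIMSEQ_le[OF lhs rhs]) (use u z in \<open>auto simp: A_def\<close>)
      then show ?thesis by simp
    qed
    then have "x \<in> A y" using x by (auto simp: A_def)
    then show ?thesis using r L by blast
  qed
  define G where "G = (\<lambda>(d, n). {y. \<forall>x\<in>A y. \<forall>x'\<in>A y. \<bar>L x d - L x' d\<bar> < 1 / Suc n})"
  have bad_lim: "\<exists>x\<in>A y. \<exists>x'\<in>A y. \<exists>u u'. \<exists>r. strict_mono r \<and> (\<forall>n. u n \<in> A (v n) \<and> u' n \<in> A (v n)) \<and>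
       (\<lambda>n. L (u (r n)) d) \<longlonglongrightarrow> L x d \<and> (\<lambda>n. L (u' (r n)) d) \<longlonglongrightarrow> L x' d \<and>
       \<bar>L x d - L x' d\<bar> \<ge> 1 / Suc k"
    if v: "v \<longlonglongrightarrow> y" and bad: "\<And>n. v n \<notin> G (d, k)" for v y d k
  proof -
    from bad have "\<exists>x\<in>A (v n). \<exists>x'\<in>A (v n). \<bar>L x d - L x' d\<bar> \<ge> 1 / Suc k" for n
      by (fastforce simp: G_def not_less)
    then obtain u u' where u: "\<And>n. u n \<in> A (v n)" and u': "\<And>n. u' n \<in> A (v n)"
      and far: "\<And>n. \<bar>L (u n) d - L (u' n) d\<bar> \<ge> 1 / Suc k"
      by metis
    from A_lim[OF u v] obtain x r where x: "x \<in> A y" and r: "strict_mono r"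
      and Lx: "\<And>d. (\<lambda>n. L (u (r n)) d) \<longlonglongrightarrow> L x d" by blast
    have "(\<lambda>n. v (r n)) \<longlonglongrightarrow> y"
      using LIMSEQ_subseq_LIMSEQ[OF v r] by (simp add: o_def)
    from A_lim[of "\<lambda>n. u' (r n)", OF u' this] obtain x' r' where x': "x' \<in> A y" and r': "strict_mono r'"
      and Lx': "\<And>d. (\<lambda>n. L (u' (r (r' n))) d) \<longlonglongrightarrow> L x' d" by blast
    have L1: "(\<lambda>n. L (u (r (r' n))) d) \<longlonglongrightarrow> L x d"
      using LIMSEQ_subseq_LIMSEQ[OF Lx r'] by (simp add: o_def)
    have "(\<lambda>n. \<bar>L (u (r (r' n))) d - L (u' (r (r' n))) d\<bar>) \<longlonglongrightarrow> \<bar>L x d - L x' d\<bar>"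
      by (intro tendsto_rabs tendsto_diff L1 Lx')
    then have "\<bar>L x d - L x' d\<bar> \<ge> 1 / Suc k"
      using far by (intro LIMSEQ_le_const) auto
    then show ?thesis
      using u u' L1 Lx' strict_mono_o[OF r r']
      by (intro bexI[OF _ x] bexI[OF _ x'] exI[of _ u] exI[of _ u'] exI[of _ "\<lambda>n. r (r' n)"])
        (auto simp: o_def)
  qed
  have G_open: "open (G (d, k))" for d k
  proof -
    have "closed (- G (d, k))"
      unfolding closed_sequential_limits
    proof (intro allI impI)
      fix v y assume "(\<forall>n. v n \<in> - G (d, k)) \<and> v \<longlonglongrightarrow> y"
      then have "\<exists>x\<in>A y. \<exists>x'\<in>A y. \<bar>L x d - L x' d\<bar> \<ge> 1 / Suc k"
        using bad_lim[of v y d k] by blast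
      then show "y \<in> - G (d, k)"
        by (force simp: G_def)
    qed
    then show ?thesis by (simp add: open_closed)
  qed
  have G_dense: "closure (G (d, k)) = UNIV" for d k
  proof -
    have "y \<in> closure (G (d, k))" for y
    proof (rule ccontr)
      assume y: "y \<notin> closure (G (d, k))"
      define v where "v = (\<lambda>n. y + (1 / real (Suc n)) *\<^sub>R d)"
      have "(\<lambda>n. 1 / real (Suc n)) \<longlonglongrightarrow> 0"
        using LIMSEQ_Suc[OF lim_1_over_n] by simp
      then have "v \<longlonglongrightarrow> y + 0 *\<^sub>R d"
        unfolding v_def by (intro tendsto_intros)
      then have v: "v \<longlonglongrightarrow> y" by simp
      have "eventually (\<lambda>n. v n \<in> - closure (G (d, k))) sequentially"
        using v y by (intro topological_tendstoD) auto
      then obtain N where N: "\<And>n. n \<ge> N \<Longrightarrow> v n \<notin> G (d, k)"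
        unfolding eventually_sequentially using closure_subset by blast
      have vN: "(\<lambda>n. v (n + N)) \<longlonglongrightarrow> y"
        using v by (rule LIMSEQ_ignore_initial_segment)
      from bad_lim[OF vN, of d k] N obtain x x' u u' r where
        x: "x \<in> A y" "x' \<in> A y" and u: "\<And>n. u n \<in> A (v (n + N))" "\<And>n. u' n \<in> A (v (n + N))"
        and Lx: "(\<lambda>n. L (u (r n)) d) \<longlonglongrightarrow> L x d" and Lx': "(\<lambda>n. L (u' (r n)) d) \<longlonglongrightarrow> L x' d"
        and far: "\<bar>L x d - L x' d\<bar> \<ge> 1 / Suc k"
        by (metis le_add2)
      \<comment> \<open>Add the minimality of \<open>a\<close> for the shifted parameter and that of \<open>z\<close> for \<open>y\<close>.\<close>
      have le: "L a d \<le> L z d" if a: "a \<in> A (v n)" and z: "z \<in> A y" for a z n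
      proof -
        have aX: "a \<in> X" and zX: "z \<in> X" using a z by (auto simp: A_def)
        have sp: "L w (v n) = L w y + (1 / Suc n) * L w d" if "w \<in> X" for w
          unfolding v_def using linear_add[OF lin[OF that]] linear_scale[OF lin[OF that]] by simp
        have "F a + (L a y + (1 / Suc n) * L a d) \<le> F z + (L z y + (1 / Suc n) * L z d)"
          using a zX sp[OF aX] sp[OF zX] unfolding A_def by fastforce
        moreover have "F z + L z y \<le> F a + L a y"
          using z aX unfolding A_def by blast
        ultimately have "(1 / Suc n) * L a d \<le> (1 / Suc n) * L z d" by linarith
        then show ?thesis by (rule mult_left_le_imp_le) simp
      qed
      have "L x d \<le> L x' d" using le[OF u(1) x(2)] by (intro LIMSEQ_le_const2[OF Lx]) auto
      moreover have "L x' d \<le> L x d" using le[OF u(2) x(1)] by (intro LIMSEQ_le_const2[OF Lx']) auto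
      ultimately show False using far by simp
    qed
    then show ?thesis by blast
  qed
  have "Met_TC.mtopology closure_of (\<Inter>(G ` (D \<times> UNIV))) = UNIV"
  proof (rule Met_TC.metric_Baire_category)
    show "Met_TC.mcomplete TYPE('b)"
      by (simp add: mcomplete_iff_complete complete_UNIV)
    show "countable (G ` (D \<times> UNIV))" using D by auto
  qed (auto simp: G_open G_dense)
  then have "0 \<in> closure (\<Inter>(G ` (D \<times> UNIV)))" by simp
  then obtain y where y: "y \<in> \<Inter>(G ` (D \<times> UNIV))" and "dist y 0 < \<epsilon>"
    using closure_approachable \<open>\<epsilon> > 0\<close> by metis
  obtain x where x: "x \<in> A y" using A_ne by blast
  have uniq: "z = x" if z: "z \<in> A y" for z
  proof (rule sep)
    show "z \<in> X" "x \<in> X" using x z by (auto simp: A_def)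
    fix d assume "d \<in> D"
    then have "\<bar>L z d - L x d\<bar> < 1 / Suc n" for n
      using y x z by (force simp: G_def)
    then have "\<bar>L z d - L x d\<bar> \<le> 0"
      using LIMSEQ_le_const[OF LIMSEQ_Suc[OF lim_1_over_n], of "\<bar>L z d - L x d\<bar>"] by (metis less_imp_le)
    then show "L z d = L x d" by simp
  qed
  have "F x + L x y < F z + L z y" if "z \<in> X" "z \<noteq> x" for z
  proof (rule ccontr)
    assume "\<not> ?thesis"
    then have "z \<in> A y" using x that unfolding A_def by force
    then show False using uniq that by blast
  qed
  then have "strict_min_on X (\<lambda>x. F x + L x y) x"
    using x by (auto simp: strict_min_on_def A_def)
  then show ?thesis using \<open>dist y 0 < \<epsilon>\<close> by auto
qed

section \<open>The torus as a compact space\<close>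

lemma to_torus_rep_torus [simp]: "to_torus (rep_torus x) = x"
  by (rule Quotient3_abs_rep[OF Quotient3_torus])

text \<open>The universal property of the quotient topology: continuity is checked on the periodic lift.\<close>

lemma continuous_on_torus_iff:
  fixes F :: "'n::finite torus \<Rightarrow> 'b::topological_space"
  shows "continuous_on UNIV F \<longleftrightarrow> continuous_on UNIV (\<lambda>y. F (to_torus y))"
  by (simp add: continuous_on_open_vimage open_torus_def vimage_def)

lemma continuous_on_to_torus: "continuous_on UNIV (to_torus :: real^'n::finite \<Rightarrow> 'n torus)"
  using continuous_on_torus_iff[of "\<lambda>x::'n torus. x"] by (simp add: continuous_on_id)

lemma torus_representative_in_unit_cube:
  obtains y :: "real^'n::finite" where "y \<in> cbox 0 1" "to_torus y = x"
proof -
  define z where "z = rep_torus x"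
  have "to_torus (\<chi> i. frac (z $ i)) = to_torus z"
    by (simp add: to_torus_eq_iff frac_def)
  moreover have "(\<chi> i. frac (z $ i)) \<in> cbox 0 1"
    by (simp add: mem_box_cart less_imp_le[OF frac_lt_1])
  ultimately show ?thesis
    using that by (simp add: z_def)
qed

lemma torus_seq_compact:
  fixes u :: "nat \<Rightarrow> 'n::finite torus"
  shows "\<exists>x r. strict_mono r \<and> (\<lambda>n. u (r n)) \<longlonglongrightarrow> x"
proof -
  have "\<exists>y \<in> cbox 0 (1::real^'n). to_torus y = u n" for n
    using torus_representative_in_unit_cube by blast
  then obtain v where v: "\<And>n. v n \<in> cbox 0 (1::real^'n)" "\<And>n. to_torus (v n) = u n"
    by metis
  obtain y r where r: "strict_mono r" and lim: "(v \<circ> r) \<longlonglongrightarrow> y"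
    using compact_imp_seq_compact[OF compact_cbox] v(1) unfolding seq_compact_def by metis
  have "isCont to_torus y"
    using continuous_on_to_torus continuous_on_eq_continuous_at by blast
  then have "(\<lambda>n. to_torus ((v \<circ> r) n)) \<longlonglongrightarrow> to_torus y"
    using lim by (rule isCont_tendsto_compose)
  then show ?thesis
    using r v(2) by (auto simp: o_def)
qed

lemma compact_UNIV_torus: "compact (UNIV :: 'n::finite torus set)"
proof -
  have "(UNIV :: 'n torus set) = to_torus ` cbox 0 1"
    using torus_representative_in_unit_cube by (metis UNIV_eq_I image_eqI)
  then show ?thesis
    using compact_continuous_image[OF continuous_on_subset[OF continuous_on_to_torus] compact_cbox]
    by (metis subset_UNIV)
qed

lemma continuous_torus_bounded:
  fixes F :: "'n::finite torus \<Rightarrow> 'b::real_normed_vector"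
  assumes "continuous_on UNIV F"
  obtains B where "B > 0" "\<And>x. norm (F x) \<le> B"
proof -
  have "compact (range F)"
    using compact_continuous_image[OF assms compact_UNIV_torus] .
  then show ?thesis
    using compact_imp_bounded bounded_pos that by (metis rangeI)
qed

section \<open>Twice differentiable functions on the torus\<close>

text \<open>Every computation with derivatives on the torus is done on the lift and transferred by this rule.\<close>

lemma torus_C2I:
  assumes G: "\<And>y. GDERIV (\<lambda>z. g (to_torus z)) y :> G y"
    and M: "\<And>y. (G has_derivative (\<lambda>h. M y *v h)) (at y)"
    and cont: "continuous_on UNIV M"
  shows "torus_C2 g" "\<And>y. torus_grad g (to_torus y) = G y" "\<And>y. torus_hess g (to_torus y) = M y"
proof -
  show grad: "torus_grad g (to_torus y) = G y" for y
    by (rule torus_grad_eqI[OF G])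
  show hess: "torus_hess g (to_torus y) = M y" for y
    by (rule torus_hess_eqI) (simp add: grad M)
  have "torus_differentiable g"
    using G unfolding torus_differentiable_def differentiable_def gderiv_def by blast
  moreover have "continuous_on UNIV G"
    using M has_derivative_continuous continuous_at_imp_continuous_on by blast
  then have "continuous_on UNIV (torus_grad g)"
    by (simp add: continuous_on_torus_iff grad)
  moreover have "continuous_on UNIV (torus_hess g)"
    by (simp add: continuous_on_torus_iff hess cont)
  ultimately show "torus_C2 g"
    using M unfolding torus_C2_def differentiable_def grad by blast
qed

lemma differentiable_imp_GDERIV:
  fixes F :: "'a::euclidean_space \<Rightarrow> real"
  assumes "F differentiable (at y)"
  shows "\<exists>D. GDERIV F y :> D"
proof -
  obtain F' where F': "(F has_derivative F') (at y)"
    using assms by (auto simp: differentiable_def)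
  then have "linear F'" by (rule has_derivative_linear)
  then have "F' h = h \<bullet> (adjoint F' 1)" for h
    using adjoint_works[of F' h 1] by simp
  then show ?thesis
    using F' unfolding gderiv_def by (metis (no_types, lifting) ext)
qed

lemma torus_differentiable_GDERIV:
  assumes "torus_differentiable g"
  shows "GDERIV (\<lambda>z. g (to_torus z)) y :> torus_grad g (to_torus y)"
proof -
  obtain D where D: "GDERIV (\<lambda>z. g (to_torus z)) y :> D"
    using assms differentiable_imp_GDERIV unfolding torus_differentiable_def by blast
  then show ?thesis
    using torus_grad_eqI by metis
qed

lemma torus_C2_GDERIV:
  assumes "torus_C2 g"
  shows "GDERIV (\<lambda>z. g (to_torus z)) y :> torus_grad g (to_torus y)"
  using assms torus_differentiable_GDERIV by (auto simp: torus_C2_def)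

lemma torus_C2_hess:
  assumes "torus_C2 g"
  shows "((\<lambda>z. torus_grad g (to_torus z)) has_derivative (\<lambda>h. torus_hess g (to_torus y) *v h)) (at y)"
proof -
  obtain F' where F': "((\<lambda>z. torus_grad g (to_torus z)) has_derivative F') (at y)"
    using assms by (auto simp: torus_C2_def differentiable_def)
  then have "F' = (\<lambda>h. matrix F' *v h)"
    using has_derivative_linear by (auto simp: matrix_works)
  then have F'': "((\<lambda>z. torus_grad g (to_torus z)) has_derivative (\<lambda>h. matrix F' *v h)) (at y)"
    using F' by simp
  then show ?thesis
    using torus_hess_eqI[OF F''] by simp
qed

lemma torus_C2_continuous:
  assumes "torus_C2 g"
  shows "continuous_on UNIV g" "continuous_on UNIV (torus_grad g)" "continuous_on UNIV (torus_lap g)"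
proof -
  have "isCont (\<lambda>y. g (to_torus y)) y" for y
    using torus_C2_GDERIV[OF assms, of y] unfolding gderiv_def by (rule has_derivative_continuous)
  then have "continuous_on UNIV (\<lambda>y. g (to_torus y))"
    by (simp add: continuous_on_eq_continuous_at)
  then show "continuous_on UNIV g"
    by (simp add: continuous_on_torus_iff)
  show "continuous_on UNIV (torus_grad g)"
    using assms by (simp add: torus_C2_def)
  have "continuous_on UNIV (torus_hess g)"
    using assms by (simp add: torus_C2_def)
  then show "continuous_on UNIV (torus_lap g)"
    unfolding torus_lap_def[abs_def] trace_def
    by (intro continuous_on_sum continuous_on_component)
qed

lemma torus_C2_lincomb:
  assumes g: "torus_C2 g" and h: "torus_C2 h"
  shows "torus_C2 (\<lambda>x. g x + a * h x)"
    "torus_grad (\<lambda>x. g x + a * h x) x = torus_grad g x + a *\<^sub>R torus_grad h x"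
    "torus_lap (\<lambda>x. g x + a * h x) x = torus_lap g x + a * torus_lap h x"
proof -
  let ?G = "\<lambda>y. torus_grad g (to_torus y) + a *\<^sub>R torus_grad h (to_torus y)"
  let ?M = "\<lambda>y. torus_hess g (to_torus y) + a *\<^sub>R torus_hess h (to_torus y)"
  have G: "GDERIV (\<lambda>z. g (to_torus z) + a * h (to_torus z)) y :> ?G y" for y
    using torus_C2_GDERIV[OF g, of y] torus_C2_GDERIV[OF h, of y] unfolding gderiv_def
    by (auto intro!: derivative_eq_intros simp: inner_right_distrib)
  have M: "(?G has_derivative (\<lambda>k. ?M y *v k)) (at y)" for y
    using torus_C2_hess[OF g, of y] torus_C2_hess[OF h, of y]
    by (auto intro!: derivative_eq_intros simp: matrix_vector_mult_add_rdistrib scaleR_matrix_vector_assoc)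
  have "continuous_on UNIV (\<lambda>y. torus_hess g (to_torus y))" "continuous_on UNIV (\<lambda>y. torus_hess h (to_torus y))"
    using g h continuous_on_torus_iff unfolding torus_C2_def by blast+
  then have cont: "continuous_on UNIV ?M"
    by (intro continuous_intros)
  note C2 = torus_C2I[of "\<lambda>x. g x + a * h x", OF G M cont]
  show "torus_C2 (\<lambda>x. g x + a * h x)"
    by (rule C2)
  show "torus_grad (\<lambda>x. g x + a * h x) x = torus_grad g x + a *\<^sub>R torus_grad h x"
    using C2(2)[of "rep_torus x"] by simp
  have "torus_hess (\<lambda>x. g x + a * h x) x = torus_hess g x + a *\<^sub>R torus_hess h x"
    using C2(3)[of "rep_torus x"] by simp
  then show "torus_lap (\<lambda>x. g x + a * h x) x = torus_lap g x + a * torus_lap h x"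
    by (simp add: torus_lap_def trace_def sum.distrib sum_distrib_left)
qed

lemma torus_C2_diff:
  assumes "torus_C2 g" "torus_C2 h"
  shows "torus_C2 (\<lambda>x. g x - h x)"
    "torus_grad (\<lambda>x. g x - h x) x = torus_grad g x - torus_grad h x"
    "torus_lap (\<lambda>x. g x - h x) x = torus_lap g x - torus_lap h x"
  using torus_C2_lincomb[OF assms, of "-1"] by simp_all

section \<open>Trigonometric waves\<close>

definition freq :: "int^'n::finite \<Rightarrow> real^'n" where
  "freq k = (2 * pi) *\<^sub>R (\<chi> i. of_int (k $ i))"

text \<open>Including the quarter phases \<open>b \<pi> / 2\<close> makes this family contain all sines and cosines, and closes its
span under multiplication with the single formula \<open>wave_mult\<close>.\<close>

definition wave :: "(int^'n::finite) \<times> int \<Rightarrow> 'n torus \<Rightarrow> real" where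
  "wave \<iota> x = cos (freq (fst \<iota>) \<bullet> rep_torus x + of_int (snd \<iota>) * (pi / 2))"

lemma wave_to_torus: "wave \<iota> (to_torus y) = cos (freq (fst \<iota>) \<bullet> y + of_int (snd \<iota>) * (pi / 2))"
proof -
  define z where "z = rep_torus (to_torus y)"
  have "to_torus z = to_torus y" by (simp add: z_def)
  then have "\<forall>i. z $ i - y $ i \<in> \<int>" by (simp add: to_torus_eq_iff)
  then have "(\<Sum>i\<in>UNIV. of_int (fst \<iota> $ i) * (z $ i - y $ i)) \<in> \<int>"
    by (auto intro!: Ints_sum)
  then obtain m :: int where m: "(\<Sum>i\<in>UNIV. of_int (fst \<iota> $ i) * (z $ i - y $ i)) = of_int m"
    by (auto elim: Ints_cases)
  have "freq (fst \<iota>) \<bullet> (z - y) = 2 * pi * of_int m"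
    by (simp add: freq_def inner_vec_def m[symmetric] sum_distrib_left mult.assoc)
  then have eq: "freq (fst \<iota>) \<bullet> z + of_int (snd \<iota>) * (pi / 2) =
      (freq (fst \<iota>) \<bullet> y + of_int (snd \<iota>) * (pi / 2)) + 2 * pi * of_int m"
    by (simp add: inner_diff_right)
  show ?thesis
    unfolding wave_def z_def[symmetric] eq cos_add by simp
qed

lemma freq_add: "freq (k + l) = freq k + freq l" and freq_diff: "freq (k - l) = freq k - freq l"
  by (simp_all add: freq_def vec_eq_iff algebra_simps)

lemma wave_mult: "wave \<iota> x * wave \<kappa> x = (wave (\<iota> + \<kappa>) x + wave (\<iota> - \<kappa>) x) / 2"
  by (simp add: wave_def freq_add freq_diff cos_times_cos inner_add_left inner_diff_left algebra_simps)

lemma wave_zero: "wave 0 x = 1"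
  by (simp add: wave_def freq_def inner_vec_def)

lemma continuous_wave: "continuous_on UNIV (wave \<iota>)"
  unfolding continuous_on_torus_iff wave_to_torus by (intro continuous_intros)

section \<open>Absolutely convergent wave series\<close>

text \<open>One majorant, \<open>B / 2 ^ n\<close>, serves for all series below; the third part is the uniform tail estimate
that termwise differentiation requires.\<close>

lemma geometric_domination:
  fixes f :: "nat \<Rightarrow> 'b::banach"
  assumes "\<And>n. norm (f n) \<le> B * (1/2)^n"
  shows "summable f" "norm (suminf f) \<le> 2 * B" "norm (sum f {..<n} - suminf f) \<le> 2 * B * (1/2)^n"
proof -
  have bound: "summable f \<and> norm (suminf f) \<le> 2 * B" if "\<And>n. norm (f n) \<le> B * (1/2)^n" for f :: "nat \<Rightarrow> 'b" and B
  proof -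
    have geo: "(\<lambda>n. B * (1/2)^n) sums (2 * B)"
      using sums_mult[OF geometric_sums[of "1/2::real"], of B] by (simp add: mult.commute)
    have "summable (\<lambda>n. norm (f n))"
      using that by (intro summable_comparison_test'[OF sums_summable[OF geo], of 0]) auto
    then show ?thesis
      using summable_norm_cancel summable_norm[of f] suminf_le[OF that _ sums_summable[OF geo]] sums_unique[OF geo]
      by force
  qed
  show f: "summable f" "norm (suminf f) \<le> 2 * B"
    using bound[OF assms] by blast+
  have "norm (f (k + n)) \<le> (B * (1/2)^n) * (1/2)^k" for k
    using assms[of "k + n"] by (simp add: power_add mult_ac)
  from bound[of "\<lambda>k. f (k + n)", OF this] have "norm (\<Sum>k. f (k + n)) \<le> 2 * B * (1/2)^n"
    by simp
  then show "norm (sum f {..<n} - suminf f) \<le> 2 * B * (1/2)^n"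
    by (metis suminf_minus_initial_segment[OF f(1)] norm_minus_commute)
qed

lemma continuous_on_geometric_series:
  fixes f :: "nat \<Rightarrow> 'a::topological_space \<Rightarrow> 'b::banach"
  assumes "\<And>n x. norm (f n x) \<le> B * (1/2)^n" "\<And>n. continuous_on UNIV (f n)"
  shows "continuous_on UNIV (\<lambda>x. \<Sum>n. f n x)"
proof (rule uniform_limit_theorem)
  show "\<forall>\<^sub>F n in sequentially. continuous_on UNIV (\<lambda>x. \<Sum>i<n. f i x)"
    using assms(2) by (intro always_eventually allI continuous_on_sum) auto
  show "uniform_limit UNIV (\<lambda>n x. \<Sum>i<n. f i x) (\<lambda>x. \<Sum>n. f n x) sequentially"
    using assms(1) by (intro Weierstrass_m_test[of _ _ "\<lambda>n. B * (1/2)^n"]) (auto intro: summable_mult summable_geometric)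
qed auto

lemma has_derivative_geometric_series:
  fixes f :: "nat \<Rightarrow> 'a::real_normed_vector \<Rightarrow> 'b::banach"
  assumes f: "\<And>n x. norm (f n x) \<le> B * (1/2)^n"
    and f': "\<And>n x. (f n has_derivative f' n x) (at x)"
    and bnd: "\<And>n x h. norm (f' n x h) \<le> B * norm h * (1/2)^n"
  shows "((\<lambda>x. \<Sum>n. f n x) has_derivative (\<lambda>h. \<Sum>n. f' n x h)) (at x)"
proof -
  have "\<exists>g. \<forall>x\<in>UNIV. (\<lambda>n. f n x) sums g x \<and> (g has_derivative (\<lambda>h. \<Sum>n. f' n x h)) (at x within UNIV)"
  proof (rule has_derivative_series[where f' = f'])
    fix e :: real assume "e > 0"
    have "(\<lambda>n. 2 * B * (1/2)^n) \<longlonglongrightarrow> 2 * B * 0"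
      by (intro tendsto_mult tendsto_const LIMSEQ_realpow_zero) auto
    then have "\<forall>\<^sub>F n in sequentially. 2 * B * (1/2)^n < e"
      using \<open>e > 0\<close> by (intro order_tendstoD) auto
    then show "\<forall>\<^sub>F n in sequentially. \<forall>x\<in>UNIV. \<forall>h. norm ((\<Sum>i<n. f' i x h) - (\<Sum>n. f' n x h)) \<le> e * norm h"
    proof eventually_elim
      case (elim n)
      have "norm ((\<Sum>i<n. f' i x h) - (\<Sum>n. f' n x h)) \<le> 2 * (B * norm h) * (1/2)^n" for x h
        by (rule geometric_domination(3)[OF bnd])
      also have "2 * (B * norm h) * (1/2)^n \<le> e * norm h" for h :: 'a
        using mult_right_mono[OF less_imp_le[OF elim] norm_ge_zero[of h]] by (simp add: mult_ac)
      finally show ?case by blast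
    qed
  next
    show "(\<lambda>n. f n 0) sums suminf (\<lambda>n. f n 0)"
      using geometric_domination(1)[OF f] by (rule summable_sums)
  qed (use f' in auto)
  then obtain g where g: "\<And>x. (\<lambda>n. f n x) sums g x" "(g has_derivative (\<lambda>h. \<Sum>n. f' n x h)) (at x)"
    by auto
  then have "g = (\<lambda>x. \<Sum>n. f n x)"
    using sums_unique by blast
  then show ?thesis using g(2) by simp
qed

definition wave_index :: "nat \<Rightarrow> (int^'n::finite) \<times> int" where
  "wave_index = from_nat"

text \<open>The denominators dominate the first two derivatives of the \<open>n\<close>-th wave.\<close>

definition wave_weight :: "'n::finite itself \<Rightarrow> nat \<Rightarrow> real" where
  "wave_weight _ n = (1/2)^n / (1 + norm (freq (fst (wave_index n :: (int^'n) \<times> int))))\<^sup>2"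

text \<open>The coefficients are sampled at the natural numbers from a bounded continuous function on the line.
These functions form a Banach space, and every bounded sequence arises in this way.\<close>

definition wave_series :: "(real \<Rightarrow>\<^sub>C real) \<Rightarrow> 'n::finite torus \<Rightarrow> real" where
  "wave_series c x = (\<Sum>n. wave_weight TYPE('n) n * c n * wave (wave_index n) x)"

lemma wave_weight_pos: "wave_weight TYPE('n::finite) n > 0"
proof -
  have "1 + norm v > 0" for v :: "real^'n"
    using norm_ge_zero[of v] by linarith
  then show ?thesis
    unfolding wave_weight_def by (intro divide_pos_pos zero_less_power) auto
qed

lemma wave_weight_bounds:
  fixes c :: "real \<Rightarrow>\<^sub>C real" and s :: real
  defines "K \<equiv> \<lambda>n. freq (fst (wave_index n :: (int^'n::finite) \<times> int))"
  assumes "\<bar>s\<bar> \<le> 1"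
  shows "\<bar>wave_weight TYPE('n) n * c n * s\<bar> \<le> norm c * (1/2)^n"
    "\<bar>wave_weight TYPE('n) n * c n * s\<bar> * norm (K n) \<le> norm c * (1/2)^n"
    "\<bar>wave_weight TYPE('n) n * c n * s\<bar> * (norm (K n))\<^sup>2 \<le> norm c * (1/2)^n"
proof -
  define N where "N = norm (K n)"
  have N: "N \<ge> 0" by (simp add: N_def)
  have w: "wave_weight TYPE('n) n = (1/2)^n / (1 + N)\<^sup>2"
    by (simp add: wave_weight_def N_def K_def)
  have main: "\<bar>wave_weight TYPE('n) n * c n * s\<bar> * q \<le> norm c * (1/2)^n" if q: "0 \<le> q" "q \<le> (1 + N)\<^sup>2" for q
  proof -
    have "\<bar>wave_weight TYPE('n) n * c n * s\<bar> * q = (\<bar>c n\<bar> * \<bar>s\<bar>) * ((1/2)^n * (q / (1 + N)\<^sup>2))"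
      by (simp add: w abs_mult)
    also have "\<dots> \<le> (norm c * 1) * ((1/2)^n * 1)"
      using q N norm_bounded[of c "real n"] assms(2)
      by (intro mult_mono) (auto simp: divide_le_eq)
    finally show ?thesis by simp
  qed
  show "\<bar>wave_weight TYPE('n) n * c n * s\<bar> \<le> norm c * (1/2)^n"
    using main[of 1] N by (simp add: power2_eq_square algebra_simps)
  show "\<bar>wave_weight TYPE('n) n * c n * s\<bar> * norm (K n) \<le> norm c * (1/2)^n"
    using main[of N] N by (simp add: power2_eq_square algebra_simps N_def)
  show "\<bar>wave_weight TYPE('n) n * c n * s\<bar> * (norm (K n))\<^sup>2 \<le> norm c * (1/2)^n"
    using main[of "N\<^sup>2"] N by (simp add: power2_eq_square algebra_simps N_def)
qed

text \<open>The second derivatives of the \<open>n\<close>-th wave are bounded by the square of its frequency, which the weight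
absorbs; hence the series may be differentiated twice term by term, and all bounds are linear in
\<open>norm c\<close>.\<close>

lemma wave_series_C2:
  fixes c :: "real \<Rightarrow>\<^sub>C real"
  shows "torus_C2 (wave_series c :: 'n::finite torus \<Rightarrow> real)"
    "\<And>x. \<bar>wave_series c (x :: 'n torus)\<bar> \<le> 2 * norm c"
    "\<And>x. norm (torus_grad (wave_series c) (x :: 'n torus)) \<le> 2 * norm c"
    "\<And>x. \<bar>torus_lap (wave_series c) (x :: 'n torus)\<bar> \<le> 2 * CARD('n) * norm c"
proof -
  define K where "K n = freq (fst (wave_index n :: (int^'n) \<times> int))" for n
  define th where "th n y = K n \<bullet> y + of_int (snd (wave_index n :: (int^'n) \<times> int)) * (pi / 2)" for n y
  define w where "w = wave_weight TYPE('n)"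
  note b = wave_weight_bounds[where 'n = 'n, folded K_def w_def]
  have lift: "wave_series c (to_torus y) = (\<Sum>n. w n * c n * cos (th n y))" for y :: "real^'n"
    unfolding wave_series_def wave_to_torus th_def K_def w_def ..
  have b0: "norm (w n * c n * cos (th n y)) \<le> norm c * (1/2)^n" for n y
    using b(1)[of "cos (th n y)" n c] by simp
  have b1: "norm ((w n * c n * - sin (th n y)) *\<^sub>R K n) \<le> norm c * (1/2)^n" for n y
    using b(2)[of "- sin (th n y)" n c] by simp
  define G where "G = (\<lambda>y. \<Sum>n. (w n * c n * - sin (th n y)) *\<^sub>R K n)"
  define M where "M = (\<lambda>y. (\<chi> i j. \<Sum>n. (w n * c n * - cos (th n y)) * (K n $ i * K n $ j)) :: real^'n^'n)"
  have G: "GDERIV (\<lambda>z. wave_series c (to_torus z)) y :> G y" for y :: "real^'n"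
  proof -
    have "((\<lambda>z. \<Sum>n. w n * c n * cos (th n z)) has_derivative
        (\<lambda>h. \<Sum>n. (w n * c n * - sin (th n y)) * (K n \<bullet> h))) (at y)"
    proof (rule has_derivative_geometric_series[OF b0])
      show "((\<lambda>z. w n * c n * cos (th n z)) has_derivative (\<lambda>h. (w n * c n * - sin (th n y)) * (K n \<bullet> h))) (at y)"
        for n y unfolding th_def by (auto intro!: derivative_eq_intros)
      fix n y h
      have "norm ((w n * c n * - sin (th n y)) * (K n \<bullet> h)) \<le> \<bar>w n * c n * - sin (th n y)\<bar> * (norm (K n) * norm h)"
        using Cauchy_Schwarz_ineq2[of "K n" h] by (simp add: abs_mult mult_left_mono)
      also have "\<dots> = (\<bar>w n * c n * - sin (th n y)\<bar> * norm (K n)) * norm h"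
        by simp
      also have "\<dots> \<le> (norm c * (1/2)^n) * norm h"
        using b(2)[of "- sin (th n y)" n c] by (intro mult_right_mono) auto
      finally show "norm ((w n * c n * - sin (th n y)) * (K n \<bullet> h)) \<le> norm c * norm h * (1/2)^n"
        by (simp add: mult_ac)
    qed
    moreover have "(\<Sum>n. (w n * c n * - sin (th n y)) * (K n \<bullet> h)) = h \<bullet> G y" for h
      unfolding G_def bounded_linear.suminf[OF bounded_linear_inner_right geometric_domination(1)[OF b1]]
      by (simp add: inner_commute)
    ultimately show ?thesis
      unfolding gderiv_def lift by simp
  qed
  have entry: "norm ((w n * c n * - cos (th n y)) * (K n $ i * K n $ j)) \<le> norm c * (1/2)^n" for n y i j
  proof -
    have "norm ((w n * c n * - cos (th n y)) * (K n $ i * K n $ j)) =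
        \<bar>w n * c n * - cos (th n y)\<bar> * (\<bar>K n $ i\<bar> * \<bar>K n $ j\<bar>)"
      by (simp add: abs_mult)
    also have "\<dots> \<le> \<bar>w n * c n * - cos (th n y)\<bar> * (norm (K n))\<^sup>2"
      unfolding power2_eq_square by (intro mult_left_mono mult_mono component_le_norm_cart) auto
    also have "\<dots> \<le> norm c * (1/2)^n"
      using b(3)[of "- cos (th n y)" n c] by simp
    finally show ?thesis .
  qed
  have sm: "summable (\<lambda>n. (w n * c n * - cos (th n y)) * (K n $ i * K n $ j))" for y i j
    by (rule geometric_domination(1)[OF entry])
  have M: "(G has_derivative (\<lambda>h. M y *v h)) (at y)" for y
  proof -
    have bM: "norm ((w n * c n * - cos (th n y) * (K n \<bullet> h)) *\<^sub>R K n) \<le> norm c * norm h * (1/2)^n" for n y h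
    proof -
      have "norm ((w n * c n * - cos (th n y) * (K n \<bullet> h)) *\<^sub>R K n)
          = \<bar>w n * c n * - cos (th n y)\<bar> * \<bar>K n \<bullet> h\<bar> * norm (K n)"
        by (simp add: abs_mult)
      also have "\<dots> \<le> \<bar>w n * c n * - cos (th n y)\<bar> * (norm (K n) * norm h) * norm (K n)"
        by (intro mult_right_mono mult_left_mono Cauchy_Schwarz_ineq2) auto
      also have "\<dots> = (\<bar>w n * c n * - cos (th n y)\<bar> * (norm (K n))\<^sup>2) * norm h"
        by (simp add: power2_eq_square)
      also have "\<dots> \<le> (norm c * (1/2)^n) * norm h"
        using b(3)[of "- cos (th n y)" n c] by (intro mult_right_mono) auto
      finally show ?thesis by (simp add: mult_ac)
    qed
    have "(G has_derivative (\<lambda>h. \<Sum>n. (w n * c n * - cos (th n y) * (K n \<bullet> h)) *\<^sub>R K n)) (at y)"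
      unfolding G_def
    proof (rule has_derivative_geometric_series[OF b1 _ bM])
      show "((\<lambda>z. (w n * c n * - sin (th n z)) *\<^sub>R K n) has_derivative
          (\<lambda>h. (w n * c n * - cos (th n y) * (K n \<bullet> h)) *\<^sub>R K n)) (at y)"
        for n y unfolding th_def by (auto intro!: derivative_eq_intros)
    qed
    moreover have "(\<Sum>n. (w n * c n * - cos (th n y) * (K n \<bullet> h)) *\<^sub>R K n) = M y *v h" for h
    proof (rule vec_eq_iff[THEN iffD2], rule allI)
      fix i
      have "(\<Sum>n. (w n * c n * - cos (th n y) * (K n \<bullet> h)) *\<^sub>R K n) $ i
          = (\<Sum>n. ((w n * c n * - cos (th n y) * (K n \<bullet> h)) *\<^sub>R K n) $ i)"
        by (rule bounded_linear.suminf[OF bounded_linear_vec_nth geometric_domination(1)[OF bM]])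
      also have "\<dots> = (\<Sum>n. \<Sum>j\<in>UNIV. (w n * c n * - cos (th n y)) * (K n $ i * K n $ j) * h $ j)"
        by (simp add: inner_vec_def sum_distrib_left sum_distrib_right mult_ac flip: sum_negf)
      also have "\<dots> = (\<Sum>j\<in>UNIV. \<Sum>n. (w n * c n * - cos (th n y)) * (K n $ i * K n $ j) * h $ j)"
        using sm by (intro suminf_sum summable_mult2)
      also have "\<dots> = (M y *v h) $ i"
        unfolding suminf_mult2[OF sm, symmetric] by (simp add: M_def matrix_vector_mult_def)
      finally show "(\<Sum>n. (w n * c n * - cos (th n y) * (K n \<bullet> h)) *\<^sub>R K n) $ i = (M y *v h) $ i" .
    qed
    ultimately show ?thesis by simp
  qed
  have cont: "continuous_on UNIV M"
    unfolding M_def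
  proof (intro continuous_on_vec_lambda continuous_on_geometric_series[OF entry])
    show "continuous_on UNIV (\<lambda>y. (w n * c n * - cos (th n y)) * (K n $ i * K n $ j))" for n i j
      unfolding th_def by (intro continuous_intros)
  qed
  note C2 = torus_C2I[of "wave_series c", OF G M cont]
  show "torus_C2 (wave_series c :: 'n torus \<Rightarrow> real)"
    by (rule C2)
  fix x :: "'n torus"
  show "\<bar>wave_series c x\<bar> \<le> 2 * norm c"
    using geometric_domination(2)[of "\<lambda>n. w n * c n * cos (th n (rep_torus x))", OF b0] lift[of "rep_torus x"] by simp
  show "norm (torus_grad (wave_series c) x) \<le> 2 * norm c"
    using geometric_domination(2)[of "\<lambda>n. (w n * c n * - sin (th n (rep_torus x))) *\<^sub>R K n", OF b1]
      C2(2)[of "rep_torus x"] by (simp add: G_def)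
  have "torus_lap (wave_series c) x = (\<Sum>i\<in>UNIV. M (rep_torus x) $ i $ i)"
    using C2(3)[of "rep_torus x"] by (simp add: torus_lap_def trace_def)
  also have "\<bar>\<dots>\<bar> \<le> (\<Sum>i\<in>(UNIV::'n set). 2 * norm c)"
  proof (intro order_trans[OF sum_abs] sum_mono)
    fix i :: 'n
    show "\<bar>M (rep_torus x) $ i $ i\<bar> \<le> 2 * norm c"
      using geometric_domination(2)[of "\<lambda>n. (w n * c n * - cos (th n (rep_torus x))) * (K n $ i * K n $ i)", OF entry]
      by (simp add: M_def)
  qed
  finally show "\<bar>torus_lap (wave_series c) x\<bar> \<le> 2 * CARD('n) * norm c"
    by simp
qed

lemma wave_series_lincomb:
  "wave_series (c + d) x = wave_series c x + wave_series d x"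
  "wave_series (a *\<^sub>R c) x = a * wave_series c x" for x :: "'n::finite torus"
proof -
  have s: "summable (\<lambda>n. wave_weight TYPE('n) n * c n * wave (wave_index n) x)" for c :: "real \<Rightarrow>\<^sub>C real"
    using wave_weight_bounds(1)[where 'n='n and s = "wave (wave_index _) x"]
    by (intro geometric_domination(1)[where B = "norm c"]) (simp add: wave_def)
  show "wave_series (c + d) x = wave_series c x + wave_series d x"
    unfolding wave_series_def by (subst suminf_add[OF s s]) (simp add: algebra_simps)
  show "wave_series (a *\<^sub>R c) x = a * wave_series c x"
    unfolding wave_series_def suminf_mult[OF s, symmetric] by (simp add: mult_ac)
qed

instance bcontfun :: (metric_space, banach) banach ..

text \<open>The tent interpolates the sequence that is 1 at \<open>m\<close> and 0 elsewhere, so only the wave number \<open>m\<close> survives in the series.\<close>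

definition unit_coeff :: "nat \<Rightarrow> (real \<Rightarrow>\<^sub>C real)" where
  "unit_coeff m = Bcontfun (\<lambda>t. max 0 (1 - \<bar>t - real m\<bar>))"

lemma wave_series_unit_coeff:
  "wave_series (unit_coeff m) x = wave_weight TYPE('n) m * wave (wave_index m) (x :: 'n::finite torus)"
proof -
  have "(\<lambda>t. max 0 (1 - \<bar>t - real m\<bar>)) \<in> bcontfun"
    by (rule bcontfun_normI[of _ 1]) (auto intro!: continuous_intros)
  then have "apply_bcontfun (unit_coeff m) = (\<lambda>t. max 0 (1 - \<bar>t - real m\<bar>))"
    unfolding unit_coeff_def by (rule Bcontfun_inverse)
  then have u: "apply_bcontfun (unit_coeff m) (real n) = (if n = m then 1 else 0)" for n
    by auto
  show ?thesis
    unfolding wave_series_def u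
    by (subst suminf_finite[of "{m}"]) auto
qed

section \<open>The torus as a Hausdorff space\<close>

text \<open>The classical embedding of the torus as a product of circles.  Its components are waves, which links
polynomials in the coordinates of the image to wave integrals.\<close>

definition torus_embed :: "'n::finite torus \<Rightarrow> (real^'n) \<times> (real^'n)" where
  "torus_embed x = (\<chi> i. wave (axis i 1, 0) x, \<chi> i. wave (axis i 1, -1) x)"

lemma continuous_torus_embed: "continuous_on UNIV torus_embed"
  unfolding torus_embed_def[abs_def]
  by (intro continuous_on_Pair continuous_on_vec_lambda continuous_wave)

lemma torus_embed_to_torus:
  "torus_embed (to_torus (y :: real^'n::finite)) = (\<chi> i. cos (2 * pi * y $ i), \<chi> i. sin (2 * pi * y $ i))"
proof -
  have "freq (axis i 1) = (2 * pi) *\<^sub>R axis i (1::real)" for i :: 'n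
    by (simp add: freq_def vec_eq_iff axis_def)
  then have "freq (axis i 1) \<bullet> y = 2 * pi * y $ i" for i
    by (simp add: inner_axis')
  then show ?thesis
    by (simp add: torus_embed_def wave_to_torus vec_eq_iff cos_diff)
qed

lemma inj_torus_embed: "inj (torus_embed :: 'n::finite torus \<Rightarrow> _)"
proof (rule injI)
  fix x x' :: "'n torus"
  define y y' where "y = rep_torus x" and "y' = rep_torus x'"
  assume "torus_embed x = torus_embed x'"
  then have "torus_embed (to_torus y) = torus_embed (to_torus y')"
    by (simp add: y_def y'_def)
  then have "sin (2 * pi * y $ i) = sin (2 * pi * y' $ i) \<and> cos (2 * pi * y $ i) = cos (2 * pi * y' $ i)" for i
    by (simp add: torus_embed_to_torus vec_eq_iff)
  then have "\<exists>n::int. 2 * pi * y $ i = 2 * pi * y' $ i + 2 * pi * n" for i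
    unfolding sin_cos_eq_iff .
  then have "\<exists>n::int. y $ i - y' $ i = n" for i
    by (metis add_diff_cancel_left' distrib_left mult_cancel_left mult_eq_0_iff pi_neq_zero zero_neq_numeral)
  then have "to_torus y = to_torus y'"
    unfolding to_torus_eq_iff by (metis Ints_of_int)
  then show "x = x'" by (simp add: y_def y'_def)
qed

instance torus :: (finite) t2_space
proof
  fix x y :: "'a torus"
  assume "x \<noteq> y"
  then have "torus_embed x \<noteq> torus_embed y"
    using injD[OF inj_torus_embed] by blast
  then obtain U V where UV: "open U" "open V" "torus_embed x \<in> U" "torus_embed y \<in> V" "U \<inter> V = {}"
    by (meson hausdorff)
  have "open (torus_embed -` U)" "open (torus_embed -` V)"
    using UV continuous_torus_embed by (auto simp: continuous_on_open_vimage)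
  moreover have "(torus_embed -` U) \<inter> (torus_embed -` V) = {}"
    using UV(5) by auto
  ultimately show "\<exists>U V. open U \<and> open V \<and> x \<in> U \<and> y \<in> V \<and> U \<inter> V = {}"
    using UV(3,4) by blast
qed

section \<open>Measures of mass at most one\<close>

lemma M1D:
  assumes "\<mu> \<in> M1"
  shows "finite_measure \<mu>" "sets \<mu> = sets borel" "space \<mu> = UNIV" "measure \<mu> UNIV \<le> 1"
proof -
  show s: "sets \<mu> = sets borel" using assms by (simp add: M1_def)
  show sp: "space \<mu> = UNIV" using sets_eq_imp_space_eq[OF s] by simp
  have le: "emeasure \<mu> UNIV \<le> 1" using assms by (simp add: M1_def)
  then show "finite_measure \<mu>"
    by (intro finite_measureI) (auto simp: sp top_unique)
  then show "measure \<mu> UNIV \<le> 1"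
    using le by (simp add: finite_measure.emeasure_eq_measure)
qed

lemma M1_integrable:
  fixes F :: "'n::finite torus \<Rightarrow> real"
  assumes \<mu>: "\<mu> \<in> M1" and F: "continuous_on UNIV F"
  shows "integrable \<mu> F"
proof -
  obtain B where "\<And>x. norm (F x) \<le> B"
    using continuous_torus_bounded[OF F] by blast
  moreover have "F \<in> borel_measurable \<mu>"
    using borel_measurable_continuous_onI[OF F] measurable_cong_sets[OF M1D(2)[OF \<mu>] refl] by blast
  ultimately show ?thesis
    by (intro finite_measure.integrable_const_bound[OF M1D(1)[OF \<mu>], of _ B]) auto
qed

lemma M1_integral_bound:
  fixes F :: "'n::finite torus \<Rightarrow> real"
  assumes \<mu>: "\<mu> \<in> M1" and F: "continuous_on UNIV F" and B: "\<And>x. \<bar>F x\<bar> \<le> B"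
  shows "\<bar>\<integral>x. F x \<partial>\<mu>\<bar> \<le> B"
proof -
  interpret finite_measure \<mu> by (rule M1D[OF \<mu>])
  have "0 \<le> B" using B[of undefined] by linarith
  have "\<bar>\<integral>x. F x \<partial>\<mu>\<bar> \<le> (\<integral>x. \<bar>F x\<bar> \<partial>\<mu>)"
    by (rule integral_abs_bound)
  also have "\<dots> \<le> (\<integral>x. B \<partial>\<mu>)"
    using B by (intro integral_mono integrable_abs M1_integrable[OF \<mu> F]) auto
  also have "\<dots> = B * measure \<mu> UNIV"
    by (simp add: M1D(3)[OF \<mu>])
  also have "\<dots> \<le> B"
    using M1D(4)[OF \<mu>] \<open>0 \<le> B\<close> mult_left_le by blast
  finally show ?thesis .
qed

subsection \<open>Waves separate measures\<close>

text \<open>Let \<open>\<H>\<close> be the set of continuous \<open>h\<close> such that \<open>h\<close> times any wave has the same integral for both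
measures.  By the product formula \<open>\<H>\<close> is stable under multiplication by waves.  Hence the functions
whose multiples of \<open>\<H>\<close> stay in \<open>\<H>\<close> form an algebra that contains the coordinates of
\<open>torus_embed\<close>.\<close>

lemma wave_integrals_determine_polynomials:
  fixes \<mu> \<nu> :: "'n::finite torus measure"
  assumes M1: "\<mu> \<in> M1" "\<nu> \<in> M1" and eq: "\<And>\<iota>. (\<integral>x. wave \<iota> x \<partial>\<mu>) = (\<integral>x. wave \<iota> x \<partial>\<nu>)"
    and "real_polynomial_function p"
  shows "(\<integral>x. p (torus_embed x) \<partial>\<mu>) = (\<integral>x. p (torus_embed x) \<partial>\<nu>)"
proof -
  define \<H> where "\<H> = {h. continuous_on UNIV h \<and> (\<forall>\<iota>. (\<integral>x. h x * wave \<iota> x \<partial>\<mu>) = (\<integral>x. h x * wave \<iota> x \<partial>\<nu>))}"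
  have int: "integrable m (\<lambda>x. h x * wave \<iota> x)" if "m \<in> M1" "continuous_on UNIV h" for m :: "'n torus measure" and h \<iota>
    using that by (intro M1_integrable continuous_intros continuous_wave)
  have add: "(\<lambda>x. g x + h x) \<in> \<H>" if "g \<in> \<H>" "h \<in> \<H>" for g h
    using that M1 by (auto simp: \<H>_def distrib_right int intro!: continuous_on_add)
  have scale: "(\<lambda>x. a * h x) \<in> \<H>" if "h \<in> \<H>" for a h
    using that by (auto simp: \<H>_def mult.assoc intro!: continuous_on_mult continuous_on_const)
  have zero: "(\<lambda>x. 0) \<in> \<H>" by (simp add: \<H>_def)
  have wave: "(\<lambda>x. wave \<kappa> x * h x) \<in> \<H>" if h: "h \<in> \<H>" for \<kappa> h
  proof -
    have hc: "continuous_on UNIV h" using h by (simp add: \<H>_def)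
    have *: "(\<integral>x. wave \<kappa> x * h x * wave \<iota> x \<partial>m)
        = ((\<integral>x. h x * wave (\<kappa> + \<iota>) x \<partial>m) + (\<integral>x. h x * wave (\<kappa> - \<iota>) x \<partial>m)) / 2"
      if "m \<in> M1" for m \<iota>
    proof -
      have "wave \<kappa> x * h x * wave \<iota> x = (h x * wave (\<kappa> + \<iota>) x + h x * wave (\<kappa> - \<iota>) x) / 2" for x
        using wave_mult[of \<kappa> x \<iota>] by (simp add: mult_ac) (simp add: algebra_simps flip: wave_mult)
      then have "(\<integral>x. wave \<kappa> x * h x * wave \<iota> x \<partial>m) =
          (\<integral>x. (h x * wave (\<kappa> + \<iota>) x + h x * wave (\<kappa> - \<iota>) x) / 2 \<partial>m)"
        by (rule Bochner_Integration.integral_cong[OF refl])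
      then show ?thesis
        using int[OF that hc] by simp
    qed
    show ?thesis
      unfolding \<H>_def mem_Collect_eq *[OF M1(1)] *[OF M1(2)]
    proof (intro conjI allI)
      show "continuous_on UNIV (\<lambda>x. wave \<kappa> x * h x)"
        by (intro continuous_on_mult continuous_wave hc)
      have "(\<integral>x. h x * wave \<iota> x \<partial>\<mu>) = (\<integral>x. h x * wave \<iota> x \<partial>\<nu>)" for \<iota>
        using h unfolding \<H>_def by blast
      then show "((\<integral>x. h x * wave (\<kappa> + \<iota>) x \<partial>\<mu>) + (\<integral>x. h x * wave (\<kappa> - \<iota>) x \<partial>\<mu>)) / 2 =
          ((\<integral>x. h x * wave (\<kappa> + \<iota>) x \<partial>\<nu>) + (\<integral>x. h x * wave (\<kappa> - \<iota>) x \<partial>\<nu>)) / 2" for \<iota>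
        by simp
    qed
  qed
  have sum: "(\<lambda>x. \<Sum>i\<in>I. g i x) \<in> \<H>" if "finite I" "\<And>i. i \<in> I \<Longrightarrow> g i \<in> \<H>" for I and g :: "'n \<Rightarrow> _"
    using that by (induction I rule: finite_induct) (auto intro: add zero)
  have "\<forall>h\<in>\<H>. (\<lambda>x. p (torus_embed x) * h x) \<in> \<H>"
    using \<open>real_polynomial_function p\<close>
  proof induction
    case (linear f)
    then interpret f: bounded_linear f .
    have f: "f (torus_embed x) =
        (\<Sum>i\<in>UNIV. wave (axis i 1, 0) x * f (axis i 1, 0)) + (\<Sum>i\<in>UNIV. wave (axis i 1, -1) x * f (0, axis i 1))"
      for x :: "'n torus"
    proof -
      have basis: "v = (\<Sum>i\<in>UNIV. (v $ i) *\<^sub>R axis i 1)" for v :: "real^'n"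
        by (simp add: basis_expansion scalar_mult_eq_scaleR[symmetric])
      have "torus_embed x = (\<Sum>i\<in>UNIV. wave (axis i 1, 0) x *\<^sub>R (axis i 1, 0))
          + (\<Sum>i\<in>UNIV. wave (axis i 1, -1) x *\<^sub>R (0, axis i 1))"
        using basis[of "fst (torus_embed x)"] basis[of "snd (torus_embed x)"]
        by (simp add: torus_embed_def prod_eq_iff fst_sum snd_sum)
      then show ?thesis
        by (simp only: f.add f.sum f.scaleR real_scaleR_def)
    qed
    show ?case
      unfolding f distrib_right sum_distrib_right
    proof (intro ballI add sum finite)
      have "(\<lambda>x. wave \<kappa> x * a * h x) \<in> \<H>" if "h \<in> \<H>" for h \<kappa> a
        using scale[OF wave[OF that], of a \<kappa>] by (simp add: mult_ac)
      then show "(\<lambda>x. wave (axis i 1, 0) x * f (axis i 1, 0) * h x) \<in> \<H>"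
        "(\<lambda>x. wave (axis i 1, -1) x * f (0, axis i 1) * h x) \<in> \<H>" if "h \<in> \<H>" for h i
        using that by blast+
    qed
  qed (auto simp: distrib_right mult.assoc intro: add scale)
  moreover have "(\<lambda>x. 1) \<in> \<H>"
    by (simp add: \<H>_def eq)
  ultimately have "(\<lambda>x. p (torus_embed x) * 1) \<in> \<H>" by (rule bspec)
  then have "(\<integral>x. p (torus_embed x) * 1 * wave 0 x \<partial>\<mu>) = (\<integral>x. p (torus_embed x) * 1 * wave 0 x \<partial>\<nu>)"
    unfolding \<H>_def by blast
  then show ?thesis by (simp add: wave_zero)
qed

text \<open>By Stone--Weierstrass on the compact image of the torus, the two measures agree on all continuous
functions.  The indicator of a closed set is a decreasing limit of such functions, and the closed
sets are a generator stable under intersections.\<close>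

lemma M1_eq_if_wave_integrals_eq:
  fixes \<mu> \<nu> :: "'n::finite torus measure"
  assumes M1: "\<mu> \<in> M1" "\<nu> \<in> M1" and eq: "\<And>\<iota>. (\<integral>x. wave \<iota> x \<partial>\<mu>) = (\<integral>x. wave \<iota> x \<partial>\<nu>)"
  shows "\<mu> = \<nu>"
proof -
  have cpt: "compact (range (torus_embed :: 'n torus \<Rightarrow> _))"
    by (rule compact_continuous_image[OF continuous_torus_embed compact_UNIV_torus])
  have cont_eq: "(\<integral>x. g (torus_embed x) \<partial>\<mu>) = (\<integral>x. g (torus_embed x) \<partial>\<nu>)" if g: "continuous_on UNIV g" for g :: "_ \<Rightarrow> real"
  proof -
    have gc: "continuous_on UNIV (\<lambda>x. g (torus_embed x))"
      by (rule continuous_on_compose2[OF g continuous_torus_embed]) auto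
    have "\<bar>(\<integral>x. g (torus_embed x) \<partial>\<mu>) - (\<integral>x. g (torus_embed x) \<partial>\<nu>)\<bar> \<le> e" if "e > 0" for e
    proof -
      obtain p where p: "real_polynomial_function p"
        "\<And>z. z \<in> range (torus_embed :: 'n torus \<Rightarrow> _) \<Longrightarrow> \<bar>g z - p z\<bar> < e / 2"
        using Stone_Weierstrass_real_polynomial_function[OF cpt, of g "e / 2"] g continuous_on_subset \<open>e > 0\<close>
        by (metis half_gt_zero subset_UNIV)
      have "continuous_on UNIV p"
        using p(1) continuous_on_polymonial_function real_polynomial_function_eq by blast
      then have pc: "continuous_on UNIV (\<lambda>x. p (torus_embed x))"
        by (rule continuous_on_compose2[OF _ continuous_torus_embed]) auto
      have close: "\<bar>(\<integral>x. g (torus_embed x) \<partial>m) - (\<integral>x. p (torus_embed x) \<partial>m)\<bar> \<le> e / 2" if m: "m \<in> M1" for m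
      proof -
        have "\<bar>\<integral>x. g (torus_embed x) - p (torus_embed x) \<partial>m\<bar> \<le> e / 2"
          using p(2) by (intro M1_integral_bound[OF m] continuous_on_diff gc pc less_imp_le) auto
        then show ?thesis
          by (simp add: Bochner_Integration.integral_diff[OF M1_integrable[OF m gc] M1_integrable[OF m pc]])
      qed
      show ?thesis
        using close[OF M1(1)] close[OF M1(2)] wave_integrals_determine_polynomials[OF M1 eq p(1)]
        unfolding abs_le_iff by linarith
    qed
    then have "\<bar>(\<integral>x. g (torus_embed x) \<partial>\<mu>) - (\<integral>x. g (torus_embed x) \<partial>\<nu>)\<bar> \<le> 0"
      by (rule field_le_epsilon) simp
    then show ?thesis by simp
  qed
  have closed_eq: "emeasure \<mu> S = emeasure \<nu> S" if "closed S" for S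
  proof (cases "S = {}")
    case False
    have "compact S"
      using compact_UNIV_torus \<open>closed S\<close> by (metis compact_Int_closed inf_top_left)
    then have "compact (torus_embed ` S)"
      by (rule compact_continuous_image[OF continuous_on_subset[OF continuous_torus_embed subset_UNIV]])
    then have clE: "closed (torus_embed ` S)" by (rule compact_imp_closed)
    define g where "g n z = max 0 (1 - real n * infdist z (torus_embed ` S))" for n z
    have gc: "continuous_on UNIV (g n)" for n
      unfolding g_def by (intro continuous_intros)
    have lim: "(\<lambda>n. g n (torus_embed x)) \<longlonglongrightarrow> indicator S x" for x
    proof (cases "x \<in> S")
      case True
      then show ?thesis by (simp add: g_def)
    next
      case nS: False
      then have "torus_embed x \<notin> torus_embed ` S"
        using injD[OF inj_torus_embed] by blast
      then have pos: "infdist (torus_embed x) (torus_embed ` S) > 0"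
        using in_closed_iff_infdist_zero[OF clE] False infdist_nonneg[of "torus_embed x" "torus_embed ` S"]
        by fastforce
      then obtain N :: nat where N: "1 < real N * infdist (torus_embed x) (torus_embed ` S)"
        using reals_Archimedean3 by blast
      have "g n (torus_embed x) = 0" if "n \<ge> N" for n
      proof -
        have "real N * infdist (torus_embed x) (torus_embed ` S) \<le> real n * infdist (torus_embed x) (torus_embed ` S)"
          using that pos by (intro mult_right_mono) auto
        then show ?thesis using N by (simp add: g_def)
      qed
      then show ?thesis
        using nS by (intro tendsto_eventually) (auto simp: eventually_sequentially)
    qed
    have lim_int: "(\<lambda>n. \<integral>x. g n (torus_embed x) \<partial>m) \<longlonglongrightarrow> measure m S" if m: "m \<in> M1" for m
    proof -
      interpret finite_measure m by (rule M1D[OF m])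
      have meas: "S \<in> sets m" using \<open>closed S\<close> M1D(2)[OF m] by simp
      have "(\<lambda>n. \<integral>x. g n (torus_embed x) \<partial>m) \<longlonglongrightarrow> (\<integral>x. indicator S x \<partial>m)"
      proof (rule integral_dominated_convergence[where w = "\<lambda>_. 1"])
        show "(\<lambda>x. g n (torus_embed x)) \<in> borel_measurable m" for n
          using M1_integrable[OF m continuous_on_compose2[OF gc continuous_torus_embed]] by auto
        show "AE x in m. norm (g n (torus_embed x)) \<le> 1" for n
          by (auto simp: g_def infdist_nonneg)
      qed (use meas lim in auto)
      then show ?thesis using meas M1D(3)[OF m] by simp
    qed
    have "measure \<mu> S = measure \<nu> S"
      using lim_int[OF M1(1)] lim_int[OF M1(2)] unfolding cont_eq[OF gc] by (rule LIMSEQ_unique)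
    then show ?thesis
      using M1D(1)[OF M1(1)] M1D(1)[OF M1(2)] by (simp add: finite_measure.emeasure_eq_measure)
  qed auto
  have borel: "sets (borel :: 'n torus measure) = sigma_sets UNIV (Collect closed)"
    unfolding borel_eq_closed by simp
  show ?thesis
  proof (rule measure_eqI_generator_eq[of "Collect closed" UNIV _ _ "\<lambda>_. UNIV"])
    show "Int_stable (Collect closed :: 'n torus set set)"
      by (auto simp: Int_stable_def)
    show "emeasure \<mu> UNIV \<noteq> \<infinity>"
      using finite_measure.emeasure_finite[OF M1D(1)[OF M1(1)]] by simp
  qed (use closed_eq borel M1D(2) M1 in auto)
qed

subsection \<open>A space-filling curve\<close>

text \<open>A continuous function of period 2 which is 0 on \<open>[0, 1/3]\<close> and 1 on \<open>[2/3, 1]\<close>; it reads off ternary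
digits.  This is the building block of Schoenberg's space-filling curve.\<close>

definition ternary_pulse :: "real \<Rightarrow> real" where
  "ternary_pulse t = max 0 (min 1 (1/2 - cos (pi * t)))"

lemma ternary_pulse_range: "\<bar>ternary_pulse t\<bar> \<le> 1"
  by (auto simp: ternary_pulse_def)

text \<open>Multiplication by \<open>3 ^ m\<close> turns the digits before position \<open>m\<close> into an even integer, which the
period removes; the digit at \<open>m\<close> contributes 0 or \<open>2/3\<close>, and the later ones at most \<open>1/3\<close>.\<close>

lemma ternary_pulse_digit:
  fixes a :: "nat \<Rightarrow> bool"
  shows "ternary_pulse (3 ^ m * (\<Sum>j. 2 * of_bool (a j) / 3 ^ Suc j)) = of_bool (a m)"
proof -
  define d where "d j = 2 * of_bool (a j) / (3::real) ^ Suc j" for j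
  have d: "0 \<le> d j" "d j \<le> 2/3 * (1/3)^j" for j
    by (auto simp: d_def power_divide)
  have geo: "(\<lambda>j. 2/3 * (1/3::real)^j) sums 1"
    using sums_mult[OF geometric_sums[of "1/3::real"], of "2/3"] by simp
  have sm: "summable d"
    by (rule summable_comparison_test'[OF sums_summable[OF geo], of 0]) (use d in auto)
  define r where "r = 3 ^ m * (\<Sum>j. d (j + Suc m))"
  have "\<exists>n. 3 ^ m * (\<Sum>j<m. d j) = 2 * real_of_int n"
  proof -
    have "3 ^ m * d j = 2 * of_int (of_bool (a j) * 3 ^ (m - Suc j))" if "j < m" for j
      using power_add[of "3::real" "Suc j" "m - Suc j"] that by (simp add: d_def)
    then have "(\<Sum>j<m. 3 ^ m * d j) = (\<Sum>j<m. 2 * of_int (of_bool (a j) * 3 ^ (m - Suc j)))"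
      by (intro sum.cong) auto
    then have "3 ^ m * (\<Sum>j<m. d j) = 2 * of_int (\<Sum>j<m. of_bool (a j) * 3 ^ (m - Suc j))"
      by (simp only: of_int_sum sum_distrib_left)
    then show ?thesis by blast
  qed
  then obtain n where n: "3 ^ m * (\<Sum>j<m. d j) = 2 * real_of_int n" by blast
  have r: "0 \<le> r" "r \<le> 1/3"
  proof -
    have sm': "summable (\<lambda>j. d (j + Suc m))" using sm by (simp only: summable_iff_shift)
    show "0 \<le> r" unfolding r_def using d(1) by (intro mult_nonneg_nonneg suminf_nonneg[OF sm']) auto
    have "(\<lambda>j. 2/3 * (1/3::real)^j * (1/3)^Suc m) sums (1 * (1/3)^Suc m)"
      by (rule sums_mult2[OF geo])
    then have s: "(\<lambda>j. 2/3 * (1/3::real)^(j + Suc m)) sums ((1/3)^Suc m)"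
      by (simp add: power_add mult.assoc)
    have "(\<Sum>j. d (j + Suc m)) \<le> (\<Sum>j. 2/3 * (1/3::real)^(j + Suc m))"
      by (rule suminf_le[OF d(2) sm' sums_summable[OF s]])
    also have "\<dots> = (1/3)^Suc m" using s by (rule sums_unique[symmetric])
    finally have "r \<le> 3 ^ m * (1/3)^Suc m" unfolding r_def by (intro mult_left_mono) auto
    also have "\<dots> = 1/3" by (simp add: power_divide)
    finally show "r \<le> 1/3" .
  qed
  have "(\<Sum>j. d j) = (\<Sum>j. d (j + Suc m)) + (\<Sum>j<Suc m. d j)"
    by (rule suminf_split_initial_segment[OF sm])
  then have "3 ^ m * (\<Sum>j. d j) = 2 * n + (3 ^ m * d m + r)"
    using n by (simp add: r_def algebra_simps)
  then have "pi * (3 ^ m * (\<Sum>j. d j)) = pi * (2 / 3 * of_bool (a m) + r) + 2 * pi * n"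
    by (simp add: d_def algebra_simps)
  then have cos: "cos (pi * (3 ^ m * (\<Sum>j. d j))) = cos (pi * (2 / 3 * of_bool (a m) + r))"
    by (simp add: cos_add)
  show ?thesis
  proof (cases "a m")
    case True
    have "cos (pi * (2 / 3 + r)) \<le> cos (2 * pi / 3)"
      using r mult_left_mono[of "2/3 + r" 1 pi] by (intro cos_monotone_0_pi_le) (auto simp: algebra_simps)
    then have "cos (pi * (2 / 3 + r)) \<le> - 1 / 2"
      by (simp add: cos_120)
    then show ?thesis
      using True cos by (simp add: ternary_pulse_def d_def)
  next
    case False
    have "cos (pi / 3) \<le> cos (pi * r)"
      using r mult_left_mono[of r "1/3" pi] by (intro cos_monotone_0_pi_le) auto
    then show ?thesis
      using False cos by (simp add: ternary_pulse_def d_def cos_60)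
  qed
qed

lemma binary_expansion:
  fixes x :: real
  assumes "0 \<le> x" "x < 1"
  shows "\<exists>b :: nat \<Rightarrow> bool. (\<lambda>k. of_bool (b k) * (1/2) ^ Suc k) sums x"
proof -
  define f where "f k = of_int \<lfloor>2 ^ k * x\<rfloor> * (1/2 :: real) ^ k" for k :: nat
  have floor_double: "\<lfloor>2 * y\<rfloor> - 2 * \<lfloor>y\<rfloor> = of_bool (\<lfloor>2 * y\<rfloor> - 2 * \<lfloor>y\<rfloor> = 1)" for y :: real
  proof -
    have "\<lfloor>2 * y\<rfloor> = 2 * \<lfloor>y\<rfloor> \<or> \<lfloor>2 * y\<rfloor> = 2 * \<lfloor>y\<rfloor> + 1" by linarith
    then show ?thesis by auto
  qed
  have step: "f (Suc k) - f k = of_bool (\<lfloor>2 * (2 ^ k * x)\<rfloor> - 2 * \<lfloor>2 ^ k * x\<rfloor> = 1) * (1/2) ^ Suc k" for k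
  proof -
    have "f (Suc k) - f k = of_int (\<lfloor>2 * (2 ^ k * x)\<rfloor> - 2 * \<lfloor>2 ^ k * x\<rfloor>) * (1/2) ^ Suc k"
      by (simp add: f_def algebra_simps)
    then show ?thesis by (subst (asm) floor_double) simp
  qed
  have "f \<longlonglongrightarrow> x"
  proof (rule LIM_zero_cancel, rule Lim_null_comparison)
    show "\<forall>\<^sub>F k in sequentially. norm (f k - x) \<le> (1/2) ^ k"
    proof (intro always_eventually allI)
      fix k
      have "f k - x = (of_int \<lfloor>2 ^ k * x\<rfloor> - 2 ^ k * x) * (1/2) ^ k"
        by (simp add: f_def algebra_simps power_divide)
      moreover have "\<bar>of_int \<lfloor>2 ^ k * x\<rfloor> - 2 ^ k * x\<bar> \<le> 1" by linarith
      ultimately show "norm (f k - x) \<le> (1/2) ^ k"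
        by (simp add: abs_mult mult_left_le_one_le)
    qed
    show "(\<lambda>k. (1/2::real) ^ k) \<longlonglongrightarrow> 0"
      by (rule LIMSEQ_realpow_zero) auto
  qed
  then have "(\<lambda>k. f (Suc k) - f k) sums (x - f 0)"
    by (rule telescope_sums)
  moreover have "f 0 = 0" using assms by (simp add: f_def) linarith
  ultimately show ?thesis
    unfolding step by (intro exI[of _ "\<lambda>k. \<lfloor>2 * (2 ^ k * x)\<rfloor> - 2 * \<lfloor>2 ^ k * x\<rfloor> = 1"]) simp
qed

text \<open>Coordinate \<open>i\<close> of the curve has as its \<open>k\<close>-th binary digit the ternary pulse at position \<open>e (k, i)\<close>.
Since \<open>e\<close> is injective, the digits of all coordinates can be prescribed independently.\<close>

lemma torus_space_filling_curve:
  "\<exists>\<gamma> :: real \<Rightarrow> 'n::finite torus. continuous_on UNIV \<gamma> \<and> \<gamma> ` {0..1} = UNIV"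
proof -
  define e :: "nat \<times> 'n \<Rightarrow> nat" where "e = to_nat"
  have e: "inj e" by (simp add: e_def)
  define \<gamma> where "\<gamma> t = to_torus (\<chi> i::'n. \<Sum>k. ternary_pulse (3 ^ e (k, i) * t) * (1/2) ^ Suc k)" for t
  have "continuous_on UNIV (\<lambda>t. \<chi> i::'n. \<Sum>k. ternary_pulse (3 ^ e (k, i) * t) * (1/2) ^ Suc k)"
  proof (intro continuous_on_vec_lambda continuous_on_geometric_series[where B = 1])
    show "norm (ternary_pulse (3 ^ e (k, i) * t) * (1/2) ^ Suc k) \<le> 1 * (1/2) ^ k" for k i t
    proof -
      have "norm (ternary_pulse (3 ^ e (k, i) * t) * (1/2) ^ Suc k) \<le> 1 * (1/2) ^ Suc k"
        unfolding norm_mult using ternary_pulse_range by (intro mult_mono) auto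
      then show ?thesis by simp
    qed
    show "continuous_on UNIV (\<lambda>t. ternary_pulse (3 ^ e (k, i) * t) * (1/2) ^ Suc k)" for k i
      unfolding ternary_pulse_def by (intro continuous_intros)
  qed
  then have cont: "continuous_on UNIV \<gamma>"
    unfolding \<gamma>_def by (rule continuous_on_compose2[OF continuous_on_to_torus]) auto
  have "\<exists>t\<in>{0..1}. \<gamma> t = x" for x
  proof -
    define z where "z = rep_torus x"
    have "\<exists>b :: nat \<Rightarrow> bool. (\<lambda>k. of_bool (b k) * (1/2) ^ Suc k) sums frac (z $ i)" for i
      by (rule binary_expansion) (auto simp: frac_lt_1)
    then obtain b where b: "\<And>i. (\<lambda>k. of_bool (b i k) * (1/2) ^ Suc k) sums frac (z $ i)"
      by metis
    define a where "a m = (\<exists>k i. m = e (k, i) \<and> b i k)" for m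
    have a: "a (e (k, i)) = b i k" for k i
      using e by (auto simp: a_def inj_eq)
    define t where "t = (\<Sum>j. 2 * of_bool (a j) / (3::real) ^ Suc j)"
    have geo: "(\<lambda>j. 2/3 * (1/3::real)^j) sums 1"
      using sums_mult[OF geometric_sums[of "1/3::real"], of "2/3"] by simp
    have le: "2 * of_bool (a j) / (3::real) ^ Suc j \<le> 2/3 * (1/3)^j" for j
      by (auto simp: power_divide)
    have sm: "summable (\<lambda>j. 2 * of_bool (a j) / (3::real) ^ Suc j)"
      by (rule summable_comparison_test'[OF sums_summable[OF geo], of 0]) (use le in auto)
    have "0 \<le> t"
      unfolding t_def by (rule suminf_nonneg[OF sm]) auto
    moreover have "t \<le> 1"
      using suminf_le[OF le sm sums_summable[OF geo]] sums_unique[OF geo] by (simp add: t_def)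
    moreover have "\<gamma> t = x"
    proof -
      have "(\<Sum>k. ternary_pulse (3 ^ e (k, i) * t) * (1/2) ^ Suc k) = frac (z $ i)" for i
        unfolding t_def ternary_pulse_digit a using sums_unique[OF b[of i]] by simp
      then have "\<gamma> t = to_torus (\<chi> i. frac (z $ i))"
        by (simp add: \<gamma>_def)
      also have "\<dots> = to_torus z"
        by (simp add: to_torus_eq_iff frac_def)
      finally show ?thesis by (simp add: z_def)
    qed
    ultimately show ?thesis by auto
  qed
  then have "\<gamma> ` {0..1} = UNIV" by (metis UNIV_eq_I image_eqI)
  then show ?thesis using cont by blast
qed

text \<open>Choose the first parameter at which the curve visits the point.  Its sublevel sets are images of
compact intervals, hence closed.\<close>

lemma continuous_surjection_borel_section:
  fixes \<gamma> :: "real \<Rightarrow> 'a::t2_space"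
  assumes cont: "continuous_on UNIV \<gamma>" and surj: "\<gamma> ` {0..1} = UNIV"
  obtains s where "s \<in> borel_measurable borel" "\<And>x. s x \<in> {0..1}" "\<And>x. \<gamma> (s x) = x"
proof -
  define s where "s x = Inf ({0..1} \<inter> \<gamma> -` {x})" for x
  have s: "s x \<in> {0..1} \<inter> \<gamma> -` {x}" for x
    unfolding s_def
  proof (rule closed_contains_Inf)
    show "closed ({0..1} \<inter> \<gamma> -` {x})"
      using cont by (intro closed_Int closed_real_atLeastAtMost continuous_closed_vimage)
        (auto simp: continuous_on_eq_continuous_at)
    have "x \<in> \<gamma> ` {0..1}" using surj by simp
    then show "{0..1} \<inter> \<gamma> -` {x} \<noteq> {}" by auto
  qed (auto intro: bdd_below.I[of _ 0])
  have s_le: "s x \<le> t" if "t \<in> {0..1}" "\<gamma> t = x" for t x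
    unfolding s_def by (rule cInf_lower) (use that in \<open>auto intro: bdd_below.I[of _ 0]\<close>)
  have level: "{x. s x \<le> a} = \<gamma> ` ({0..1} \<inter> {..a})" for a
  proof (intro equalityI subsetI)
    fix x assume "x \<in> {x. s x \<le> a}"
    then show "x \<in> \<gamma> ` ({0..1} \<inter> {..a})"
      using s[of x] by (intro image_eqI[of _ _ "s x"]) auto
  next
    fix x assume "x \<in> \<gamma> ` ({0..1} \<inter> {..a})"
    then show "x \<in> {x. s x \<le> a}"
      using s_le by fastforce
  qed
  have "compact ({0..1} \<inter> {..a})" for a :: real
    using compact_Int_closed[OF compact_Icc closed_atMost] .
  then have "closed {x. s x \<le> a}" for a
    unfolding level
    by (intro compact_imp_closed compact_continuous_image continuous_on_subset[OF cont]) auto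
  then have "s \<in> borel_measurable borel"
    unfolding borel_measurable_iff_le by auto
  then show ?thesis using s that by auto
qed

subsection \<open>Weak sequential compactness\<close>

definition weak_tendsto :: "(nat \<Rightarrow> 'n::finite torus measure) \<Rightarrow> 'n torus measure \<Rightarrow> bool" where
  "weak_tendsto m \<mu> \<longleftrightarrow> (\<forall>F :: 'n torus \<Rightarrow> real. continuous_on UNIV F \<longrightarrow>
     (\<lambda>n. \<integral>x. F x \<partial>m n) \<longlonglongrightarrow> (\<integral>x. F x \<partial>\<mu>))"

lemma M1_scaled_distr:
  fixes \<gamma> :: "real \<Rightarrow> 'n::finite torus"
  assumes \<gamma>: "continuous_on UNIV \<gamma>" and "real_distribution P" and a: "0 \<le> a" "a \<le> 1"
  shows "density (distr P borel \<gamma>) (\<lambda>_. ennreal a) \<in> M1" (is "?D \<in> M1")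
    and "continuous_on UNIV F \<Longrightarrow>
      (\<integral>x. F x \<partial>density (distr P borel \<gamma>) (\<lambda>_. ennreal a)) = a * (\<integral>t. F (\<gamma> t) \<partial>P)"
proof -
  interpret P: real_distribution P by fact
  have \<gamma>m: "\<gamma> \<in> measurable P borel"
    using borel_measurable_continuous_onI[OF \<gamma>] by (simp add: measurable_cong_sets[OF P.events_eq_borel refl])
  then interpret D: prob_space "distr P borel \<gamma>"
    by (rule P.prob_space_distr)
  have "emeasure ?D UNIV = ennreal a"
    using D.emeasure_space_1 by (subst emeasure_density_const) auto
  then show "?D \<in> M1"
    using a by (simp add: M1_def)
  assume F: "continuous_on UNIV F"
  then have Fm: "F \<in> borel_measurable borel" by (rule borel_measurable_continuous_onI)
  have "(\<integral>x. F x \<partial>?D) = a * (\<integral>x. F x \<partial>distr P borel \<gamma>)"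
    using Fm a by (subst integral_density) auto
  also have "\<dots> = a * (\<integral>t. F (\<gamma> t) \<partial>P)"
    using Fm \<gamma>m by (subst integral_distr) auto
  finally show "(\<integral>x. F x \<partial>?D) = a * (\<integral>t. F (\<gamma> t) \<partial>P)" .
qed

text \<open>The normalised measure is carried to the interval by the section \<open>s\<close>; the zero measure, which cannot
be normalised, is represented by an arbitrary distribution with factor 0.\<close>

lemma M1_lift_to_interval:
  fixes \<gamma> :: "real \<Rightarrow> 'n::finite torus"
  assumes s: "s \<in> borel_measurable borel" "\<And>x. s x \<in> {0..1}" "\<And>x. \<gamma> (s x) = x"
    and \<gamma>: "continuous_on UNIV \<gamma>" and \<mu>: "\<mu> \<in> M1"
  shows "\<exists>P. real_distribution P \<and> measure P {-1<..1} = 1 \<and>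
    (\<forall>F :: 'n torus \<Rightarrow> real. continuous_on UNIV F \<longrightarrow> (\<integral>x. F x \<partial>\<mu>) = measure \<mu> UNIV * (\<integral>t. F (\<gamma> t) \<partial>P))"
proof -
  interpret \<mu>: finite_measure \<mu> by (rule M1D[OF \<mu>])
  note sets = M1D(2)[OF \<mu>] and space = M1D(3)[OF \<mu>]
  define a where "a = measure \<mu> UNIV"
  have a: "0 \<le> a" by (simp add: a_def)
  show ?thesis
  proof (cases "a = 0")
    case True
    then have "emeasure \<mu> UNIV = 0"
      by (simp add: a_def \<mu>.emeasure_eq_measure)
    then have "AE x in \<mu>. F x = 0" for F :: "'n torus \<Rightarrow> real"
      by (intro AE_I[of _ _ UNIV]) (auto simp: sets)
    then have zero: "(\<integral>x. F x \<partial>\<mu>) = 0" for F :: "'n torus \<Rightarrow> real"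
      by (rule integral_eq_zero_AE)
    have "prob_space (return borel (0::real))" by (rule prob_space_return) simp
    then have "real_distribution (return borel (0::real))"
      by (auto simp: real_distribution_def real_distribution_axioms_def)
    moreover have "measure (return borel (0::real)) {-1<..1} = 1"
      by (simp add: measure_return)
    ultimately show ?thesis
      using zero True by (intro exI[of _ "return borel 0"]) (auto simp: a_def)
  next
    case False
    with a have pos: "a > 0" by simp
    define Q where "Q = density \<mu> (\<lambda>_. ennreal (1 / a))"
    have "emeasure Q UNIV = 1"
      unfolding Q_def using pos sets.top[of \<mu>] space
      by (subst emeasure_density_const) (auto simp: \<mu>.emeasure_eq_measure a_def ennreal_mult[symmetric])
    then interpret Q: prob_space Q
      by (intro prob_spaceI) (simp add: Q_def space)
    have sm: "s \<in> borel_measurable Q"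
      using s(1) by (simp add: Q_def measurable_cong_sets[OF sets refl])
    define P where "P = distr Q borel s"
    have "real_distribution P"
      unfolding P_def by (rule Q.real_distribution_distr[OF sm])
    moreover have "measure P {-1<..1} = 1"
    proof -
      have "s -` {-1<..1} \<inter> space Q = space Q"
        using s(2) by (auto intro!: less_le_trans[OF neg_less_0_iff_less[THEN iffD2, OF zero_less_one]])
      then show ?thesis
        unfolding P_def by (simp add: measure_distr[OF sm] Q.prob_space)
    qed
    moreover have "(\<integral>x. F x \<partial>\<mu>) = a * (\<integral>t. F (\<gamma> t) \<partial>P)" if F: "continuous_on UNIV F" for F :: "'n torus \<Rightarrow> real"
    proof -
      have Fm: "F \<in> borel_measurable \<mu>"
        using borel_measurable_continuous_onI[OF F] measurable_cong_sets[OF sets refl] by blast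
      have "(\<lambda>t. F (\<gamma> t)) \<in> borel_measurable borel"
        by (intro borel_measurable_continuous_onI continuous_on_compose2[OF F \<gamma>]) auto
      then have "(\<integral>t. F (\<gamma> t) \<partial>P) = (\<integral>x. F x \<partial>Q)"
        unfolding P_def using sm s(3) by (subst integral_distr) auto
      also have "\<dots> = (1 / a) * (\<integral>x. F x \<partial>\<mu>)"
        unfolding Q_def using Fm a by (subst integral_density) auto
      finally show ?thesis using pos by simp
    qed
    ultimately show ?thesis by (auto simp: a_def)
  qed
qed

text \<open>The lifted distributions live on \<open>[0, 1]\<close> and hence are tight.  Continuous functions on the torus
become bounded continuous functions on the line after composition with the curve, so weak
convergence on the line suffices, even though the limit need not be concentrated on the range of the
section.\<close>

theorem M1_seq_compact:
  fixes m :: "nat \<Rightarrow> 'n::finite torus measure"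
  assumes m: "\<And>n. m n \<in> M1"
  shows "\<exists>\<mu>\<in>M1. \<exists>r. strict_mono r \<and> weak_tendsto (\<lambda>n. m (r n)) \<mu>"
proof -
  obtain \<gamma> :: "real \<Rightarrow> 'n torus" where \<gamma>: "continuous_on UNIV \<gamma>" "\<gamma> ` {0..1} = UNIV"
    using torus_space_filling_curve by blast
  obtain s where s: "s \<in> borel_measurable borel" "\<And>x. s x \<in> {0..1}" "\<And>x. \<gamma> (s x) = x"
    using continuous_surjection_borel_section[OF \<gamma>] by blast
  define a where "a n = measure (m n) UNIV" for n
  obtain P where P: "\<And>n. real_distribution (P n)" "\<And>n. measure (P n) {-1<..1} = 1"
    and int: "\<And>n (F :: 'n torus \<Rightarrow> real). continuous_on UNIV F \<Longrightarrow> (\<integral>x. F x \<partial>m n) = a n * (\<integral>t. F (\<gamma> t) \<partial>P n)"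
    using M1_lift_to_interval[OF s \<gamma>(1) m] unfolding a_def by metis
  have "\<forall>n. a n \<in> {0..1}" using M1D(4)[OF m] by (simp add: a_def)
  then obtain \<alpha> r where \<alpha>: "\<alpha> \<in> {0..1}" and r: "strict_mono r" and lim: "(a \<circ> r) \<longlonglongrightarrow> \<alpha>"
    using compact_imp_seq_compact[OF compact_Icc, of 0 "1::real"] unfolding seq_compact_def by metis
  have "tight P"
    unfolding tight_def
  proof (intro conjI allI impI P)
    show "\<exists>a b. a < b \<and> (\<forall>n. measure (P n) {a<..b} > 1 - \<epsilon>)" if "\<epsilon> > 0" for \<epsilon> :: real
      using that P(2) by (intro exI[of _ "-1"] exI[of _ 1]) simp
  qed
  then obtain r' Q where r': "strict_mono r'" and Q: "real_distribution Q" and conv: "weak_conv_m (P \<circ> r \<circ> r') Q"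
    using tight_imp_convergent_subsubsequence[OF _ r] by blast
  define \<mu> where "\<mu> = density (distr Q borel \<gamma>) (\<lambda>_. ennreal \<alpha>)"
  have "\<mu> \<in> M1"
    unfolding \<mu>_def using \<alpha> by (intro M1_scaled_distr[OF \<gamma>(1) Q]) auto
  moreover have "weak_tendsto (\<lambda>n. m (r (r' n))) \<mu>"
    unfolding weak_tendsto_def
  proof (intro allI impI)
    fix F :: "'n torus \<Rightarrow> real"
    assume F: "continuous_on UNIV F"
    obtain B where B: "\<And>x. norm (F x) \<le> B"
      using continuous_torus_bounded[OF F] by blast
    have "continuous_on UNIV (\<lambda>t. F (\<gamma> t))"
      by (rule continuous_on_compose2[OF F \<gamma>(1)]) auto
    then have cont: "isCont (\<lambda>t. F (\<gamma> t)) t" for t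
      by (simp add: continuous_on_eq_continuous_at)
    have "(\<lambda>n. \<integral>t. F (\<gamma> t) \<partial>(P \<circ> r \<circ> r') n) \<longlonglongrightarrow> (\<integral>t. F (\<gamma> t) \<partial>Q)"
      by (rule weak_conv_imp_integral_bdd_continuous_conv[OF _ Q conv cont B]) (simp add: P)
    moreover have "(\<lambda>n. a (r (r' n))) \<longlonglongrightarrow> \<alpha>"
      using LIMSEQ_subseq_LIMSEQ[OF lim r'] by (simp add: o_def)
    ultimately have "(\<lambda>n. a (r (r' n)) * (\<integral>t. F (\<gamma> t) \<partial>P (r (r' n)))) \<longlonglongrightarrow> \<alpha> * (\<integral>t. F (\<gamma> t) \<partial>Q)"
      by (intro tendsto_mult) auto
    then show "(\<lambda>n. \<integral>x. F x \<partial>m (r (r' n))) \<longlonglongrightarrow> (\<integral>x. F x \<partial>\<mu>)"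
      unfolding int[OF F] \<mu>_def using \<alpha> by (subst M1_scaled_distr(2)[OF \<gamma>(1) Q _ _ F]) auto
  qed
  ultimately show ?thesis
    using strict_mono_o[OF r r'] by (auto simp: o_def)
qed

lemma limitin_M1_topology:
  fixes m :: "nat \<Rightarrow> 'n::finite torus measure"
  assumes "weak_tendsto m \<mu>" "\<And>n. m n \<in> M1" "\<mu> \<in> M1"
  shows "limitin M1_topology m \<mu> sequentially"
  unfolding limitin_def topspace_M1_topology
proof (intro conjI allI impI)
  show "\<mu> \<in> M1" by fact
  fix U assume "openin M1_topology U \<and> \<mu> \<in> U"
  then have "generate_topology_on {{\<mu> \<in> M1. (\<integral>x. \<phi> x \<partial>\<mu>) \<in> V} | \<phi> V. continuous_on UNIV \<phi> \<and> open (V :: real set)} U"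
    and "\<mu> \<in> U"
    by (simp_all add: M1_topology_def openin_topology_generated_by_iff)
  then show "\<forall>\<^sub>F n in sequentially. m n \<in> U"
  proof (induction rule: generate_topology_on.induct)
    case (Int a b)
    then show ?case by (auto intro: eventually_conj)
  next
    case (UN K)
    then obtain k where "k \<in> K" "\<mu> \<in> k" by blast
    then have "\<forall>\<^sub>F n in sequentially. m n \<in> k" by (rule UN.IH)
    then show ?case by eventually_elim (use \<open>k \<in> K\<close> in blast)
  next
    case (Basis S)
    then obtain \<phi> and V :: "real set" where S: "S = {\<mu> \<in> M1. (\<integral>x. \<phi> x \<partial>\<mu>) \<in> V}" and "continuous_on UNIV \<phi>" "open V"
      by blast
    then have "\<forall>\<^sub>F n in sequentially. (\<integral>x. \<phi> x \<partial>m n) \<in> V"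
      using assms(1) Basis.prems by (intro topological_tendstoD) (auto simp: weak_tendsto_def)
    then show ?case
      using assms(2) by (simp add: S)
  qed simp
qed

text \<open>The mixture is the law of a point drawn from \<open>\<nu>\<close> or \<open>\<mu>\<close> according to a Bernoulli variable.\<close>

lemma M1_mixture:
  fixes \<mu> \<nu> :: "'n::finite torus measure"
  assumes M1: "\<mu> \<in> M1" "\<nu> \<in> M1" and p: "0 \<le> p" "p \<le> 1"
  shows "\<exists>\<rho>\<in>M1. \<forall>F :: 'n torus \<Rightarrow> real. continuous_on UNIV F \<longrightarrow>
    (\<integral>x. F x \<partial>\<rho>) = p * (\<integral>x. F x \<partial>\<nu>) + (1 - p) * (\<integral>x. F x \<partial>\<mu>)"
proof -
  define K where "K b = (if b then \<nu> else \<mu>)" for b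
  have "m \<in> space (subprob_algebra borel)" if "m \<in> M1" for m :: "'n torus measure"
    using that M1D(2,3)[OF that] by (auto simp: space_subprob_algebra M1_def intro!: subprob_spaceI)
  then have K: "K \<in> measurable (bernoulli_pmf p) (subprob_algebra borel)"
    using M1 by (simp add: K_def)
  define \<rho> where "\<rho> = bind (measure_pmf (bernoulli_pmf p)) K"
  interpret sub: subprob_space \<rho>
    unfolding \<rho>_def by (rule subprob_space_bind[OF _ K]) (rule prob_space_imp_subprob_space, rule measure_pmf.prob_space_axioms)
  have sets: "sets \<rho> = sets borel"
    unfolding \<rho>_def by (rule sets_bind) (use K in \<open>auto simp: space_subprob_algebra\<close>)
  have "\<rho> \<in> M1"
    using sub.emeasure_space_le_1 sets sets_eq_imp_space_eq[OF sets] by (simp add: M1_def)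
  moreover have "(\<integral>x. F x \<partial>\<rho>) = p * (\<integral>x. F x \<partial>\<nu>) + (1 - p) * (\<integral>x. F x \<partial>\<mu>)"
    if F: "continuous_on UNIV F" for F :: "'n torus \<Rightarrow> real"
  proof -
    obtain B where B: "\<And>x. norm (F x) \<le> B"
      using continuous_torus_bounded[OF F] by blast
    have "(\<integral>x. F x \<partial>\<rho>) = (\<integral>b. (\<integral>x. F x \<partial>K b) \<partial>bernoulli_pmf p)"
      unfolding \<rho>_def
    proof (rule integral_bind[OF borel_measurable_continuous_onI[OF F] _ K])
      show "AE b in bernoulli_pmf p. emeasure (K b) (space (K b)) \<le> ennreal 1"
        using M1 M1D(3)[OF M1(1)] M1D(3)[OF M1(2)] by (auto simp: K_def M1_def)
    qed (use B in \<open>auto intro: measure_pmf.finite_measure\<close>)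
    then show ?thesis
      using p by (simp add: K_def mult.commute)
  qed
  ultimately show ?thesis by blast
qed

section \<open>Convex Hamiltonians\<close>

lemma C1_hamiltonian_lift:
  assumes "C1_hamiltonian (H :: 'n::finite torus \<Rightarrow> _)"
  obtains D :: "(real^'n) \<times> (real^'n) \<Rightarrow> real^'n"
  where "continuous_on UNIV D" "\<And>y p. GDERIV (H (to_torus y)) p :> D (y, p)"
    "\<And>y p. DpH H (to_torus y) p = D (y, p)"
    "continuous_on UNIV (\<lambda>(y, p). H (to_torus y) p)"
proof -
  obtain D where D: "\<And>w. GDERIV (\<lambda>(y, p). H (to_torus y) p) w :> D w" and cont: "continuous_on UNIV D"
    using assms unfolding C1_hamiltonian_def by blast
  have G: "GDERIV (H (to_torus y)) p :> snd (D (y, p))" for y p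
  proof -
    have "((\<lambda>q. (y, q)) has_derivative (\<lambda>h. (0, h))) (at p)"
      by (auto intro!: derivative_eq_intros)
    from has_derivative_compose[OF this D[of "(y, p)", unfolded gderiv_def]]
    show ?thesis by (simp add: gderiv_def inner_prod_def)
  qed
  moreover have "DpH H (to_torus y) p = snd (D (y, p))" for y p
    unfolding DpH_def
  proof (rule the_equality[where P = "\<lambda>E. GDERIV (H (to_torus y)) p :> E", OF G])
    fix E assume "GDERIV (H (to_torus y)) p :> E"
    then have "(\<lambda>h. h \<bullet> E) = (\<lambda>h. h \<bullet> snd (D (y, p)))"
      using G[of y p] has_derivative_unique unfolding gderiv_def by blast
    then show "E = snd (D (y, p))"
      by (metis vector_eq_ldot)
  qed
  moreover have "isCont (\<lambda>(y, p). H (to_torus y) p) w" for w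
    using D[of w] unfolding gderiv_def by (rule has_derivative_continuous)
  then have "continuous_on UNIV (\<lambda>(y, p). H (to_torus y) p)"
    by (simp add: continuous_on_eq_continuous_at)
  moreover have "continuous_on UNIV (\<lambda>w. snd (D w))"
    using cont by (rule continuous_on_snd)
  ultimately show ?thesis using that by blast
qed

lemma C1_hamiltonian_continuous:
  assumes H: "C1_hamiltonian (H :: 'n::finite torus \<Rightarrow> _)" and G: "continuous_on UNIV G"
  shows "continuous_on UNIV (\<lambda>x. H x (G x))" "continuous_on UNIV (\<lambda>x. DpH H x (G x))"
proof -
  obtain D where D: "continuous_on UNIV D" "\<And>y p. DpH H (to_torus y) p = D (y, p)"
    "continuous_on UNIV (\<lambda>(y, p). H (to_torus y) p)"
    using C1_hamiltonian_lift[OF H] by metis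
  have "continuous_on UNIV (\<lambda>y. (y, G (to_torus y)))"
    using G by (auto simp: continuous_on_torus_iff intro!: continuous_on_Pair continuous_on_id)
  from continuous_on_compose2[OF D(3) this] continuous_on_compose2[OF D(1) this]
  show "continuous_on UNIV (\<lambda>x. H x (G x))" "continuous_on UNIV (\<lambda>x. DpH H x (G x))"
    by (simp_all add: continuous_on_torus_iff D(2))
qed

lemma DpH_bounded:
  assumes H: "C1_hamiltonian (H :: 'n::finite torus \<Rightarrow> _)"
  obtains B where "B > 0" "\<And>x p. norm p \<le> C \<Longrightarrow> norm (DpH H x p) \<le> B"
proof -
  obtain D where D: "continuous_on UNIV D" "\<And>y p. DpH H (to_torus y) p = D (y, p)"
    using C1_hamiltonian_lift[OF H] by metis
  have "compact (D ` (cbox 0 1 \<times> cball 0 C))"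
    by (intro compact_continuous_image continuous_on_subset[OF D(1)] compact_Times compact_cbox compact_cball) auto
  then obtain B where B: "B > 0" "\<forall>z\<in>D ` (cbox 0 1 \<times> cball 0 C). norm z \<le> B"
    using compact_imp_bounded bounded_pos by metis
  have "norm (DpH H x p) \<le> B" if "norm p \<le> C" for x p
  proof -
    obtain y where y: "y \<in> cbox 0 1" "to_torus y = x"
      using torus_representative_in_unit_cube by blast
    have "DpH H x p = D (y, p)" using D(2) y(2) by blast
    then show ?thesis using B(2) y(1) that by simp
  qed
  then show ?thesis using B(1) that by blast
qed

lemma convex_hamiltonian_above_tangent:
  assumes H: "C1_hamiltonian (H :: 'n::finite torus \<Rightarrow> _)" and conv: "convex_on UNIV (H x)"
  shows "H x q \<ge> H x p + (q - p) \<bullet> DpH H x p"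
proof -
  obtain D where D: "\<And>y p. GDERIV (H (to_torus y)) p :> D (y, p)" "\<And>y p. DpH H (to_torus y) p = D (y, p)"
    using C1_hamiltonian_lift[OF H] by metis
  have G: "GDERIV (H x) p :> DpH H x p"
    using D[of "rep_torus x" p] by simp
  define g where "g r = H x (p + r *\<^sub>R (q - p))" for r :: real
  have "convex_on UNIV g"
  proof (rule convex_onI)
    fix u r s :: real
    assume "0 < u" "u < 1"
    moreover have "p + ((1 - u) *\<^sub>R r + u *\<^sub>R s) *\<^sub>R (q - p)
        = (1 - u) *\<^sub>R (p + r *\<^sub>R (q - p)) + u *\<^sub>R (p + s *\<^sub>R (q - p))"
      by (simp add: algebra_simps)
    ultimately show "g ((1 - u) *\<^sub>R r + u *\<^sub>R s) \<le> (1 - u) * g r + u * g s"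
      unfolding g_def using convex_onD[OF conv, of u] by simp
  qed auto
  moreover have "(g has_real_derivative ((q - p) \<bullet> DpH H x p)) (at 0)"
  proof -
    have "((\<lambda>r. p + r *\<^sub>R (q - p)) has_derivative (\<lambda>r. r *\<^sub>R (q - p))) (at 0)"
      by (auto intro!: derivative_eq_intros)
    moreover have "(H x has_derivative (\<lambda>h. h \<bullet> DpH H x p)) (at (p + 0 *\<^sub>R (q - p)))"
      using G by (simp add: gderiv_def)
    ultimately have "(g has_derivative (\<lambda>r. (r *\<^sub>R (q - p)) \<bullet> DpH H x p)) (at 0)"
      unfolding g_def by (rule has_derivative_compose)
    then show ?thesis
      by (simp add: has_field_derivative_def mult_commute_abs)
  qed
  ultimately have "g 1 - g 0 \<ge> ((q - p) \<bullet> DpH H x p) * (1 - 0)"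
    by (intro convex_on_imp_above_tangent[of UNIV]) auto
  then show ?thesis by (simp add: g_def)
qed

section \<open>The doubled equation\<close>

lemma M1_integral_ge:
  fixes F :: "'n::finite torus \<Rightarrow> real"
  assumes \<mu>: "\<mu> \<in> M1" and F: "continuous_on UNIV F" and k: "k \<ge> 0" "\<And>x. F x \<ge> - k"
  shows "(\<integral>x. F x \<partial>\<mu>) \<ge> - k"
proof -
  interpret finite_measure \<mu> by (rule M1D[OF \<mu>])
  have "- k \<le> - k * measure \<mu> UNIV"
    using M1D(4)[OF \<mu>] k(1) mult_left_le by (simp add: mult_left_le)
  also have "\<dots> = (\<integral>x. - k \<partial>\<mu>)"
    by (simp add: M1D(3)[OF \<mu>])
  also have "\<dots> \<le> (\<integral>x. F x \<partial>\<mu>)"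
    using k(2) by (intro integral_mono M1_integrable[OF \<mu> F]) auto
  finally show ?thesis .
qed

text \<open>This is the heart of the comparison.  Collect everything as one integral against \<open>\<mu>\<close> and one against
\<open>\<nu>\<close>.  The Laplacians of \<open>u\<close> and \<open>v\<close> cancel in each of them.  The Hamiltonian terms are
the gap between \<open>H\<close> and its tangent at the gradient of \<open>u\<close> (for \<open>\<mu>\<close>) or of \<open>v\<close> (for \<open>\<nu>\<close>), which is
nonnegative.  Only the contributions of the perturbations \<open>\<Phi>\<close> and \<open>\<Psi>\<close> have no sign.\<close>

lemma doubled_equation_lower_bound:
  fixes u v \<Phi> \<Psi> :: "'n::finite torus \<Rightarrow> real"
  assumes M1: "\<mu> \<in> M1" "\<nu> \<in> M1"
    and C2: "torus_C2 u" "torus_C2 v" "torus_C2 \<Phi>" "torus_C2 \<Psi>"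
    and F: "continuous_on UNIV F" "continuous_on UNIV G" "pair_diff (\<lambda>x. F x - G x) \<mu> \<nu> \<ge> 0"
    and H: "C1_hamiltonian H" "\<And>x. convex_on UNIV (H x)"
    and B: "\<And>x. norm (DpH H x (torus_grad u x)) \<le> B" "\<And>x. norm (DpH H x (torus_grad v x)) \<le> B"
    and e: "\<And>x. norm (torus_grad \<Phi> x) \<le> e" "\<And>x. norm (torus_grad \<Psi> x) \<le> e"
    and e': "\<And>x. \<bar>torus_lap \<Phi> x\<bar> \<le> e'" "\<And>x. \<bar>torus_lap \<Psi> x\<bar> \<le> e'"
    and "\<sigma> \<ge> 0"
  shows "pair_diff (\<lambda>x. F x - H x (torus_grad u x) + \<sigma> * torus_lap u x) \<mu> \<nu>
      + pair_FP \<sigma> (\<lambda>x. u x - (v x - \<Phi> x)) (\<lambda>x. DpH H x (torus_grad u x)) \<mu>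
      + (pair_diff (\<lambda>x. G x - H x (torus_grad v x) + \<sigma> * torus_lap v x) \<nu> \<mu>
      + pair_FP \<sigma> (\<lambda>x. v x - (u x - \<Psi> x)) (\<lambda>x. DpH H x (torus_grad v x)) \<nu>)
      \<ge> - 2 * (B * e + \<sigma> * e')"
proof -
  define k where "k = B * e + \<sigma> * e'"
  have nonneg: "0 \<le> B" "0 \<le> e" "0 \<le> e'"
    using order_trans[OF norm_ge_zero B(1)] order_trans[OF norm_ge_zero e(1)] order_trans[OF abs_ge_zero e'(1)] by auto
  then have k: "k \<ge> 0" using \<open>\<sigma> \<ge> 0\<close> by (simp add: k_def)
  define hu where "hu x = H x (torus_grad u x)" for x
  define hv where "hv x = H x (torus_grad v x)" for x
  define bu where "bu x = DpH H x (torus_grad u x)" for x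
  define bv where "bv x = DpH H x (torus_grad v x)" for x
  define lu lv l\<Phi> l\<Psi> where "lu = torus_lap u" and "lv = torus_lap v" and "l\<Phi> = torus_lap \<Phi>" and "l\<Psi> = torus_lap \<Psi>"
  define du where "du x = (torus_grad u x - torus_grad v x + torus_grad \<Phi> x) \<bullet> bu x" for x
  define dv where "dv x = (torus_grad v x - torus_grad u x + torus_grad \<Psi> x) \<bullet> bv x" for x
  have test: "torus_grad (\<lambda>x. a x - (b x - c x)) x = torus_grad a x - torus_grad b x + torus_grad c x"
    "torus_lap (\<lambda>x. a x - (b x - c x)) x = torus_lap a x - torus_lap b x + torus_lap c x"
    if "torus_C2 a" "torus_C2 b" "torus_C2 c" for a b c :: "'n torus \<Rightarrow> real" and x
    using that by (simp_all add: torus_C2_diff)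
  have cont: "continuous_on UNIV hu" "continuous_on UNIV hv" "continuous_on UNIV lu" "continuous_on UNIV lv"
    "continuous_on UNIV l\<Phi>" "continuous_on UNIV l\<Psi>" "continuous_on UNIV du" "continuous_on UNIV dv"
    unfolding hu_def[abs_def] hv_def[abs_def] lu_def lv_def l\<Phi>_def l\<Psi>_def
      du_def[abs_def] dv_def[abs_def] bu_def bv_def
    by (intro C1_hamiltonian_continuous[OF H(1)] torus_C2_continuous(2,3) C2
        continuous_on_inner continuous_on_add continuous_on_diff)+
  have int: "integrable m F" "integrable m G" "integrable m hu" "integrable m hv" "integrable m lu" "integrable m lv"
    "integrable m l\<Phi>" "integrable m l\<Psi>" "integrable m du" "integrable m dv" if "m \<in> M1" for m
    by (intro M1_integrable[OF that] F cont)+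
  have small: "a \<bullet> b - \<sigma> * l \<ge> - k" if "norm a \<le> e" "norm b \<le> B" "\<bar>l\<bar> \<le> e'" for a b :: "real^'n" and l
  proof -
    have "\<bar>a \<bullet> b\<bar> \<le> e * B"
      using Cauchy_Schwarz_ineq2[of a b] mult_mono[OF that(1,2) nonneg(2)] by simp
    moreover have "\<sigma> * l \<le> \<sigma> * e'"
      using that(3) \<open>\<sigma> \<ge> 0\<close> by (intro mult_left_mono) auto
    ultimately show ?thesis by (simp add: k_def mult.commute[of B])
  qed
  have A: "- k \<le> (\<integral>x. hv x - hu x + du x - \<sigma> * l\<Phi> x \<partial>\<mu>)"
  proof (rule M1_integral_ge[OF M1(1) _ k])
    show "continuous_on UNIV (\<lambda>x. hv x - hu x + du x - \<sigma> * l\<Phi> x)"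
      by (intro continuous_intros cont)
    fix x
    have "hv x - hu x - (torus_grad v x - torus_grad u x) \<bullet> bu x \<ge> 0"
      using convex_hamiltonian_above_tangent[OF H(1) H(2), of x "torus_grad u x" "torus_grad v x"]
      by (simp add: hu_def hv_def bu_def)
    moreover have "torus_grad \<Phi> x \<bullet> bu x - \<sigma> * l\<Phi> x \<ge> - k"
      using small e(1) B(1) e'(1) by (simp add: bu_def l\<Phi>_def)
    ultimately show "- k \<le> hv x - hu x + du x - \<sigma> * l\<Phi> x"
      by (simp add: du_def inner_add_left inner_diff_left)
  qed
  have C: "- k \<le> (\<integral>x. hu x - hv x + dv x - \<sigma> * l\<Psi> x \<partial>\<nu>)"
  proof (rule M1_integral_ge[OF M1(2) _ k])
    show "continuous_on UNIV (\<lambda>x. hu x - hv x + dv x - \<sigma> * l\<Psi> x)"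
      by (intro continuous_intros cont)
    fix x
    have "hu x - hv x - (torus_grad u x - torus_grad v x) \<bullet> bv x \<ge> 0"
      using convex_hamiltonian_above_tangent[OF H(1) H(2), of x "torus_grad v x" "torus_grad u x"]
      by (simp add: hu_def hv_def bv_def)
    moreover have "torus_grad \<Psi> x \<bullet> bv x - \<sigma> * l\<Psi> x \<ge> - k"
      using small e(2) B(2) e'(2) by (simp add: bv_def l\<Psi>_def)
    ultimately show "- k \<le> hu x - hv x + dv x - \<sigma> * l\<Psi> x"
      by (simp add: dv_def inner_add_left inner_diff_left)
  qed
  have FG: "(\<integral>x. F x \<partial>\<mu>) - (\<integral>x. G x \<partial>\<mu>) - ((\<integral>x. F x \<partial>\<nu>) - (\<integral>x. G x \<partial>\<nu>)) \<ge> 0"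
    using F(3) int[OF M1(1)] int[OF M1(2)] by (simp add: pair_diff_def)
  have FP: "pair_FP \<sigma> (\<lambda>x. u x - (v x - \<Phi> x)) bu \<mu>
      = (\<integral>x. du x \<partial>\<mu>) - \<sigma> * ((\<integral>x. lu x \<partial>\<mu>) - (\<integral>x. lv x \<partial>\<mu>) + (\<integral>x. l\<Phi> x \<partial>\<mu>))"
    "pair_FP \<sigma> (\<lambda>x. v x - (u x - \<Psi> x)) bv \<nu>
      = (\<integral>x. dv x \<partial>\<nu>) - \<sigma> * ((\<integral>x. lv x \<partial>\<nu>) - (\<integral>x. lu x \<partial>\<nu>) + (\<integral>x. l\<Psi> x \<partial>\<nu>))"
    using int[OF M1(1)] int[OF M1(2)]
    by (simp_all add: pair_FP_def test[OF C2(1,2,3)] test[OF C2(2,1,4)]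
        du_def[symmetric] dv_def[symmetric] lu_def[symmetric] lv_def[symmetric] l\<Phi>_def[symmetric] l\<Psi>_def[symmetric])
  have A': "- k \<le> (\<integral>x. hv x \<partial>\<mu>) - (\<integral>x. hu x \<partial>\<mu>) + (\<integral>x. du x \<partial>\<mu>) - \<sigma> * (\<integral>x. l\<Phi> x \<partial>\<mu>)"
    using A int[OF M1(1)] by simp
  have C': "- k \<le> (\<integral>x. hu x \<partial>\<nu>) - (\<integral>x. hv x \<partial>\<nu>) + (\<integral>x. dv x \<partial>\<nu>) - \<sigma> * (\<integral>x. l\<Psi> x \<partial>\<nu>)"
    using C int[OF M1(2)] by simp
  have PD: "pair_diff (\<lambda>x. F x - hu x + \<sigma> * lu x) \<mu> \<nu>
      = ((\<integral>x. F x \<partial>\<mu>) - (\<integral>x. hu x \<partial>\<mu>) + \<sigma> * (\<integral>x. lu x \<partial>\<mu>))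
      - ((\<integral>x. F x \<partial>\<nu>) - (\<integral>x. hu x \<partial>\<nu>) + \<sigma> * (\<integral>x. lu x \<partial>\<nu>))"
    "pair_diff (\<lambda>x. G x - hv x + \<sigma> * lv x) \<nu> \<mu>
      = ((\<integral>x. G x \<partial>\<nu>) - (\<integral>x. hv x \<partial>\<nu>) + \<sigma> * (\<integral>x. lv x \<partial>\<nu>))
      - ((\<integral>x. G x \<partial>\<mu>) - (\<integral>x. hv x \<partial>\<mu>) + \<sigma> * (\<integral>x. lv x \<partial>\<mu>))"
    using int[OF M1(1)] int[OF M1(2)] by (simp_all add: pair_diff_def)
  have "- 2 * k \<le> pair_diff (\<lambda>x. F x - hu x + \<sigma> * lu x) \<mu> \<nu> + pair_FP \<sigma> (\<lambda>x. u x - (v x - \<Phi> x)) bu \<mu>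
      + (pair_diff (\<lambda>x. G x - hv x + \<sigma> * lv x) \<nu> \<mu> + pair_FP \<sigma> (\<lambda>x. v x - (u x - \<Psi> x)) bv \<nu>)"
    using A' C' FG unfolding FP PD by (simp add: algebra_simps)
  then show ?thesis
    unfolding hu_def[abs_def] hv_def[abs_def] bu_def[abs_def] bv_def[abs_def] lu_def lv_def k_def .
qed

section \<open>Continuity properties of M-solutions\<close>

context
  fixes \<sigma> :: real and H :: "'n::finite torus \<Rightarrow> real^'n \<Rightarrow> real" and f U
  assumes sol: "M_solution \<sigma> H f U"
begin

lemma M_solution_C2: "t > 0 \<Longrightarrow> \<mu> \<in> M1 \<Longrightarrow> torus_C2 (U t \<mu>)"
  using sol by (auto simp: M_solution_def)

lemma M_solution_grad_bounded:
  assumes "T > 0"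
  obtains C where "\<And>t \<mu> x. t \<in> {0..T} \<Longrightarrow> \<mu> \<in> M1 \<Longrightarrow> norm (torus_grad (U t \<mu>) x) \<le> C"
  using sol assms unfolding M_solution_def by metis

lemma M_solution_continuous:
  assumes "t \<ge> 0" "\<mu> \<in> M1"
  shows "continuous_on UNIV (U t \<mu>)"
proof -
  have "\<exists>C. \<forall>t\<in>{0..t + 1}. \<forall>\<mu>\<in>M1. torus_differentiable (U t \<mu>) \<and> (\<forall>x. norm (torus_grad (U t \<mu>) x) \<le> C)"
    using sol assms(1) unfolding M_solution_def by (metis add_nonneg_pos zero_less_one)
  then have "torus_differentiable (U t \<mu>)"
    using assms by auto
  then have "isCont (\<lambda>y. U t \<mu> (to_torus y)) y" for y
    by (auto simp: torus_differentiable_def intro: differentiable_imp_continuous_within)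
  then show ?thesis
    by (simp add: continuous_on_torus_iff continuous_on_eq_continuous_at)
qed

lemma M_solution_tendsto:
  assumes t: "t \<longlonglongrightarrow> t'" "\<And>n. t n \<ge> 0"
    and m: "weak_tendsto m \<mu>" "\<And>n. m n \<in> M1" "\<mu> \<in> M1"
    and x: "x \<longlonglongrightarrow> x'"
  shows "(\<lambda>n. U (t n) (m n) (x n)) \<longlonglongrightarrow> U t' \<mu> x'"
proof -
  have "t' \<ge> 0" using t by (intro LIMSEQ_le_const) auto
  then have "limitin (top_of_set {0..}) t t' sequentially"
    using t by (simp add: limitin_subtopology)
  then have "limitin (prod_topology (top_of_set {0..}) (prod_topology M1_topology euclidean))
      (\<lambda>n. (t n, m n, x n)) (t', \<mu>, x') sequentially"
    using limitin_M1_topology[OF m] x by (simp add: limitin_pairwise o_def)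
  then have "limitin euclidean ((\<lambda>(t, \<mu>, x). U t \<mu> x) \<circ> (\<lambda>n. (t n, m n, x n))) ((\<lambda>(t, \<mu>, x). U t \<mu> x) (t', \<mu>, x')) sequentially"
    using sol unfolding M_solution_def by (intro continuous_map_limit) auto
  then show ?thesis by (simp add: o_def)
qed

text \<open>Joint continuity on the compact torus upgrades pointwise to uniform convergence, which is needed
below because the measure of integration varies along the sequence too.\<close>

lemma M_solution_uniformly_tendsto:
  assumes t: "t \<longlonglongrightarrow> t'" "\<And>n. t n \<ge> 0"
    and m: "weak_tendsto m \<mu>" "\<And>n. m n \<in> M1" "\<mu> \<in> M1"
    and "\<epsilon> > 0"
  shows "\<forall>\<^sub>F n in sequentially. \<forall>x. \<bar>U (t n) (m n) x - U t' \<mu> x\<bar> \<le> \<epsilon>"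
proof (rule ccontr)
  assume "\<not> ?thesis"
  then have "\<forall>N. \<exists>n\<ge>N. \<exists>x. \<bar>U (t n) (m n) x - U t' \<mu> x\<bar> > \<epsilon>"
    unfolding eventually_sequentially by (meson not_le)
  then have "infinite {n. \<exists>x. \<bar>U (t n) (m n) x - U t' \<mu> x\<bar> > \<epsilon>}"
    by (simp add: infinite_nat_iff_unbounded_le)
  from infinite_enumerate[OF this]
  obtain r :: "nat \<Rightarrow> nat" where r: "strict_mono r" "\<forall>n. \<exists>x. \<bar>U (t (r n)) (m (r n)) x - U t' \<mu> x\<bar> > \<epsilon>"
    by auto
  from r(2) obtain x where x: "\<And>n. \<bar>U (t (r n)) (m (r n)) (x n) - U t' \<mu> (x n)\<bar> > \<epsilon>"
    by metis
  obtain x' q where q: "strict_mono q" "(\<lambda>n. x (q n)) \<longlonglongrightarrow> x'"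
    using torus_seq_compact by blast
  have rq: "strict_mono (r \<circ> q)" using r(1) q(1) by (rule strict_mono_o)
  have "t' \<ge> 0" using t by (intro LIMSEQ_le_const) auto
  have t': "(\<lambda>n. t (r (q n))) \<longlonglongrightarrow> t'"
    using LIMSEQ_subseq_LIMSEQ[OF t(1) rq] by (simp add: o_def)
  have m': "weak_tendsto (\<lambda>n. m (r (q n))) \<mu>"
    using m(1) LIMSEQ_subseq_LIMSEQ[OF _ rq] unfolding weak_tendsto_def by (fastforce simp: o_def)
  have "(\<lambda>n. U (t (r (q n))) (m (r (q n))) (x (q n))) \<longlonglongrightarrow> U t' \<mu> x'"
    by (rule M_solution_tendsto[OF t' t(2) m' m(2,3) q(2)])
  moreover have "(\<lambda>n. U t' \<mu> (x (q n))) \<longlonglongrightarrow> U t' \<mu> x'"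
    by (rule continuous_on_tendsto_compose[OF M_solution_continuous[OF \<open>t' \<ge> 0\<close> m(3)] q(2)]) auto
  ultimately have "(\<lambda>n. \<bar>U (t (r (q n))) (m (r (q n))) (x (q n)) - U t' \<mu> (x (q n))\<bar>) \<longlonglongrightarrow> \<bar>U t' \<mu> x' - U t' \<mu> x'\<bar>"
    by (intro tendsto_rabs tendsto_diff)
  then have "\<epsilon> \<le> \<bar>U t' \<mu> x' - U t' \<mu> x'\<bar>"
    using x by (intro LIMSEQ_le_const) (auto intro: less_imp_le)
  then show False using \<open>\<epsilon> > 0\<close> by simp
qed

lemma M_solution_integral_tendsto:
  assumes t: "t \<longlonglongrightarrow> t'" "\<And>n. t n \<ge> 0"
    and m: "weak_tendsto m \<mu>" "\<And>n. m n \<in> M1" "\<mu> \<in> M1"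
    and k: "weak_tendsto k \<nu>" "\<And>n. k n \<in> M1"
  shows "(\<lambda>n. \<integral>x. U (t n) (m n) x \<partial>k n) \<longlonglongrightarrow> (\<integral>x. U t' \<mu> x \<partial>\<nu>)"
proof -
  have "t' \<ge> 0" using t by (intro LIMSEQ_le_const) auto
  note c = M_solution_continuous[OF this m(3)]
  have "(\<lambda>n. (\<integral>x. U (t n) (m n) x \<partial>k n) - (\<integral>x. U t' \<mu> x \<partial>k n)) \<longlonglongrightarrow> 0"
  proof (rule LIMSEQ_I)
    fix \<epsilon> :: real assume "\<epsilon> > 0"
    then have "\<forall>\<^sub>F n in sequentially. \<forall>x. \<bar>U (t n) (m n) x - U t' \<mu> x\<bar> \<le> \<epsilon> / 2"
      by (intro M_solution_uniformly_tendsto[OF t m]) simp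
    then have "\<forall>\<^sub>F n in sequentially. norm ((\<integral>x. U (t n) (m n) x \<partial>k n) - (\<integral>x. U t' \<mu> x \<partial>k n) - 0) < \<epsilon>"
    proof eventually_elim
      case (elim n)
      note cn = M_solution_continuous[OF t(2) m(2), of n n]
      have "\<bar>\<integral>x. U (t n) (m n) x - U t' \<mu> x \<partial>k n\<bar> \<le> \<epsilon> / 2"
        using elim by (intro M1_integral_bound[OF k(2)] continuous_on_diff cn c) auto
      then show ?case
        using \<open>\<epsilon> > 0\<close> Bochner_Integration.integral_diff[OF M1_integrable[OF k(2)[of n] cn] M1_integrable[OF k(2)[of n] c]]
        by simp
    qed
    then show "\<exists>N. \<forall>n\<ge>N. norm ((\<integral>x. U (t n) (m n) x \<partial>k n) - (\<integral>x. U t' \<mu> x \<partial>k n) - 0) < \<epsilon>"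
      by (simp add: eventually_sequentially)
  qed
  moreover have "(\<lambda>n. \<integral>x. U t' \<mu> x \<partial>k n) \<longlonglongrightarrow> (\<integral>x. U t' \<mu> x \<partial>\<nu>)"
    using k(1) c by (simp add: weak_tendsto_def)
  ultimately show ?thesis
    using tendsto_add by fastforce
qed

lemma M_solution_at_strict_min:
  assumes "T > 0" "torus_C2 \<phi>" "\<nu> \<in> M1" "\<theta> C1_differentiable_on UNIV" "t \<in> {0<..T}" "\<mu> \<in> M1"
    and "strict_min_on ({0..T} \<times> M1) (\<lambda>(s, m). pair_diff (\<lambda>x. U s m x - \<phi> x) m \<nu> - \<theta> s) (t, \<mu>)"
  shows "deriv \<theta> t \<ge>
          pair_diff (\<lambda>x. f \<mu> x - H x (torus_grad (U t \<mu>) x) + \<sigma> * torus_lap (U t \<mu>) x) \<mu> \<nu> +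
          pair_FP \<sigma> (\<lambda>x. U t \<mu> x - \<phi> x) (\<lambda>x. DpH H x (torus_grad (U t \<mu>) x)) \<mu>"
  using sol assms unfolding M_solution_def by blast

end

section \<open>Comparison of two M-solutions\<close>

lemma quadratic_penalty_C1:
  fixes s k g :: real
  shows "(\<lambda>t. - ((t - s)\<^sup>2 * k + g * t)) C1_differentiable_on UNIV"
    and "deriv (\<lambda>t. - ((t - s)\<^sup>2 * k + g * t)) t = - (2 * k * (t - s) + g)"
proof -
  have D: "((\<lambda>t. - ((t - s)\<^sup>2 * k + g * t)) has_real_derivative - (2 * k * (t - s) + g)) (at t)" for t
    by (auto intro!: derivative_eq_intros simp: algebra_simps)
  then show "deriv (\<lambda>t. - ((t - s)\<^sup>2 * k + g * t)) t = - (2 * k * (t - s) + g)"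
    by (rule DERIV_imp_deriv)
  show "(\<lambda>t. - ((t - s)\<^sup>2 * k + g * t)) C1_differentiable_on UNIV"
    unfolding C1_differentiable_on_def
    using D by (intro exI[of _ "\<lambda>t. - (2 * k * (t - s) + g)"])
      (auto simp: has_real_derivative_iff_has_vector_derivative intro!: continuous_intros)
qed

text \<open>The linear functionals of the point \<open>(t, s, \<mu>, \<nu>)\<close> to which the variational principle is applied.
Each is the sum of a functional of \<open>(t, \<mu>)\<close> and one of \<open>(s, \<nu>)\<close>, so that freezing one pair leaves a
test function of the kind that the definition of an M-solution allows.\<close>

definition perturbation ::
  "real \<times> real \<times> 'n::finite torus measure \<times> 'n torus measure \<Rightarrow>
    ((real \<Rightarrow>\<^sub>C real) \<times> (real \<Rightarrow>\<^sub>C real)) \<times> (real \<times> real) \<Rightarrow> real" where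
  "perturbation = (\<lambda>(t, s, \<mu>, \<nu>) ((c, d), (a, b)).
     (\<integral>x. wave_series c x \<partial>\<mu>) + (\<integral>x. wave_series d x \<partial>\<nu>) + a * t + b * s)"

lemma linear_perturbation:
  assumes "\<mu> \<in> M1" "\<nu> \<in> M1"
  shows "linear (perturbation (t, s, \<mu>, \<nu>))"
proof (rule linearI)
  have add: "wave_series (c + d) = (\<lambda>x :: 'a torus. wave_series c x + wave_series d x)"
    and scale: "wave_series (r *\<^sub>R c) = (\<lambda>x :: 'a torus. r * wave_series c x)" for c d r
    by (auto simp: wave_series_lincomb)
  have int: "integrable m (wave_series c)" if "m \<in> M1" for m :: "'a torus measure" and c
    using that by (intro M1_integrable torus_C2_continuous(1) wave_series_C2(1))
  fix y z :: "((real \<Rightarrow>\<^sub>C real) \<times> (real \<Rightarrow>\<^sub>C real)) \<times> (real \<times> real)" and r :: real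
  obtain c d a b where y: "y = ((c, d), (a, b))" by (metis surj_pair)
  obtain c' d' a' b' where z: "z = ((c', d'), (a', b'))" by (metis surj_pair)
  show "perturbation (t, s, \<mu>, \<nu>) (y + z) = perturbation (t, s, \<mu>, \<nu>) y + perturbation (t, s, \<mu>, \<nu>) z"
    by (simp add: y z perturbation_def add int assms algebra_simps)
  show "perturbation (t, s, \<mu>, \<nu>) (r *\<^sub>R y) = r *\<^sub>R perturbation (t, s, \<mu>, \<nu>) y"
    by (simp add: y perturbation_def scale int assms algebra_simps)
qed

lemma norm_nested_pair_le:
  fixes y :: "('a::real_normed_vector \<times> 'b::real_normed_vector) \<times> ('c::real_normed_vector \<times> 'd::real_normed_vector)"
  assumes "y = ((c, d), (a, b))"
  shows "norm c \<le> norm y" "norm d \<le> norm y" "norm a \<le> norm y" "norm b \<le> norm y"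
  unfolding assms
  by (meson norm_fst_le norm_snd_le order_trans fst_conv snd_conv)+

lemma perturbation_bound:
  assumes "\<mu> \<in> M1" "\<nu> \<in> M1" "t \<in> {0..T}" "s \<in> {0..T}"
  shows "\<bar>perturbation (t, s, \<mu>, \<nu>) y\<bar> \<le> (4 + 2 * T) * norm y"
proof -
  obtain c d a b where y: "y = ((c, d), (a, b))" by (metis surj_pair)
  note n = norm_nested_pair_le[OF y]
  have w: "\<bar>\<integral>x. wave_series e x \<partial>m\<bar> \<le> 2 * norm y" if "m \<in> M1" "norm e \<le> norm y" for m :: "'a torus measure" and e
    using M1_integral_bound[OF that(1) torus_C2_continuous(1)[OF wave_series_C2(1)] wave_series_C2(2), of e] that(2)
    by linarith
  have l: "\<bar>e * r\<bar> \<le> T * norm y" if "norm e \<le> norm y" "r \<in> {0..T}" for e r :: real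
    using mult_mono[of "\<bar>r\<bar>" T "\<bar>e\<bar>" "norm y"] that by (simp add: abs_mult mult.commute)
  have "\<bar>perturbation (t, s, \<mu>, \<nu>) y\<bar> \<le>
      \<bar>\<integral>x. wave_series c x \<partial>\<mu>\<bar> + \<bar>\<integral>x. wave_series d x \<partial>\<nu>\<bar> + \<bar>a * t\<bar> + \<bar>b * s\<bar>"
    by (simp add: y perturbation_def)
  also have "\<dots> \<le> 2 * norm y + 2 * norm y + T * norm y + T * norm y"
    using n assms by (intro add_mono w l) auto
  finally show ?thesis by (simp add: algebra_simps)
qed

definition perturbation_directions :: "(((real \<Rightarrow>\<^sub>C real) \<times> (real \<Rightarrow>\<^sub>C real)) \<times> (real \<times> real)) set" where
  "perturbation_directions =
     range (\<lambda>m. ((unit_coeff m, 0), (0, 0))) \<union> range (\<lambda>m. ((0, unit_coeff m), (0, 0))) \<union>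
     {((0, 0), (1, 0)), ((0, 0), (0, 1))}"

lemma countable_perturbation_directions: "countable perturbation_directions"
  by (simp add: perturbation_directions_def)

lemma M1_eq_if_unit_series_eq:
  fixes \<mu> \<nu> :: "'n::finite torus measure"
  assumes "\<mu> \<in> M1" "\<nu> \<in> M1"
    and eq: "\<And>m. (\<integral>x. wave_series (unit_coeff m) x \<partial>\<mu>) = (\<integral>x. wave_series (unit_coeff m) x \<partial>\<nu>)"
  shows "\<mu> = \<nu>"
proof (rule M1_eq_if_wave_integrals_eq[OF assms(1,2)])
  fix \<iota> :: "(int^'n) \<times> int"
  have "wave_index (to_nat \<iota>) = \<iota>" by (simp add: wave_index_def)
  moreover have "wave_weight TYPE('n) (to_nat \<iota>) \<noteq> 0"
    using wave_weight_pos[where 'n = 'n, of "to_nat \<iota>"] by simp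
  ultimately show "(\<integral>x. wave \<iota> x \<partial>\<mu>) = (\<integral>x. wave \<iota> x \<partial>\<nu>)"
    using eq[of "to_nat \<iota>"] by (simp add: wave_series_unit_coeff)
qed

lemma perturbation_separates:
  fixes \<mu> \<nu> \<mu>' \<nu>' :: "'n::finite torus measure"
  assumes M1: "\<mu> \<in> M1" "\<nu> \<in> M1" "\<mu>' \<in> M1" "\<nu>' \<in> M1"
    and eq: "\<And>y. y \<in> perturbation_directions \<Longrightarrow> perturbation (t, s, \<mu>, \<nu>) y = perturbation (t', s', \<mu>', \<nu>') y"
  shows "(t, s, \<mu>, \<nu>) = (t', s', \<mu>', \<nu>')"
proof -
  have zero: "wave_series 0 = (\<lambda>x :: 'n torus. 0)"
    using wave_series_lincomb(2)[of 0 0] by auto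
  have "(\<integral>x. wave_series (unit_coeff m) x \<partial>\<mu>) = (\<integral>x. wave_series (unit_coeff m) x \<partial>\<mu>')"
    "(\<integral>x. wave_series (unit_coeff m) x \<partial>\<nu>) = (\<integral>x. wave_series (unit_coeff m) x \<partial>\<nu>')" for m
    using eq[of "((unit_coeff m, 0), (0, 0))"] eq[of "((0, unit_coeff m), (0, 0))"]
    by (simp_all add: perturbation_directions_def perturbation_def zero)
  then have "\<mu> = \<mu>'" "\<nu> = \<nu>'"
    using M1 M1_eq_if_unit_series_eq by blast+
  moreover have "t = t'" "s = s'"
    using eq[of "((0, 0), (1, 0))"] eq[of "((0, 0), (0, 1))"]
    by (simp_all add: perturbation_directions_def perturbation_def zero)
  ultimately show ?thesis by simp
qed

text \<open>Doubling of variables.  The perturbed minimum at \<open>(t, s, \<mu>, \<nu>)\<close> is a strict minimum in \<open>(t, \<mu>)\<close> alone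
and in \<open>(s, \<nu>)\<close> alone, so it may be used in the definition of both solutions.\<close>

theorem M_solutions_cross_monotone:
  fixes H :: "'n::finite torus \<Rightarrow> real^'n \<Rightarrow> real"
    and f :: "'n torus measure \<Rightarrow> 'n torus \<Rightarrow> real"
  assumes \<sigma>: "\<sigma> > 0" and H: "C1_hamiltonian H" "\<And>x. convex_on UNIV (H x)"
    and f: "\<And>\<mu>. \<mu> \<in> M1 \<Longrightarrow> continuous_on UNIV (f \<mu>)" "monotone_M1 f"
    and U: "M_solution \<sigma> H f U" and V: "M_solution \<sigma> H f V"
    and init: "\<And>\<mu> \<nu>. \<mu> \<in> M1 \<Longrightarrow> \<nu> \<in> M1 \<Longrightarrow> pair_diff (\<lambda>x. U 0 \<mu> x - V 0 \<nu> x) \<mu> \<nu> \<ge> 0"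
    and T: "T > 0" and M1: "\<mu>0 \<in> M1" "\<nu>0 \<in> M1"
  shows "pair_diff (\<lambda>x. U T \<mu>0 x - V T \<nu>0 x) \<mu>0 \<nu>0 \<ge> 0"
proof (rule ccontr)
  define W where "W = (\<lambda>(t, s, \<mu>, \<nu>). pair_diff (\<lambda>x. U t \<mu> x - V s \<nu> x) \<mu> \<nu>)"
  define X :: "(real \<times> real \<times> 'n torus measure \<times> 'n torus measure) set"
    where "X = {0..T} \<times> {0..T} \<times> M1 \<times> M1"
  assume "\<not> pair_diff (\<lambda>x. U T \<mu>0 x - V T \<nu>0 x) \<mu>0 \<nu>0 \<ge> 0"
  then have neg: "W (T, T, \<mu>0, \<nu>0) < 0" by (simp add: W_def)
  define \<kappa> where "\<kappa> = - W (T, T, \<mu>0, \<nu>0) / 4"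
  have \<kappa>: "\<kappa> > 0" "W (T, T, \<mu>0, \<nu>0) = - 4 * \<kappa>" using neg by (simp_all add: \<kappa>_def)

  note cU = M_solution_continuous[OF U] and cV = M_solution_continuous[OF V]
  have intU: "integrable m (U t \<mu>)" if "t \<ge> 0" "\<mu> \<in> M1" "m \<in> M1" for t \<mu> m
    using that by (intro M1_integrable cU)
  have intV: "integrable m (V t \<mu>)" if "t \<ge> 0" "\<mu> \<in> M1" "m \<in> M1" for t \<mu> m
    using that by (intro M1_integrable cV)
  have W_eq: "W (t, s, \<mu>, \<nu>) = ((\<integral>x. U t \<mu> x \<partial>\<mu>) - (\<integral>x. V s \<nu> x \<partial>\<mu>)) - ((\<integral>x. U t \<mu> x \<partial>\<nu>) - (\<integral>x. V s \<nu> x \<partial>\<nu>))"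
    if "t \<ge> 0" "s \<ge> 0" "\<mu> \<in> M1" "\<nu> \<in> M1" for t s \<mu> \<nu>
    using intU intV that by (simp add: W_def pair_diff_def)

  have seq: "\<exists>x\<in>X. \<exists>r. strict_mono r \<and> (\<lambda>n. W (u (r n))) \<longlonglongrightarrow> W x \<and>
      (\<lambda>n. fst (u (r n))) \<longlonglongrightarrow> fst x \<and> (\<lambda>n. fst (snd (u (r n)))) \<longlonglongrightarrow> fst (snd x) \<and>
      (\<forall>y. (\<lambda>n. perturbation (u (r n)) y) \<longlonglongrightarrow> perturbation x y)"
    if uX: "\<And>n. u n \<in> X" for u :: "nat \<Rightarrow> _"
  proof -
    define t where "t n = fst (u n)" for n
    define s where "s n = fst (snd (u n))" for n
    define m where "m n = fst (snd (snd (u n)))" for n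
    define k where "k n = snd (snd (snd (u n)))" for n
    have u: "u n = (t n, s n, m n, k n)" for n by (simp add: t_def s_def m_def k_def)
    have mem: "t n \<in> {0..T}" "s n \<in> {0..T}" "m n \<in> M1" "k n \<in> M1" for n
      using uX[of n] unfolding u X_def by auto
    obtain t' r1 where t': "t' \<in> {0..T}" and r1: "strict_mono r1" and l1: "(t \<circ> r1) \<longlonglongrightarrow> t'"
      using compact_imp_seq_compact[OF compact_Icc] mem(1) unfolding seq_compact_def by metis
    have "\<forall>n. (s \<circ> r1) n \<in> {0..T}" using mem by simp
    then obtain s' r2 where s': "s' \<in> {0..T}" and r2: "strict_mono r2" and l2: "((s \<circ> r1) \<circ> r2) \<longlonglongrightarrow> s'"
      using compact_imp_seq_compact[OF compact_Icc] unfolding seq_compact_def by metis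
    obtain \<mu> r3 where \<mu>: "\<mu> \<in> M1" and r3: "strict_mono r3" and l3: "weak_tendsto (\<lambda>n. m (r1 (r2 (r3 n)))) \<mu>"
      using M1_seq_compact[of "\<lambda>n. m (r1 (r2 n))"] mem by blast
    obtain \<nu> r4 where \<nu>: "\<nu> \<in> M1" and r4: "strict_mono r4" and l4: "weak_tendsto (\<lambda>n. k (r1 (r2 (r3 (r4 n))))) \<nu>"
      using M1_seq_compact[of "\<lambda>n. k (r1 (r2 (r3 n)))"] mem by blast
    define r where "r n = r1 (r2 (r3 (r4 n)))" for n
    have r: "strict_mono r"
      using r1 r2 r3 r4 by (auto simp: r_def strict_mono_def)
    have lt: "(\<lambda>n. t (r n)) \<longlonglongrightarrow> t'"
      using LIMSEQ_subseq_LIMSEQ[OF l1 strict_mono_o[OF r2 strict_mono_o[OF r3 r4]]] by (simp add: o_def r_def)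
    have ls: "(\<lambda>n. s (r n)) \<longlonglongrightarrow> s'"
      using LIMSEQ_subseq_LIMSEQ[OF l2 strict_mono_o[OF r3 r4]] by (simp add: o_def r_def)
    have lm: "weak_tendsto (\<lambda>n. m (r n)) \<mu>"
      using l3 LIMSEQ_subseq_LIMSEQ[OF _ r4] unfolding weak_tendsto_def by (fastforce simp: o_def r_def)
    have lk: "weak_tendsto (\<lambda>n. k (r n)) \<nu>"
      using l4 by (simp add: r_def)
    have pos: "t (r n) \<ge> 0" "s (r n) \<ge> 0" for n using mem by auto
    have pos': "t' \<ge> 0" "s' \<ge> 0" using t' s' by auto
    note limU = M_solution_integral_tendsto[OF U lt pos(1) lm mem(3) \<mu>]
    note limV = M_solution_integral_tendsto[OF V ls pos(2) lk mem(4) \<nu>]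
    have "(\<lambda>n. W (u (r n))) \<longlonglongrightarrow> W (t', s', \<mu>, \<nu>)"
      unfolding u W_eq[OF pos mem(3,4)] W_eq[OF pos' \<mu> \<nu>]
      by (intro tendsto_diff limU[OF lm mem(3)] limU[OF lk mem(4)] limV[OF lm mem(3)] limV[OF lk mem(4)])
    moreover have "(\<lambda>n. perturbation (u (r n)) y) \<longlonglongrightarrow> perturbation (t', s', \<mu>, \<nu>) y" for y
    proof -
      obtain c d a b where y: "y = ((c, d), (a, b))" by (metis surj_pair)
      have "continuous_on UNIV (wave_series e :: 'n torus \<Rightarrow> real)" for e
        by (rule torus_C2_continuous(1)[OF wave_series_C2(1)])
      then have "(\<lambda>n. \<integral>x. wave_series c x \<partial>m (r n)) \<longlonglongrightarrow> (\<integral>x. wave_series c x \<partial>\<mu>)"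
        "(\<lambda>n. \<integral>x. wave_series d x \<partial>k (r n)) \<longlonglongrightarrow> (\<integral>x. wave_series d x \<partial>\<nu>)"
        using lm lk by (simp_all add: weak_tendsto_def)
      then show ?thesis
        unfolding u y perturbation_def prod.case
        by (intro tendsto_add tendsto_mult tendsto_const lt ls)
    qed
    moreover have "(t', s', \<mu>, \<nu>) \<in> X"
      using t' s' \<mu> \<nu> by (simp add: X_def)
    ultimately show ?thesis
      using r lt ls by (intro bexI[of _ "(t', s', \<mu>, \<nu>)"] exI[of _ r]) (auto simp: u)
  qed
  have x0: "(T, T, \<mu>0, \<nu>0) \<in> X"
    using T M1 by (simp add: X_def)

  \<comment> \<open>If one time is 0 and the other small, the pairing is close to a value at the initial time,
      which is nonnegative; compactness makes this uniform in the measures.\<close>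
  have "\<exists>\<delta>>0. \<forall>(t, s, \<mu>, \<nu>)\<in>X. \<bar>t - s\<bar> \<le> \<delta> \<longrightarrow> t = 0 \<or> s = 0 \<longrightarrow> W (t, s, \<mu>, \<nu>) > - \<kappa>"
  proof (rule ccontr)
    assume "\<not> ?thesis"
    then have "\<forall>\<delta>>0. \<exists>x\<in>X. \<bar>fst x - fst (snd x)\<bar> \<le> \<delta> \<and> (fst x = 0 \<or> fst (snd x) = 0) \<and> W x \<le> - \<kappa>"
      by (fastforce simp: not_less)
    then have "\<forall>n. \<exists>x\<in>X. \<bar>fst x - fst (snd x)\<bar> \<le> 1 / Suc n \<and> (fst x = 0 \<or> fst (snd x) = 0) \<and> W x \<le> - \<kappa>"
      by auto
    then obtain u where u: "\<And>n. u n \<in> X" "\<And>n. \<bar>fst (u n) - fst (snd (u n))\<bar> \<le> 1 / Suc n"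
      "\<And>n. fst (u n) = 0 \<or> fst (snd (u n)) = 0" "\<And>n. W (u n) \<le> - \<kappa>"
      by metis
    obtain x r where x: "x \<in> X" and r: "strict_mono r" and lW: "(\<lambda>n. W (u (r n))) \<longlonglongrightarrow> W x"
      and lt: "(\<lambda>n. fst (u (r n))) \<longlonglongrightarrow> fst x" and ls: "(\<lambda>n. fst (snd (u (r n)))) \<longlonglongrightarrow> fst (snd x)"
      using seq[of u, OF u(1)] by blast
    have inv: "(\<lambda>n. 1 / real (Suc (r n))) \<longlonglongrightarrow> 0"
      using LIMSEQ_subseq_LIMSEQ[OF LIMSEQ_Suc[OF lim_1_over_n] r] by (simp add: o_def)
    have small: "\<bar>fst (u n)\<bar> \<le> 1 / Suc n" "\<bar>fst (snd (u n))\<bar> \<le> 1 / Suc n" for n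
      using u(2,3)[of n] by auto
    have "(\<lambda>n. fst (u (r n))) \<longlonglongrightarrow> 0" "(\<lambda>n. fst (snd (u (r n)))) \<longlonglongrightarrow> 0"
      using small by (intro Lim_null_comparison[OF _ inv] always_eventually; simp)+
    then have zero: "fst x = 0" "fst (snd x) = 0"
      using LIMSEQ_unique lt ls by blast+
    obtain \<mu> \<nu> where x_eq: "x = (0, 0, \<mu>, \<nu>)" and "\<mu> \<in> M1" "\<nu> \<in> M1"
      using x zero by (cases x) (auto simp: X_def)
    then have "W x \<ge> 0" using init by (simp add: W_def)
    moreover have "W x \<le> - \<kappa>"
      using lW u(4) by (intro LIMSEQ_le_const2) auto
    ultimately show False using \<kappa> by simp
  qed
  then obtain \<delta> where \<delta>: "\<delta> > 0"
    and near_initial: "\<And>t s \<mu> \<nu>. (t, s, \<mu>, \<nu>) \<in> X \<Longrightarrow> \<bar>t - s\<bar> \<le> \<delta> \<Longrightarrow> t = 0 \<or> s = 0 \<Longrightarrow> W (t, s, \<mu>, \<nu>) > - \<kappa>"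
    by fast

  have "\<exists>x\<in>X. \<forall>z\<in>X. W x \<le> W z"
  proof (rule attains_min_if_seq_compact)
    show "X \<noteq> {}" using x0 by blast
  qed (use seq in blast)
  then obtain w where w: "\<And>z. z \<in> X \<Longrightarrow> w \<le> W z"
    by blast
  define B where "B = \<bar>w\<bar>"
  \<comment> \<open>With this weight, \<open>(t - s)\<^sup>2 k \<le> B\<close> forces \<open>\<bar>t - s\<bar> \<le> \<delta>\<close>.\<close>
  define k where "k = (B + 1) / \<delta>\<^sup>2"
  have k: "k > 0" using \<delta> by (simp add: k_def B_def add_nonneg_pos)
  \<comment> \<open>At \<open>(T, T, \<mu>0, \<nu>0)\<close> the linear penalty equals \<open>\<kappa>\<close>, a quarter of the negative value of \<open>W\<close> there.\<close>
  define \<gamma> where "\<gamma> = \<kappa> / (2 * T)"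
  have \<gamma>: "\<gamma> > 0" using \<kappa> T by (simp add: \<gamma>_def)

  obtain CU where CU: "\<And>t \<mu> x. t \<in> {0..T} \<Longrightarrow> \<mu> \<in> M1 \<Longrightarrow> norm (torus_grad (U t \<mu>) x) \<le> CU"
    using M_solution_grad_bounded[OF U T] by blast
  obtain CV where CV: "\<And>t \<mu> x. t \<in> {0..T} \<Longrightarrow> \<mu> \<in> M1 \<Longrightarrow> norm (torus_grad (V t \<mu>) x) \<le> CV"
    using M_solution_grad_bounded[OF V T] by blast
  obtain b where b: "b > 0" "\<And>x p. norm p \<le> max CU CV \<Longrightarrow> norm (DpH H x p) \<le> b"
    using DpH_bounded[OF H(1)] by blast
  define K where "K = 2 * (b * 2 + \<sigma> * (2 * CARD('n)))"
  have K: "K \<ge> 0" using b \<sigma> by (simp add: K_def)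
  \<comment> \<open>The first bound keeps the perturbation below \<open>\<kappa> / 2\<close> on \<open>X\<close>; the second one
      keeps its effect on the sum of the two viscosity inequalities below \<open>2 \<gamma>\<close>.\<close>
  define \<eta> where "\<eta> = min (\<kappa> / (2 * (4 + 2 * T))) (\<gamma> / (2 + K))"
  have \<eta>: "\<eta> > 0" using \<kappa> T \<gamma> K by (simp add: \<eta>_def)

  define F where "F = (\<lambda>x. W x + (fst x - fst (snd x))\<^sup>2 * k + \<gamma> * (fst x + fst (snd x)))"
  have "\<exists>y x. norm y < \<eta> \<and> strict_min_on X (\<lambda>x. F x + perturbation x y) x"
  proof (rule linear_perturbation_strict_min[where C = "4 + 2 * T" and D = perturbation_directions])
    show "X \<noteq> {}" using x0 by blast
    show "linear (perturbation x)" if "x \<in> X" for x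
      using that by (cases x) (auto simp: X_def intro: linear_perturbation)
    show "\<bar>perturbation x y\<bar> \<le> (4 + 2 * T) * norm y" if "x \<in> X" for x y
      using that by (cases x) (auto simp: X_def intro: perturbation_bound)
    show "\<exists>x\<in>X. \<exists>r. strict_mono r \<and> (\<lambda>n. F (u (r n))) \<longlonglongrightarrow> F x \<and>
        (\<forall>y. (\<lambda>n. perturbation (u (r n)) y) \<longlonglongrightarrow> perturbation x y)" if uX: "\<And>n. u n \<in> X" for u :: "nat \<Rightarrow> _"
    proof -
      obtain x r where x: "x \<in> X" and r: "strict_mono r" and lW: "(\<lambda>n. W (u (r n))) \<longlonglongrightarrow> W x"
        and lt: "(\<lambda>n. fst (u (r n))) \<longlonglongrightarrow> fst x" and ls: "(\<lambda>n. fst (snd (u (r n)))) \<longlonglongrightarrow> fst (snd x)"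
        and lp: "\<forall>y. (\<lambda>n. perturbation (u (r n)) y) \<longlonglongrightarrow> perturbation x y"
        using seq[of u, OF uX] by blast
      have "(\<lambda>n. F (u (r n))) \<longlonglongrightarrow> F x"
        unfolding F_def by (intro tendsto_intros lW lt ls)
      then show ?thesis using x r lp by blast
    qed
    show "x = x'" if "x \<in> X" "x' \<in> X"
      "\<And>d. d \<in> perturbation_directions \<Longrightarrow> perturbation x d = perturbation x' d" for x x'
    proof -
      obtain t s \<mu> \<nu> t' s' \<mu>' \<nu>' where eq: "x = (t, s, \<mu>, \<nu>)" "x' = (t', s', \<mu>', \<nu>')"
        by (metis surj_pair)
      show ?thesis
        unfolding eq using that by (intro perturbation_separates) (auto simp: eq X_def)
    qed
  qed (use countable_perturbation_directions \<eta> in auto)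
  then obtain y x where y: "norm y < \<eta>" and min: "strict_min_on X (\<lambda>x. F x + perturbation x y) x"
    by blast
  obtain t s \<mu> \<nu> where x_eq: "x = (t, s, \<mu>, \<nu>)" by (metis surj_pair)
  obtain c d a a' where y_eq: "y = ((c, d), (a, a'))" by (metis surj_pair)
  note ny = norm_nested_pair_le[OF y_eq]
  have xX: "x \<in> X" and less: "\<And>z. z \<in> X \<Longrightarrow> z \<noteq> x \<Longrightarrow> F x + perturbation x y < F z + perturbation z y"
    using min by (auto simp: strict_min_on_def)
  have ts: "t \<in> {0..T}" "s \<in> {0..T}" and M1x: "\<mu> \<in> M1" "\<nu> \<in> M1"
    using xX by (auto simp: X_def x_eq)

  \<comment> \<open>Penalty and perturbation are too small to hide the negative value of \<open>W\<close>: at the minimum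
      \<open>W \<le> - \<kappa>\<close> and \<open>\<bar>t - s\<bar> \<le> \<delta>\<close>, which excludes the initial time for both variables.\<close>
  have pert: "\<bar>perturbation z y\<bar> \<le> \<kappa> / 2" if "z \<in> X" for z
  proof -
    have "\<bar>perturbation z y\<bar> \<le> (4 + 2 * T) * norm y"
      using that by (cases z) (auto simp: X_def intro: perturbation_bound)
    also have "\<dots> \<le> (4 + 2 * T) * (\<kappa> / (2 * (4 + 2 * T)))"
      using y T by (intro mult_left_mono) (auto simp: \<eta>_def)
    also have "\<dots> = \<kappa> / 2"
    proof -
      have "e * (\<kappa> / (2 * e)) = \<kappa> / 2" if "e > 0" for e :: real using that by simp
      then show ?thesis using T by (metis add_pos_pos mult_pos_pos zero_less_numeral)
    qed
    finally show ?thesis .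
  qed
  have "F x + perturbation x y \<le> F (T, T, \<mu>0, \<nu>0) + perturbation (T, T, \<mu>0, \<nu>0) y"
    using less[OF x0] by (cases "(T, T, \<mu>0, \<nu>0) = x") auto
  moreover have "F (T, T, \<mu>0, \<nu>0) = - 3 * \<kappa>"
    using \<kappa>(2) T by (simp add: F_def \<gamma>_def)
  ultimately have Fx: "F x \<le> - 2 * \<kappa>"
    using pert[OF xX] pert[OF x0] by (simp add: abs_le_iff)
  have Wx: "W x + (t - s)\<^sup>2 * k \<le> - 2 * \<kappa>"
  proof -
    have "0 \<le> \<gamma> * (t + s)" using \<gamma> ts by simp
    then show ?thesis using Fx by (simp add: F_def x_eq)
  qed
  have "\<bar>t - s\<bar> \<le> \<delta>"
  proof -
    have "(t - s)\<^sup>2 * k \<le> B"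
      using Wx w[OF xX] \<kappa> by (simp add: B_def)
    also have "\<dots> \<le> \<delta>\<^sup>2 * k" using \<delta> by (simp add: k_def)
    finally have "(t - s)\<^sup>2 \<le> \<delta>\<^sup>2" using k by simp
    then show ?thesis using \<delta> abs_le_square_iff[of "t - s" \<delta>] by simp
  qed
  moreover have "W (t, s, \<mu>, \<nu>) \<le> - \<kappa>"
  proof -
    have "0 \<le> (t - s)\<^sup>2 * k" using k by simp
    then show ?thesis using Wx \<kappa> by (simp add: x_eq)
  qed
  ultimately have "t \<noteq> 0" "s \<noteq> 0"
    using near_initial[of t s \<mu> \<nu>] xX by (auto simp: x_eq)
  then have pos: "t \<in> {0<..T}" "s \<in> {0<..T}" using ts by auto
  have C2: "torus_C2 (U t \<mu>)" "torus_C2 (V s \<nu>)"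
    using pos M1x M_solution_C2[OF U] M_solution_C2[OF V] by auto
  note C2w = wave_series_C2(1)[where 'n = 'n]
  have cw: "continuous_on UNIV (wave_series e :: 'n torus \<Rightarrow> real)" for e
    by (rule torus_C2_continuous(1)[OF C2w])

  \<comment> \<open>With one pair of variables frozen, the perturbed functional differs by a constant \<open>R\<close> from
      the functional that the definition of the other solution tests.\<close>
  define \<theta> where "\<theta> r = - ((r - s)\<^sup>2 * k + (\<gamma> + a) * r)" for r
  define \<theta>' where "\<theta>' r = - ((r - t)\<^sup>2 * k + (\<gamma> + a') * r)" for r
  have "strict_min_on ({0..T} \<times> M1)
      (\<lambda>(r, m). pair_diff (\<lambda>x. U r m x - (V s \<nu> x - wave_series c x)) m \<nu> - \<theta> r) (t, \<mu>)"
  proof -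
    define R where "R = \<gamma> * s + a' * s + (\<integral>x. wave_series d x \<partial>\<nu>) + (\<integral>x. wave_series c x \<partial>\<nu>)"
    have G: "pair_diff (\<lambda>x. U r m x - (V s \<nu> x - wave_series c x)) m \<nu> - \<theta> r
        = F (r, s, m, \<nu>) + perturbation (r, s, m, \<nu>) y - R" if "r \<in> {0..T}" "m \<in> M1" for r m
    proof -
      have "integrable q (U r m)" "integrable q (V s \<nu>)" "integrable q (wave_series c)" if "q \<in> M1" for q
        using that \<open>r \<in> {0..T}\<close> \<open>m \<in> M1\<close> ts M1x by (auto intro: intU intV M1_integrable cw)
      then show ?thesis
        using that ts M1x
        by (simp add: F_def W_eq pair_diff_def \<theta>_def R_def y_eq perturbation_def algebra_simps)
    qed
    show ?thesis
      unfolding strict_min_on_def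
    proof (intro conjI ballI impI)
      fix z assume z: "z \<in> {0..T} \<times> M1" "z \<noteq> (t, \<mu>)"
      obtain r m where "z = (r, m)" by (metis surj_pair)
      with z show "(case (t, \<mu>) of (r, m) \<Rightarrow> pair_diff (\<lambda>x. U r m x - (V s \<nu> x - wave_series c x)) m \<nu> - \<theta> r)
          < (case z of (r, m) \<Rightarrow> pair_diff (\<lambda>x. U r m x - (V s \<nu> x - wave_series c x)) m \<nu> - \<theta> r)"
        using less[of "(r, s, m, \<nu>)"] ts M1x G[OF ts(1) M1x(1)] G[of r m] by (auto simp: x_eq X_def)
    qed (use ts M1x in auto)
  qed
  from M_solution_at_strict_min[OF U T torus_C2_diff(1)[OF C2(2) C2w] M1x(2) _ pos(1) M1x(1) this]
  have 1: "- (2 * k * (t - s) + (\<gamma> + a)) \<ge>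
      pair_diff (\<lambda>x. f \<mu> x - H x (torus_grad (U t \<mu>) x) + \<sigma> * torus_lap (U t \<mu>) x) \<mu> \<nu> +
      pair_FP \<sigma> (\<lambda>x. U t \<mu> x - (V s \<nu> x - wave_series c x)) (\<lambda>x. DpH H x (torus_grad (U t \<mu>) x)) \<mu>"
    using quadratic_penalty_C1[of s k "\<gamma> + a"] unfolding \<theta>_def[abs_def] by simp
  have "strict_min_on ({0..T} \<times> M1)
      (\<lambda>(r, m). pair_diff (\<lambda>x. V r m x - (U t \<mu> x - wave_series d x)) m \<mu> - \<theta>' r) (s, \<nu>)"
  proof -
    define R where "R = \<gamma> * t + a * t + (\<integral>x. wave_series c x \<partial>\<mu>) + (\<integral>x. wave_series d x \<partial>\<mu>)"
    have G: "pair_diff (\<lambda>x. V r m x - (U t \<mu> x - wave_series d x)) m \<mu> - \<theta>' r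
        = F (t, r, \<mu>, m) + perturbation (t, r, \<mu>, m) y - R" if "r \<in> {0..T}" "m \<in> M1" for r m
    proof -
      have "integrable q (V r m)" "integrable q (U t \<mu>)" "integrable q (wave_series d)" if "q \<in> M1" for q
        using that \<open>r \<in> {0..T}\<close> \<open>m \<in> M1\<close> ts M1x by (auto intro: intU intV M1_integrable cw)
      then show ?thesis
        using that ts M1x
        by (simp add: F_def W_eq pair_diff_def \<theta>'_def R_def y_eq perturbation_def power2_commute[of t] algebra_simps)
    qed
    show ?thesis
      unfolding strict_min_on_def
    proof (intro conjI ballI impI)
      fix z assume z: "z \<in> {0..T} \<times> M1" "z \<noteq> (s, \<nu>)"
      obtain r m where "z = (r, m)" by (metis surj_pair)
      with z show "(case (s, \<nu>) of (r, m) \<Rightarrow> pair_diff (\<lambda>x. V r m x - (U t \<mu> x - wave_series d x)) m \<mu> - \<theta>' r)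
          < (case z of (r, m) \<Rightarrow> pair_diff (\<lambda>x. V r m x - (U t \<mu> x - wave_series d x)) m \<mu> - \<theta>' r)"
        using less[of "(t, r, \<mu>, m)"] ts M1x G[OF ts(2) M1x(2)] G[of r m] by (auto simp: x_eq X_def)
    qed (use ts M1x in auto)
  qed
  from M_solution_at_strict_min[OF V T torus_C2_diff(1)[OF C2(1) C2w] M1x(1) _ pos(2) M1x(2) this]
  have 2: "- (2 * k * (s - t) + (\<gamma> + a')) \<ge>
      pair_diff (\<lambda>x. f \<nu> x - H x (torus_grad (V s \<nu>) x) + \<sigma> * torus_lap (V s \<nu>) x) \<nu> \<mu> +
      pair_FP \<sigma> (\<lambda>x. V s \<nu> x - (U t \<mu> x - wave_series d x)) (\<lambda>x. DpH H x (torus_grad (V s \<nu>) x)) \<nu>"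
    using quadratic_penalty_C1[of t k "\<gamma> + a'"] unfolding \<theta>'_def[abs_def] by simp

  have fm: "pair_diff (\<lambda>x. f \<mu> x - f \<nu> x) \<mu> \<nu> \<ge> 0"
    using f(2) M1x by (simp add: monotone_M1_def)
  have "- 2 * (b * (2 * norm y) + \<sigma> * (2 * CARD('n) * norm y)) \<le>
      - (2 * k * (t - s) + (\<gamma> + a)) + - (2 * k * (s - t) + (\<gamma> + a'))"
  proof (rule order_trans[OF doubled_equation_lower_bound add_mono[OF 1 2]])
    show "norm (torus_grad (wave_series c) x) \<le> 2 * norm y" "norm (torus_grad (wave_series d) x) \<le> 2 * norm y"
      for x :: "'n torus"
      using wave_series_C2(3)[of c x] wave_series_C2(3)[of d x] ny by linarith+
    have "2 * real CARD('n) * norm e \<le> 2 * real CARD('n) * norm y" if "norm e \<le> norm y" for e :: "real \<Rightarrow>\<^sub>C real"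
      using that by (intro mult_left_mono) auto
    then show "\<bar>torus_lap (wave_series c) x\<bar> \<le> 2 * CARD('n) * norm y" "\<bar>torus_lap (wave_series d) x\<bar> \<le> 2 * CARD('n) * norm y"
      for x :: "'n torus"
      using wave_series_C2(4)[of c x] wave_series_C2(4)[of d x] ny by (auto intro: order_trans)
    show "norm (DpH H x (torus_grad (U t \<mu>) x)) \<le> b" "norm (DpH H x (torus_grad (V s \<nu>) x)) \<le> b" for x
      using b(2) CU[OF ts(1) M1x(1), of x] CV[OF ts(2) M1x(2), of x] by (simp_all add: le_max_iff_disj)
  qed (use M1x C2 C2w f fm H \<sigma> in auto)
  then have "2 * \<gamma> + a + a' \<le> K * norm y"
    by (simp add: K_def algebra_simps)
  then have "2 * \<gamma> \<le> (2 + K) * norm y"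
    using ny by (simp add: algebra_simps)
  also have "\<dots> \<le> (2 + K) * (\<gamma> / (2 + K))"
    using y K by (intro mult_left_mono) (auto simp: \<eta>_def)
  also have "\<dots> = \<gamma>" using K by simp
  finally show False using \<gamma> by simp
qed

section \<open>Uniqueness\<close>

text \<open>Minty's argument.  The inequality for \<open>\<mu>\<close> and \<open>(1 - p) \<mu> + p m\<close> is linear in \<open>p\<close> up to the argument of
\<open>V\<close>, which tends to \<open>\<mu>\<close> as \<open>p\<close> tends to 0.\<close>

lemma M_solutions_eq_if_cross_monotone:
  fixes U V :: "real \<Rightarrow> 'n::finite torus measure \<Rightarrow> 'n torus \<Rightarrow> real"
  assumes U: "M_solution \<sigma> H f U" and V: "M_solution \<sigma> H f V" and t: "t \<ge> 0"
    and UV: "\<And>\<mu> \<nu>. \<mu> \<in> M1 \<Longrightarrow> \<nu> \<in> M1 \<Longrightarrow> pair_diff (\<lambda>x. U t \<mu> x - V t \<nu> x) \<mu> \<nu> \<ge> 0"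
    and VU: "\<And>\<mu> \<nu>. \<mu> \<in> M1 \<Longrightarrow> \<nu> \<in> M1 \<Longrightarrow> pair_diff (\<lambda>x. V t \<mu> x - U t \<nu> x) \<mu> \<nu> \<ge> 0"
    and \<mu>: "\<mu> \<in> M1"
  shows "U t \<mu> x = V t \<mu> x"
proof -
  have half: "pair_diff (\<lambda>x. U t \<mu> x - V t \<mu> x) \<mu> m \<ge> 0"
    if U: "M_solution \<sigma> H f U" and V: "M_solution \<sigma> H f V"
      and UV: "\<And>\<mu> \<nu>. \<mu> \<in> M1 \<Longrightarrow> \<nu> \<in> M1 \<Longrightarrow> pair_diff (\<lambda>x. U t \<mu> x - V t \<nu> x) \<mu> \<nu> \<ge> 0"
      and m: "m \<in> M1" for U V :: "real \<Rightarrow> 'n torus measure \<Rightarrow> 'n torus \<Rightarrow> real" and m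
  proof -
    note cU = M_solution_continuous[OF U t] and cV = M_solution_continuous[OF V t]
    define p where "p n = 1 / real (Suc n)" for n
    have p: "0 < p n" "p n \<le> 1" for n by (simp_all add: p_def)
    have "\<exists>\<rho>\<in>M1. \<forall>F :: 'n torus \<Rightarrow> real. continuous_on UNIV F \<longrightarrow>
        (\<integral>x. F x \<partial>\<rho>) = p n * (\<integral>x. F x \<partial>m) + (1 - p n) * (\<integral>x. F x \<partial>\<mu>)" for n
      using M1_mixture[OF \<mu> m less_imp_le[OF p(1)] p(2)] .
    then obtain \<nu> where \<nu>: "\<And>n. \<nu> n \<in> M1"
      and mix: "\<And>n (F :: 'n torus \<Rightarrow> real). continuous_on UNIV F \<Longrightarrow>
        (\<integral>x. F x \<partial>\<nu> n) = p n * (\<integral>x. F x \<partial>m) + (1 - p n) * (\<integral>x. F x \<partial>\<mu>)"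
      by metis
    have "p \<longlonglongrightarrow> 0"
      unfolding p_def using LIMSEQ_Suc[OF lim_1_over_n] .
    have lim: "weak_tendsto \<nu> \<mu>"
      unfolding weak_tendsto_def
    proof (intro allI impI)
      fix F :: "'n torus \<Rightarrow> real" assume "continuous_on UNIV F"
      have "(\<lambda>n. p n * (\<integral>x. F x \<partial>m) + (1 - p n) * (\<integral>x. F x \<partial>\<mu>)) \<longlonglongrightarrow> 0 * (\<integral>x. F x \<partial>m) + (1 - 0) * (\<integral>x. F x \<partial>\<mu>)"
        by (intro tendsto_intros \<open>p \<longlonglongrightarrow> 0\<close>)
      then show "(\<lambda>n. \<integral>x. F x \<partial>\<nu> n) \<longlonglongrightarrow> (\<integral>x. F x \<partial>\<mu>)"
        by (simp add: mix[OF \<open>continuous_on UNIV F\<close>])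
    qed
    have const: "weak_tendsto (\<lambda>_. q) q" for q :: "'n torus measure"
      by (simp add: weak_tendsto_def)
    have ineq: "(\<integral>x. U t \<mu> x \<partial>\<mu>) - (\<integral>x. V t (\<nu> n) x \<partial>\<mu>) - ((\<integral>x. U t \<mu> x \<partial>m) - (\<integral>x. V t (\<nu> n) x \<partial>m)) \<ge> 0" for n
    proof -
      let ?g = "\<lambda>x. U t \<mu> x - V t (\<nu> n) x"
      have c: "continuous_on UNIV ?g"
        by (intro continuous_on_diff cU cV \<mu> \<nu>)
      have "0 \<le> pair_diff ?g \<mu> (\<nu> n)" by (rule UV[OF \<mu> \<nu>])
      also have "\<dots> = p n * ((\<integral>x. ?g x \<partial>\<mu>) - (\<integral>x. ?g x \<partial>m))"
        unfolding pair_diff_def mix[OF c] by (simp add: algebra_simps)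
      finally have "0 \<le> (\<integral>x. ?g x \<partial>\<mu>) - (\<integral>x. ?g x \<partial>m)"
        using p(1)[of n] by (simp add: zero_le_mult_iff)
      moreover have "integrable q (U t \<mu>)" "integrable q (V t (\<nu> n))" if "q \<in> M1" for q
        using that by (simp_all add: M1_integrable cU cV \<mu> \<nu>)
      ultimately show ?thesis using \<mu> m by simp
    qed
    have "(\<lambda>n. (\<integral>x. U t \<mu> x \<partial>\<mu>) - (\<integral>x. V t (\<nu> n) x \<partial>\<mu>) - ((\<integral>x. U t \<mu> x \<partial>m) - (\<integral>x. V t (\<nu> n) x \<partial>m)))
        \<longlonglongrightarrow> (\<integral>x. U t \<mu> x \<partial>\<mu>) - (\<integral>x. V t \<mu> x \<partial>\<mu>) - ((\<integral>x. U t \<mu> x \<partial>m) - (\<integral>x. V t \<mu> x \<partial>m))"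
      using t m \<mu> by (intro tendsto_diff tendsto_const M_solution_integral_tendsto[OF V _ _ lim \<nu> \<mu> const]) auto
    then have "0 \<le> (\<integral>x. U t \<mu> x \<partial>\<mu>) - (\<integral>x. V t \<mu> x \<partial>\<mu>) - ((\<integral>x. U t \<mu> x \<partial>m) - (\<integral>x. V t \<mu> x \<partial>m))"
      using ineq by (intro LIMSEQ_le_const) auto
    moreover have "integrable q (U t \<mu>)" "integrable q (V t \<mu>)" if "q \<in> M1" for q
      using that by (simp_all add: M1_integrable cU cV \<mu>)
    ultimately show ?thesis using \<mu> m by (simp add: pair_diff_def)
  qed
  define g where "g x = U t \<mu> x - V t \<mu> x" for x
  have gc: "continuous_on UNIV g"
    unfolding g_def by (intro continuous_on_diff M_solution_continuous[OF U t \<mu>] M_solution_continuous[OF V t \<mu>])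
  have eq: "(\<integral>x. g x \<partial>\<mu>) = (\<integral>x. g x \<partial>m)" if "m \<in> M1" for m
  proof -
    have "pair_diff g \<mu> m \<ge> 0"
      using half[OF U V UV that] by (simp add: g_def[abs_def])
    moreover have "pair_diff (\<lambda>x. - g x) \<mu> m \<ge> 0"
      using half[OF V U VU that] by (simp add: g_def)
    ultimately show ?thesis by (simp add: pair_diff_def)
  qed
  have "null_measure borel \<in> M1" by (simp add: M1_def)
  from eq[OF this] have "(\<integral>x. g x \<partial>\<mu>) = 0" by simp
  moreover have "return borel x \<in> M1"
    by (simp add: M1_def emeasure_return)
  from eq[OF this] have "(\<integral>x. g x \<partial>\<mu>) = g x"
    using borel_measurable_continuous_onI[OF gc] by (simp add: integral_return)
  ultimately show ?thesis by (simp add: g_def)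
qed

theorem theorem9p14:
  fixes \<sigma> :: real
    and H :: "'n::finite torus \<Rightarrow> real^'n \<Rightarrow> real"
    and f U0 :: "'n torus measure \<Rightarrow> 'n torus \<Rightarrow> real"
  assumes "\<sigma> > 0"
    and "C1_hamiltonian H"
    and "\<And>\<mu>. \<mu> \<in> M1 \<Longrightarrow> continuous_on UNIV (f \<mu>)"
    and "\<And>\<mu>. \<mu> \<in> M1 \<Longrightarrow> continuous_on UNIV (U0 \<mu>)"
    and "\<And>x. convex_on UNIV (H x)"
    and "monotone_M1 f"
    and "monotone_M1 U0"
  shows "(\<forall>U V. M_solution \<sigma> H f U \<and> (\<forall>\<mu>\<in>M1. \<forall>x. U 0 \<mu> x = U0 \<mu> x) \<and>
                M_solution \<sigma> H f V \<and> (\<forall>\<mu>\<in>M1. \<forall>x. V 0 \<mu> x = U0 \<mu> x) \<longrightarrow>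
                (\<forall>t\<ge>0. \<forall>\<mu>\<in>M1. \<forall>x. U t \<mu> x = V t \<mu> x)) \<and>
         (\<forall>U. M_solution \<sigma> H f U \<and> (\<forall>\<mu>\<in>M1. \<forall>x. U 0 \<mu> x = U0 \<mu> x) \<longrightarrow>
              (\<forall>t\<ge>0. monotone_M1 (U t)))"
proof -
  have cross: "pair_diff (\<lambda>x. U t \<mu> x - V t \<nu> x) \<mu> \<nu> \<ge> 0"
    if U: "M_solution \<sigma> H f U" "\<forall>\<mu>\<in>M1. \<forall>x. U 0 \<mu> x = U0 \<mu> x"
      and V: "M_solution \<sigma> H f V" "\<forall>\<mu>\<in>M1. \<forall>x. V 0 \<mu> x = U0 \<mu> x"
      and "t \<ge> 0" "\<mu> \<in> M1" "\<nu> \<in> M1" for U V t \<mu> \<nu>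
  proof -
    have init: "pair_diff (\<lambda>x. U 0 \<mu> x - V 0 \<nu> x) \<mu> \<nu> \<ge> 0" if "\<mu> \<in> M1" "\<nu> \<in> M1" for \<mu> \<nu>
      using \<open>monotone_M1 U0\<close> U(2) V(2) that by (simp add: monotone_M1_def)
    show ?thesis
    proof (cases "t = 0")
      case True
      then show ?thesis using init that by simp
    next
      case False
      then show ?thesis
        using M_solutions_cross_monotone[OF assms(1,2,5,3,6) U(1) V(1) init, of t \<mu> \<nu>] that by simp
    qed
  qed
  show ?thesis
  proof (intro conjI allI impI ballI)
    fix U V :: "real \<Rightarrow> 'n torus measure \<Rightarrow> 'n torus \<Rightarrow> real" and t
      and \<mu> :: "'n torus measure" and x
    assume UV: "M_solution \<sigma> H f U \<and> (\<forall>\<mu>\<in>M1. \<forall>x. U 0 \<mu> x = U0 \<mu> x) \<and>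
      M_solution \<sigma> H f V \<and> (\<forall>\<mu>\<in>M1. \<forall>x. V 0 \<mu> x = U0 \<mu> x)" and t: "t \<ge> (0::real)" and \<mu>: "\<mu> \<in> M1"
    show "U t \<mu> x = V t \<mu> x"
      by (rule M_solutions_eq_if_cross_monotone[OF _ _ t _ _ \<mu>]) (use UV t cross in blast)+
  next
    fix U and t :: real
    assume "M_solution \<sigma> H f U \<and> (\<forall>\<mu>\<in>M1. \<forall>x. U 0 \<mu> x = U0 \<mu> x)" "t \<ge> 0"
    then show "monotone_M1 (U t)"
      unfolding monotone_M1_def using cross by blast
  qed
qed

end
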